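(* Let $K$ be a field of characteristic zero and let $\mathfrak{M}$ be a polynilpotent variety of Lie algebras over $K$, that is $\mathfrak{M}=\mathfrak{N}_{c_k}\mathfrak{N}_{c_{k-1}}\cdots\mathfrak{N}_{c_1}$ for some $k\ge1$ and $c_1,\ldots,c_k\ge1$, such that $\mathfrak{M}\ne\mathfrak{A}$ and $\mathfrak{M}\neq\mathfrak{A}^2$. Then every free algebra of $\mathfrak{M}$ of rank $n\geq 2$ has absolutely wild automorphisms.
   Context: $\mathfrak{N}_c$ ($c\ge1$) is the variety of all nilpotent Lie algebras $G$ over $K$ with $G^{c+1}=0$ (where $G^1=G$, $G^{m+1}=[G^m,G]$); $\mathfrak{A}=\mathfrak{N}_1$ is the variety of abelian Lie algebras. The product $\mathfrak{U}\mathfrak{V}$ of varieties consists of the Lie algebras having an ideal in $\mathfrak{U}$ with quotient in $\mathfrak{V}$; in particular $\mathfrak{A}^2$ is the variety of metabelian Lie algebras. The free algebra of rank $n$ of $\mathfrak{N}_{c_k}\cdots\mathfrak{N}_{c_1}$ is $L_n/I$, where $L_n$ is the free Lie algebra on $x_1,\ldots,x_n$ and $I=(\ldots((L_n^{c_1+1})^{c_2+1})^{\ldots})^{c_k+1}$. Let $A$ be the free algebra of a variety $\mathfrak{M}$ of Lie algebras over $K$ on free generators $x_1,\ldots,x_n$, with grading $A=A_1\oplus A_2\oplus\cdots$, $A_m$ the linear span of monomials of degree $m$. $(f_1,\ldots,f_n)$ denotes the endomorphism $x_i\mapsto f_i$. An automorphism $(x_1,\ldots,x_{i-1},\alpha x_i+f,x_{i+1},\ldots,x_n)$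 with $0\ne\alpha\in K$ and $f$ in the subalgebra generated by the $x_j$, $j\ne i$, is called elementary; tame automorphisms are the elements of the subgroup of $\mathrm{Aut}(A)$ generated by all elementary automorphisms. For $m\ge1$, $\mathrm{IA}(m)$ is the group of automorphisms $\phi$ of $A$ with $\phi(x_j)-x_j\in A_{m+1}+A_{m+2}+\cdots$ for all $j$. An automorphism $\phi$ of $A$ is approximately tame if there is a sequence of tame automorphisms $\psi_m$ with $\phi\psi_m^{-1}\in\mathrm{IA}(m)$ for all $m$; it is absolutely wild if it is not approximately tame. *)

theory Defs
  imports "HOL-Algebra.Algebra" "HOL-Algebra.Algebraic_Closure_Type" "HOL.Hull"
begin

section \<open>Lie algebras\<close>

text \<open>
  The scalars form a type \<open>'k\<close> of class \<open>field\<close>, which is passed to the locales of HOL-Algebra as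
  the ring \<^const>\<open>ring_of_type_algebra\<close>. As in the locale \<^locale>\<open>algebra\<close>, an algebra is a \<open>module\<close>
  record whose field \<open>mult\<close> is the product, here the Lie bracket; the field \<open>one\<close> is unused.
\<close>

abbreviation scalars :: "'k::field ring"
  where "scalars \<equiv> ring_of_type_algebra"

locale lie_algebra = module scalars L
  for L :: "('k::field, 'a, 'm) module_scheme" (structure) +
  assumes bracket_closed:
      "\<lbrakk>x \<in> carrier L; y \<in> carrier L\<rbrakk> \<Longrightarrow> x \<otimes> y \<in> carrier L"
    and bracket_add_left:
      "\<lbrakk>x \<in> carrier L; y \<in> carrier L; z \<in> carrier L\<rbrakk> \<Longrightarrow> (x \<oplus> y) \<otimes> z = x \<otimes> z \<oplus> y \<otimes> z"
    and bracket_add_right: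
      "\<lbrakk>x \<in> carrier L; y \<in> carrier L; z \<in> carrier L\<rbrakk> \<Longrightarrow> x \<otimes> (y \<oplus> z) = x \<otimes> y \<oplus> x \<otimes> z"
    and bracket_smult_left:
      "\<lbrakk>x \<in> carrier L; y \<in> carrier L\<rbrakk> \<Longrightarrow> (a \<odot>\<^bsub>L\<^esub> x) \<otimes> y = a \<odot>\<^bsub>L\<^esub> (x \<otimes> y)"
    and bracket_smult_right:
      "\<lbrakk>x \<in> carrier L; y \<in> carrier L\<rbrakk> \<Longrightarrow> x \<otimes> (a \<odot>\<^bsub>L\<^esub> y) = a \<odot>\<^bsub>L\<^esub> (x \<otimes> y)"
    and bracket_self:
      "x \<in> carrier L \<Longrightarrow> x \<otimes> x = \<zero>"
    and jacobi:
      "\<lbrakk>x \<in> carrier L; y \<in> carrier L; z \<in> carrier L\<rbrakk> \<Longrightarrow>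
        (x \<otimes> y) \<otimes> z \<oplus> (y \<otimes> z) \<otimes> x \<oplus> (z \<otimes> x) \<otimes> y = \<zero>"

definition lin_span :: "('k::field, 'a) module \<Rightarrow> 'a set \<Rightarrow> 'a set"
  where "lin_span A S = (\<lambda>H. submodule H scalars A) hull S"

definition subalgebra_of :: "('k::field, 'a) module \<Rightarrow> 'a set \<Rightarrow> bool"
  where "subalgebra_of A H \<longleftrightarrow>
    submodule H scalars A \<and> (\<forall>x\<in>H. \<forall>y\<in>H. x \<otimes>\<^bsub>A\<^esub> y \<in> H)"

text \<open>Ideals are two-sided, so that the definition also applies to nonassociative algebras.\<close>

definition ideal_of :: "('k::field, 'a) module \<Rightarrow> 'a set \<Rightarrow> bool"
  where "ideal_of A I \<longleftrightarrow>
    submodule I scalars A \<and>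
    (\<forall>x\<in>I. \<forall>y\<in>carrier A. x \<otimes>\<^bsub>A\<^esub> y \<in> I \<and> y \<otimes>\<^bsub>A\<^esub> x \<in> I)"

text \<open>This extends \<^const>\<open>FactRing\<close> by the scalar multiplication of cosets.\<close>

definition quot_alg :: "('k::field, 'a) module \<Rightarrow> 'a set \<Rightarrow> ('k, 'a set) module"
  where "quot_alg A I =
    \<lparr>carrier = a_rcosets\<^bsub>A\<^esub> I, monoid.mult = rcoset_mult A I, one = I +>\<^bsub>A\<^esub> \<one>\<^bsub>A\<^esub>,
     ring.zero = I, add = set_add A, module.smult = (\<lambda>a C. \<Union>x\<in>C. I +>\<^bsub>A\<^esub> (a \<odot>\<^bsub>A\<^esub> x))\<rparr>"

text \<open>
  \<open>lie_power G H m\<close> is \<open>H\<^sup>m\<close> for \<open>m \<ge> 1\<close>, that is \<open>H\<^sup>1 = H\<close> and \<open>H\<^sup>m\<^sup>+\<^sup>1 = [H\<^sup>m, H]\<close>; the value at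
  \<open>m = 0\<close> is a convention. The brackets are taken in \<open>G\<close>.
\<close>

primrec lie_power :: "('k::field, 'a) module \<Rightarrow> 'a set \<Rightarrow> nat \<Rightarrow> 'a set"
  where
    "lie_power G H 0 = H"
  | "lie_power G H (Suc m) =
      (if m = 0 then H
       else lin_span G {x \<otimes>\<^bsub>G\<^esub> y |x y. x \<in> lie_power G H m \<and> y \<in> H})"


section \<open>Varieties\<close>

text \<open>
  A variety is represented by the set of its members among the Lie algebras whose carrier is a
  subset of a given type. Different varieties may have the same members over a small type (over
  \<open>unit\<close> there are only zero algebras); two varieties differ if and only if their sets of members
  are different over some type.
\<close>

definition nilpotent_variety :: "nat \<Rightarrow> ('k::field, 'a) module set"
  where "nilpotent_variety c =
    {G. lie_algebra G \<and> lie_power G (carrier G) (c + 1) = {\<zero>\<^bsub>G\<^esub>}}"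

definition abelian_variety :: "('k::field, 'a) module set"
  where "abelian_variety = nilpotent_variety 1"

text \<open>The quotients of an algebra over \<open>'a\<close> live over \<open>'a set\<close>.\<close>

definition variety_product ::
    "('k::field, 'a) module set \<Rightarrow> ('k, 'a set) module set \<Rightarrow> ('k, 'a) module set"
  where "variety_product U V =
    {G. lie_algebra G \<and> (\<exists>I. ideal_of G I \<and> G\<lparr>carrier := I\<rparr> \<in> U \<and> quot_alg G I \<in> V)}"

text \<open>
  The list \<open>[c\<^sub>1, \<dots>, c\<^sub>k]\<close> stands for the product of the varieties of nilpotent algebras of classes
  \<open>c\<^sub>k, \<dots>, c\<^sub>1\<close> in this order, bracketed to the left. The empty product consists of the zero
  algebras.
\<close>

fun polynilpotent_variety :: "nat list \<Rightarrow> ('k::field, 'a) module set"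
  where
    "polynilpotent_variety [] = {G. lie_algebra G \<and> carrier G = {\<zero>\<^bsub>G\<^esub>}}"
  | "polynilpotent_variety [c] = nilpotent_variety c"
  | "polynilpotent_variety (c # d # cs) =
      variety_product (polynilpotent_variety (d # cs)) (nilpotent_variety c)"


section \<open>Free algebras\<close>

datatype 'x magma = Gen 'x | Br "'x magma" "'x magma"

primrec magma_degree :: "'x magma \<Rightarrow> nat"
  where
    "magma_degree (Gen i) = 1"
  | "magma_degree (Br u v) = magma_degree u + magma_degree v"

text \<open>
  In the free nonassociative algebra on the generators \<open>1, \<dots>, n\<close>, an element is the finitely
  supported family of its coefficients, and the bracket extends \<^const>\<open>Br\<close> bilinearly.
\<close>

primrec nonassoc_mult :: "('x magma \<Rightarrow> 'k::field) \<Rightarrow> ('x magma \<Rightarrow> 'k) \<Rightarrow> 'x magma \<Rightarrow> 'k"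
  where
    "nonassoc_mult f g (Gen i) = 0"
  | "nonassoc_mult f g (Br u v) = f u * g v"

definition free_nonassoc :: "nat \<Rightarrow> ('k::field, nat magma \<Rightarrow> 'k) module"
  where "free_nonassoc n =
    \<lparr>carrier = {f. finite {w. f w \<noteq> 0} \<and> (\<forall>w. f w \<noteq> 0 \<longrightarrow> set_magma w \<subseteq> {1..n})},
     monoid.mult = nonassoc_mult, one = (\<lambda>w. 0),
     ring.zero = (\<lambda>w. 0), add = (\<lambda>f g w. f w + g w), module.smult = (\<lambda>a f w. a * f w)\<rparr>"

definition nonassoc_gen :: "nat \<Rightarrow> nat magma \<Rightarrow> 'k::field"
  where "nonassoc_gen i = (\<lambda>w. if w = Gen i then 1 else 0)"

definition lie_relations :: "('k::field, 'a) module \<Rightarrow> 'a set"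
  where "lie_relations A =
    {x \<otimes>\<^bsub>A\<^esub> x |x. x \<in> carrier A} \<union>
    {(x \<otimes>\<^bsub>A\<^esub> y) \<otimes>\<^bsub>A\<^esub> z \<oplus>\<^bsub>A\<^esub> (y \<otimes>\<^bsub>A\<^esub> z) \<otimes>\<^bsub>A\<^esub> x \<oplus>\<^bsub>A\<^esub> (z \<otimes>\<^bsub>A\<^esub> x) \<otimes>\<^bsub>A\<^esub> y |x y z.
      x \<in> carrier A \<and> y \<in> carrier A \<and> z \<in> carrier A}"

definition lie_ideal :: "nat \<Rightarrow> (nat magma \<Rightarrow> 'k::field) set"
  where "lie_ideal n = ideal_of (free_nonassoc n) hull lie_relations (free_nonassoc n)"

definition free_lie :: "nat \<Rightarrow> ('k::field, (nat magma \<Rightarrow> 'k) set) module"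
  where "free_lie n = quot_alg (free_nonassoc n) (lie_ideal n)"

definition free_lie_gen :: "nat \<Rightarrow> nat \<Rightarrow> (nat magma \<Rightarrow> 'k::field) set"
  where "free_lie_gen n i = lie_ideal n +>\<^bsub>free_nonassoc n\<^esub> nonassoc_gen i"

text \<open>For \<open>cs = [c\<^sub>1, \<dots>, c\<^sub>k]\<close>, the ideal obtained from \<open>L\<close> by raising it successively to the powers
  \<open>c\<^sub>1 + 1, \<dots>, c\<^sub>k + 1\<close>.\<close>

definition polynilpotent_ideal :: "('k::field, 'a) module \<Rightarrow> nat list \<Rightarrow> 'a set"
  where "polynilpotent_ideal L cs = foldl (\<lambda>H c. lie_power L H (c + 1)) (carrier L) cs"

definition free_polynilpotent ::
    "nat list \<Rightarrow> nat \<Rightarrow> ('k::field, (nat magma \<Rightarrow> 'k) set set) module"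
  where "free_polynilpotent cs n = quot_alg (free_lie n) (polynilpotent_ideal (free_lie n) cs)"

definition free_polynilpotent_gen ::
    "nat list \<Rightarrow> nat \<Rightarrow> nat \<Rightarrow> (nat magma \<Rightarrow> 'k::field) set set"
  where "free_polynilpotent_gen cs n i =
    polynilpotent_ideal (free_lie n) cs +>\<^bsub>free_lie n\<^esub> free_lie_gen n i"


section \<open>Automorphisms\<close>

definition alg_hom :: "('k::field, 'a) module \<Rightarrow> ('k, 'b) module \<Rightarrow> ('a \<Rightarrow> 'b) set"
  where "alg_hom A B =
    {\<phi>. \<phi> \<in> carrier A \<rightarrow> carrier B \<and>
      (\<forall>x\<in>carrier A. \<forall>y\<in>carrier A. \<phi> (x \<oplus>\<^bsub>A\<^esub> y) = \<phi> x \<oplus>\<^bsub>B\<^esub> \<phi> y) \<and>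
      (\<forall>a. \<forall>x\<in>carrier A. \<phi> (a \<odot>\<^bsub>A\<^esub> x) = a \<odot>\<^bsub>B\<^esub> \<phi> x) \<and>
      (\<forall>x\<in>carrier A. \<forall>y\<in>carrier A. \<phi> (x \<otimes>\<^bsub>A\<^esub> y) = \<phi> x \<otimes>\<^bsub>B\<^esub> \<phi> y)}"

definition alg_Aut :: "('k::field, 'a) module \<Rightarrow> ('a \<Rightarrow> 'a) monoid"
  where "alg_Aut A = BijGroup (carrier A) \<lparr>carrier := Bij (carrier A) \<inter> alg_hom A A\<rparr>"

text \<open>In the remaining definitions, \<open>A\<close> is an algebra with free generators \<open>x 1, \<dots>, x n\<close>.\<close>

definition elementary_automorphisms ::
    "('k::field, 'a) module \<Rightarrow> (nat \<Rightarrow> 'a) \<Rightarrow> nat \<Rightarrow> ('a \<Rightarrow> 'a) set"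
  where "elementary_automorphisms A x n =
    {\<phi> \<in> carrier (alg_Aut A). \<exists>i\<in>{1..n}. \<exists>\<alpha> f.
      \<alpha> \<noteq> 0 \<and> f \<in> subalgebra_of A hull (x ` ({1..n} - {i})) \<and>
      \<phi> (x i) = \<alpha> \<odot>\<^bsub>A\<^esub> x i \<oplus>\<^bsub>A\<^esub> f \<and>
      (\<forall>j\<in>{1..n} - {i}. \<phi> (x j) = x j)}"

definition tame_automorphisms ::
    "('k::field, 'a) module \<Rightarrow> (nat \<Rightarrow> 'a) \<Rightarrow> nat \<Rightarrow> ('a \<Rightarrow> 'a) set"
  where "tame_automorphisms A x n = generate (alg_Aut A) (elementary_automorphisms A x n)"

primrec eval_magma :: "('k::field, 'a) module \<Rightarrow> (nat \<Rightarrow> 'a) \<Rightarrow> nat magma \<Rightarrow> 'a"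
  where
    "eval_magma A x (Gen i) = x i"
  | "eval_magma A x (Br u v) = eval_magma A x u \<otimes>\<^bsub>A\<^esub> eval_magma A x v"

definition homogeneous_component ::
    "('k::field, 'a) module \<Rightarrow> (nat \<Rightarrow> 'a) \<Rightarrow> nat \<Rightarrow> nat \<Rightarrow> 'a set"
  where "homogeneous_component A x n m =
    lin_span A (eval_magma A x ` {w. set_magma w \<subseteq> {1..n} \<and> magma_degree w = m})"

text \<open>\<open>IA_group A x n m\<close> is \<open>IA(m)\<close>; the sum of the components of degree greater than \<open>m\<close> is the
  span of their union.\<close>

definition IA_group ::
    "('k::field, 'a) module \<Rightarrow> (nat \<Rightarrow> 'a) \<Rightarrow> nat \<Rightarrow> nat \<Rightarrow> ('a \<Rightarrow> 'a) set"
  where "IA_group A x n m =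
    {\<phi> \<in> carrier (alg_Aut A). \<forall>j\<in>{1..n}.
      \<phi> (x j) \<ominus>\<^bsub>A\<^esub> x j \<in> lin_span A (\<Union>d\<in>{m<..}. homogeneous_component A x n d)}"

definition approximately_tame ::
    "('k::field, 'a) module \<Rightarrow> (nat \<Rightarrow> 'a) \<Rightarrow> nat \<Rightarrow> ('a \<Rightarrow> 'a) \<Rightarrow> bool"
  where "approximately_tame A x n \<phi> \<longleftrightarrow>
    \<phi> \<in> carrier (alg_Aut A) \<and>
    (\<exists>\<psi> :: nat \<Rightarrow> 'a \<Rightarrow> 'a. \<forall>m\<ge>1.
      \<psi> m \<in> tame_automorphisms A x n \<and>
      \<phi> \<otimes>\<^bsub>alg_Aut A\<^esub> inv\<^bsub>alg_Aut A\<^esub> (\<psi> m) \<in> IA_group A x n m)"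

definition absolutely_wild ::
    "('k::field, 'a) module \<Rightarrow> (nat \<Rightarrow> 'a) \<Rightarrow> nat \<Rightarrow> ('a \<Rightarrow> 'a) \<Rightarrow> bool"
  where "absolutely_wild A x n \<phi> \<longleftrightarrow>
    \<phi> \<in> carrier (alg_Aut A) \<and> \<not> approximately_tame A x n \<phi>"

end

theory Submission
  imports Defs "HOL-Library.Product_Plus" "Jordan_Normal_Form.Determinant"
begin

text \<open>
  A hom from the free algebra to the affine Lie algebra of \<open>2 \<times> 2\<close> matrices acting on the plane, over
  \<open>K[t]\<close>, consists of a point (the matrix parts) and a tangent vector (the plane parts) of the images of
  the generators. The tangent parts define Jacobian matrices of tuples of Lie elements, for which the
  chain rule holds. An elementary automorphism has constant Jacobian determinant, hence so has some lift to
  the free nonassociative algebra of any tame automorphism. On the other hand, the relations of the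
  polynilpotent variety with classes \<open>c\<^sub>1, \<dots>, c\<^sub>k\<close> live in degrees at least \<open>\<Prod>(c\<^sub>i + 1)\<close> and therefore do not
  influence the determinant below a certain power of \<open>t\<close>, if matrices divisible by \<open>t\<close> are substituted.

  For \<open>n \<ge> 3\<close> and \<open>k \<ge> 2\<close>, let \<open>u\<close> be a word in \<open>x\<^sub>1, x\<^sub>2\<close> that lies in the last but one term of the
  polynilpotent series, and let \<open>y \<in> {x\<^sub>1, x\<^sub>2}\<close>. Then \<open>x\<^sub>3 \<mapsto> x\<^sub>3 + [y, [u, x\<^sub>3]]\<close> is an automorphism, because
  \<open>ad y \<circ> ad u\<close> is nilpotent and fixed by it; its Jacobian determinant begins with \<open>1 + tr(y u) t\<^sup>d\<close>,
  and \<open>y\<close>, \<open>u\<close> of small degree with nonzero trace exist. For \<open>k = 1\<close> the automorphism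
  \<open>x\<^sub>2 \<mapsto> x\<^sub>2 + [x\<^sub>1, x\<^sub>2]\<close> is treated in the same way. For \<open>n = 2\<close> tame automorphisms are linear, while
  the automorphism \<open>x\<^sub>i \<mapsto> x\<^sub>i + [u, x\<^sub>i]\<close> is not.
\<close>

section \<open>Nonassociative algebras, homomorphisms and quotients\<close>

text \<open>Derivatives of Lie elements live in the universal enveloping algebra, which is not
  commutative, so a Jacobian matrix over it has no ordinary determinant. A representation by 2 by 2
  matrices over \<open>K[t]\<close> restores one, and t records degrees. A derivative lowers degrees
  by one: with D the product of the \<open>c_i + 1\<close>, the entries are reliable only modulo
  t^(D-1). Hence the bound d + 2 \<le> D for reading off the coefficient of t^d.

  For k \<ge> 2 the word u is a commutator and its matrix has trace zero; the second factor y buys a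
  nonzero trace for one more degree. The generators x_1 and x_2 go to two of three matrices any two
  of which bracket to a multiple of the third, and y u is scalar if y and u have the same direction.
  For the classes [1, 1] the shortest such u has degree 3, so d = 4 = D and the bound fails; this is
  where the metabelian variety drops out. In rank 2 the words y and u, which must avoid one
  generator, could only be multiples of the other, whence the separate argument.\<close>

lemma scalars_simps [simp]:
  "carrier scalars = UNIV" "one scalars = 1" "ring.zero scalars = 0"
  "add scalars = (+)" "monoid.mult scalars = (*)"
  by (auto simp: ring_of_type_algebra_def fun_eq_iff)

text \<open>The bilinear part of the axioms of a Lie algebra. Tame automorphisms are lifted to the
  free nonassociative algebra, so homomorphisms, quotients and hulls are developed without the Lie
  identities.\<close>

locale nonassoc_algebra = module scalars A
  for A :: "('k::field, 'a) module" (structure) +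
  assumes mult_closed [simp, intro]:
      "\<lbrakk>x \<in> carrier A; y \<in> carrier A\<rbrakk> \<Longrightarrow> x \<otimes> y \<in> carrier A"
    and mult_add_left:
      "\<lbrakk>x \<in> carrier A; y \<in> carrier A; z \<in> carrier A\<rbrakk> \<Longrightarrow> (x \<oplus> y) \<otimes> z = x \<otimes> z \<oplus> y \<otimes> z"
    and mult_add_right:
      "\<lbrakk>x \<in> carrier A; y \<in> carrier A; z \<in> carrier A\<rbrakk> \<Longrightarrow> x \<otimes> (y \<oplus> z) = x \<otimes> y \<oplus> x \<otimes> z"
    and mult_smult_left:
      "\<lbrakk>x \<in> carrier A; y \<in> carrier A\<rbrakk> \<Longrightarrow> (a \<odot>\<^bsub>A\<^esub> x) \<otimes> y = a \<odot>\<^bsub>A\<^esub> (x \<otimes> y)"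
    and mult_smult_right:
      "\<lbrakk>x \<in> carrier A; y \<in> carrier A\<rbrakk> \<Longrightarrow> x \<otimes> (a \<odot>\<^bsub>A\<^esub> y) = a \<odot>\<^bsub>A\<^esub> (x \<otimes> y)"

lemma lie_algebra_iff:
  fixes A :: "('k::field, 'a) module"
  shows "lie_algebra A \<longleftrightarrow> nonassoc_algebra A \<and>
    (\<forall>x\<in>carrier A. x \<otimes>\<^bsub>A\<^esub> x = \<zero>\<^bsub>A\<^esub>) \<and>
    (\<forall>x\<in>carrier A. \<forall>y\<in>carrier A. \<forall>z\<in>carrier A.
      (x \<otimes>\<^bsub>A\<^esub> y) \<otimes>\<^bsub>A\<^esub> z \<oplus>\<^bsub>A\<^esub> (y \<otimes>\<^bsub>A\<^esub> z) \<otimes>\<^bsub>A\<^esub> x \<oplus>\<^bsub>A\<^esub> (z \<otimes>\<^bsub>A\<^esub> x) \<otimes>\<^bsub>A\<^esub> y = \<zero>\<^bsub>A\<^esub>)"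
  unfolding lie_algebra_def lie_algebra_axioms_def nonassoc_algebra_def nonassoc_algebra_axioms_def
  by auto

context nonassoc_algebra begin

lemma smult_in [simp, intro]: "x \<in> carrier A \<Longrightarrow> a \<odot>\<^bsub>A\<^esub> x \<in> carrier A"
  by (rule smult_closed) auto

lemma smult_add: "x \<in> carrier A \<Longrightarrow> y \<in> carrier A \<Longrightarrow>
    a \<odot>\<^bsub>A\<^esub> (x \<oplus> y) = a \<odot>\<^bsub>A\<^esub> x \<oplus> a \<odot>\<^bsub>A\<^esub> y"
  by (rule smult_r_distr) auto

lemma add_smult: "x \<in> carrier A \<Longrightarrow> (a + b) \<odot>\<^bsub>A\<^esub> x = a \<odot>\<^bsub>A\<^esub> x \<oplus> b \<odot>\<^bsub>A\<^esub> x"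
  using smult_l_distr[of a b x] by simp

lemma smult_smult: "x \<in> carrier A \<Longrightarrow> a \<odot>\<^bsub>A\<^esub> (b \<odot>\<^bsub>A\<^esub> x) = (a * b) \<odot>\<^bsub>A\<^esub> x"
  using smult_assoc1[of a b x] by simp

lemma one_smult [simp]: "x \<in> carrier A \<Longrightarrow> 1 \<odot>\<^bsub>A\<^esub> x = x"
  using smult_one[of x] by simp

lemma zero_smult [simp]: "x \<in> carrier A \<Longrightarrow> 0 \<odot>\<^bsub>A\<^esub> x = \<zero>"
  using smult_l_null[of x] by simp

lemma smult_zero [simp]: "a \<odot>\<^bsub>A\<^esub> \<zero> = \<zero>"
  using smult_r_null[of a] by simp

lemma minus_eq_smult: "x \<in> carrier A \<Longrightarrow> \<ominus> x = (-1) \<odot>\<^bsub>A\<^esub> x"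
  by (rule M.minus_equality) (metis add.left_inverse add_smult one_smult zero_smult smult_in)+

lemma mult_zero_left [simp]: "x \<in> carrier A \<Longrightarrow> \<zero> \<otimes> x = \<zero>"
  by (metis M.zero_closed mult_smult_left mult_closed zero_smult)

lemma mult_zero_right [simp]: "x \<in> carrier A \<Longrightarrow> x \<otimes> \<zero> = \<zero>"
  by (metis M.zero_closed mult_smult_right mult_closed zero_smult)

lemma submodule_iff: "submodule S scalars A \<longleftrightarrow> S \<subseteq> carrier A \<and> \<zero> \<in> S \<and>
    (\<forall>x\<in>S. \<forall>y\<in>S. x \<oplus> y \<in> S) \<and> (\<forall>a. \<forall>x\<in>S. a \<odot>\<^bsub>A\<^esub> x \<in> S)" (is "?L = ?R")
proof
  assume ?L
  from submoduleE[OF this] obtain x where "x \<in> S" and *: "S \<subseteq> carrier A"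
      "\<forall>x\<in>S. \<forall>y\<in>S. x \<oplus> y \<in> S" "\<forall>a. \<forall>x\<in>S. a \<odot>\<^bsub>A\<^esub> x \<in> S"
    by auto
  moreover have "0 \<odot>\<^bsub>A\<^esub> x \<in> S" using * \<open>x \<in> S\<close> by blast
  ultimately show ?R by (auto simp: subset_iff)
next
  assume ?R
  then show ?L
    by (intro submoduleI) (auto simp: minus_eq_smult subset_iff)
qed

lemma submoduleD:
  assumes "submodule S scalars A"
  shows "x \<in> S \<Longrightarrow> x \<in> carrier A" "\<zero> \<in> S" "x \<in> S \<Longrightarrow> y \<in> S \<Longrightarrow> x \<oplus> y \<in> S"
    "x \<in> S \<Longrightarrow> a \<odot>\<^bsub>A\<^esub> x \<in> S" "x \<in> S \<Longrightarrow> \<ominus> x \<in> S" "x \<in> S \<Longrightarrow> y \<in> S \<Longrightarrow> x \<ominus> y \<in> S"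
  using assms by (auto simp: submodule_iff minus_eq_smult a_minus_def subset_iff)

lemma submodule_carrier: "submodule (carrier A) scalars A"
  by (auto simp: submodule_iff)

lemma submodule_zero: "submodule {\<zero>} scalars A"
  by (auto simp: submodule_iff)

lemma submodule_Inter: "T \<noteq> {} \<Longrightarrow> \<forall>t\<in>T. submodule t scalars A \<Longrightarrow> submodule (\<Inter>T) scalars A"
proof -
  assume "T \<noteq> {}" and *: "\<forall>t\<in>T. submodule t scalars A"
  then obtain t where "t \<in> T" by blast
  with * have "t \<subseteq> carrier A" by (simp add: submodule_iff)
  with \<open>t \<in> T\<close> have "\<Inter>T \<subseteq> carrier A" by (rule Inter_lower[THEN subset_trans])
  with * show ?thesis by (simp add: submodule_iff)
qed

lemma subalgebra_carrier: "subalgebra_of A (carrier A)"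
  by (simp add: subalgebra_of_def submodule_carrier)

lemma ideal_carrier: "ideal_of A (carrier A)"
  by (simp add: ideal_of_def submodule_carrier)

lemma subalgebraI:
  assumes "S \<subseteq> carrier A" "\<zero> \<in> S" "\<And>x y. x \<in> S \<Longrightarrow> y \<in> S \<Longrightarrow> x \<oplus> y \<in> S"
    "\<And>a x. x \<in> S \<Longrightarrow> a \<odot>\<^bsub>A\<^esub> x \<in> S" "\<And>x y. x \<in> S \<Longrightarrow> y \<in> S \<Longrightarrow> x \<otimes> y \<in> S"
  shows "subalgebra_of A S"
  using assms by (simp add: subalgebra_of_def submodule_iff)

lemma idealI:
  assumes "submodule S scalars A" 
    "\<And>x y. x \<in> S \<Longrightarrow> y \<in> carrier A \<Longrightarrow> x \<otimes> y \<in> S" "\<And>x y. x \<in> S \<Longrightarrow> y \<in> carrier A \<Longrightarrow> y \<otimes> x \<in> S"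
  shows "ideal_of A S"
  using assms by (simp add: ideal_of_def)

end

text \<open>A hull is an intersection. The superset \<open>C\<close> makes the intersected family
  nonempty; an empty intersection would be \<open>UNIV\<close>, which need not lie in the
  carrier.\<close>

lemma hull_satisfies:
  assumes "S \<subseteq> C" "P C" "\<And>T. T \<noteq> {} \<Longrightarrow> \<forall>t\<in>T. P t \<Longrightarrow> P (\<Inter>T)"
  shows "P (P hull S)"
  unfolding hull_def by (rule assms(3)) (use assms in auto)

context nonassoc_algebra begin

lemma submodule_lin_span: "S \<subseteq> carrier A \<Longrightarrow> submodule (lin_span A S) scalars A"
  unfolding lin_span_def
  by (rule hull_satisfies[where C = "carrier A" and P = "\<lambda>H. submodule H scalars A"])
    (simp_all add: submodule_carrier submodule_Inter)

lemma lin_span_minimal: "S \<subseteq> T \<Longrightarrow> submodule T scalars A \<Longrightarrow> lin_span A S \<subseteq> T"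
  unfolding lin_span_def by (rule hull_minimal)

lemma lin_span_inc: "x \<in> S \<Longrightarrow> x \<in> lin_span A S"
  unfolding lin_span_def by (rule hull_inc)

lemma subalgebra_hull: "S \<subseteq> carrier A \<Longrightarrow> subalgebra_of A (subalgebra_of A hull S)"
  by (rule hull_satisfies[where C = "carrier A"])
    (simp_all add: subalgebra_carrier, auto intro: submodule_Inter simp: subalgebra_of_def)

lemma ideal_hull: "S \<subseteq> carrier A \<Longrightarrow> ideal_of A (ideal_of A hull S)"
  by (rule hull_satisfies[where C = "carrier A"])
    (simp_all add: ideal_carrier, auto intro: submodule_Inter simp: ideal_of_def)

end

section \<open>Homomorphisms: images, preimages, equalizers\<close>

locale algebra_hom = A: nonassoc_algebra A + B: nonassoc_algebra B
  for A :: "('k::field, 'a) module" and B :: "('k, 'b) module" +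
  fixes h
  assumes hom: "h \<in> alg_hom A B"
begin

lemma hom_closed [simp, intro]: "x \<in> carrier A \<Longrightarrow> h x \<in> carrier B"
  using hom by (auto simp: alg_hom_def)

lemma hom_add [simp]: "x \<in> carrier A \<Longrightarrow> y \<in> carrier A \<Longrightarrow> h (x \<oplus>\<^bsub>A\<^esub> y) = h x \<oplus>\<^bsub>B\<^esub> h y"
  using hom by (auto simp: alg_hom_def)

lemma hom_mult [simp]: "x \<in> carrier A \<Longrightarrow> y \<in> carrier A \<Longrightarrow> h (x \<otimes>\<^bsub>A\<^esub> y) = h x \<otimes>\<^bsub>B\<^esub> h y"
  using hom by (auto simp: alg_hom_def)

lemma hom_smult [simp]: "x \<in> carrier A \<Longrightarrow> h (a \<odot>\<^bsub>A\<^esub> x) = a \<odot>\<^bsub>B\<^esub> h x"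
  using hom by (auto simp: alg_hom_def)

lemma hom_zero [simp]: "h \<zero>\<^bsub>A\<^esub> = \<zero>\<^bsub>B\<^esub>"
  by (metis A.M.zero_closed A.zero_smult B.zero_smult hom_closed hom_smult)

lemma hom_uminus [simp]: "x \<in> carrier A \<Longrightarrow> h (\<ominus>\<^bsub>A\<^esub> x) = \<ominus>\<^bsub>B\<^esub> h x"
  by (simp add: A.minus_eq_smult B.minus_eq_smult)

lemma hom_minus [simp]: "x \<in> carrier A \<Longrightarrow> y \<in> carrier A \<Longrightarrow> h (x \<ominus>\<^bsub>A\<^esub> y) = h x \<ominus>\<^bsub>B\<^esub> h y"
  by (simp add: a_minus_def)

lemma submodule_preimage: "submodule T scalars B \<Longrightarrow> submodule {x \<in> carrier A. h x \<in> T} scalars A"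
  by (auto simp: A.submodule_iff B.submodule_iff)

lemma submodule_image: "submodule S scalars A \<Longrightarrow> submodule (h ` S) scalars B"
proof -
  assume "submodule S scalars A"
  note * = A.submoduleD[OF this]
  show ?thesis unfolding B.submodule_iff
  proof (intro conjI ballI allI)
    show "h ` S \<subseteq> carrier B" using * by auto
    show "\<zero>\<^bsub>B\<^esub> \<in> h ` S" using *(2) hom_zero by (metis imageI)
    fix x assume "x \<in> h ` S"
    then obtain x' where x': "x' \<in> S" "x = h x'" by auto
    show "a \<odot>\<^bsub>B\<^esub> x \<in> h ` S" for a
      using *(4)[OF x'(1), of a] *(1)[OF x'(1)] by (auto simp: x' simp flip: hom_smult)
    fix y assume "y \<in> h ` S"
    then obtain y' where y': "y' \<in> S" "y = h y'" by auto
    show "x \<oplus>\<^bsub>B\<^esub> y \<in> h ` S" 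
      using *(3)[OF x'(1) y'(1)] *(1)[OF x'(1)] *(1)[OF y'(1)] by (auto simp: x' y' simp flip: hom_add)
  qed
qed

lemma subalgebra_preimage: "subalgebra_of B T \<Longrightarrow> subalgebra_of A {x \<in> carrier A. h x \<in> T}"
  using submodule_preimage by (auto simp: subalgebra_of_def)

lemma subalgebra_image:
  assumes "subalgebra_of A S"
  shows "subalgebra_of B (h ` S)"
  unfolding subalgebra_of_def
proof (intro conjI ballI)
  show "submodule (h ` S) scalars B" using assms submodule_image by (auto simp: subalgebra_of_def)
  fix x y assume "x \<in> h ` S" "y \<in> h ` S"
  then obtain x' y' where *: "x' \<in> S" "x = h x'" "y' \<in> S" "y = h y'" by auto
  then have "x' \<otimes>\<^bsub>A\<^esub> y' \<in> S" "x' \<in> carrier A" "y' \<in> carrier A"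
    using assms A.submoduleD(1) by (auto simp: subalgebra_of_def)
  then show "x \<otimes>\<^bsub>B\<^esub> y \<in> h ` S" unfolding * by (metis hom_mult imageI)
qed

text \<open>The image of a subalgebra is a subalgebra, so the image of a generated subalgebra
  contains the one generated by the image. This later lifts the summand \<open>f\<close> of an
  elementary automorphism to an element avoiding the same generator.\<close>

lemma subalgebra_hull_image:
  assumes "S \<subseteq> carrier A" "y \<in> subalgebra_of B hull (h ` S)"
  obtains x where "x \<in> subalgebra_of A hull S" "x \<in> carrier A" "h x = y"
proof -
  have *: "subalgebra_of A (subalgebra_of A hull S)" by (rule A.subalgebra_hull) fact
  have "subalgebra_of B hull (h ` S) \<subseteq> h ` (subalgebra_of A hull S)"
    by (rule hull_minimal) (auto intro: hull_inc subalgebra_image *)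
  with assms(2) * show ?thesis
    using that by (auto simp: subalgebra_of_def dest: A.submoduleD(1))
qed

end

lemma algebra_homI: "nonassoc_algebra A \<Longrightarrow> nonassoc_algebra B \<Longrightarrow> h \<in> alg_hom A B \<Longrightarrow> algebra_hom A B h"
  by (simp add: algebra_hom_def algebra_hom_axioms_def)

lemma alg_hom_comp: "g \<in> alg_hom A B \<Longrightarrow> h \<in> alg_hom B C \<Longrightarrow> (\<lambda>x. h (g x)) \<in> alg_hom A C"
  by (auto simp: alg_hom_def Pi_iff)

lemma subalgebra_equalizer:
  assumes "algebra_hom A B g" "algebra_hom A B h"
  shows "subalgebra_of A {x \<in> carrier A. g x = h x}"
proof -
  interpret g: algebra_hom A B g by fact
  interpret h: algebra_hom A B h by fact
  show ?thesis by (rule g.A.subalgebraI) auto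
qed

text \<open>The axioms are checked on preimages. Preservation of zero is a separate hypothesis
  because it does not follow from \<open>alg_hom\<close> before \<open>B\<close> is known to be an
  abelian group.\<close>

lemma hom_image_nonassoc_algebra:
  fixes A :: "('k::field, 'a) module" and B :: "('k, 'b) module"
  assumes A: "nonassoc_algebra A" and h: "h \<in> alg_hom A B" and onto: "h ` carrier A = carrier B"
    and zero: "h \<zero>\<^bsub>A\<^esub> = \<zero>\<^bsub>B\<^esub>"
  shows "nonassoc_algebra B"
proof -
  interpret A: nonassoc_algebra A by fact
  have add: "x \<in> carrier A \<Longrightarrow> y \<in> carrier A \<Longrightarrow> h x \<oplus>\<^bsub>B\<^esub> h y = h (x \<oplus>\<^bsub>A\<^esub> y)"
    and mult: "x \<in> carrier A \<Longrightarrow> y \<in> carrier A \<Longrightarrow> h x \<otimes>\<^bsub>B\<^esub> h y = h (x \<otimes>\<^bsub>A\<^esub> y)"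
    and smult: "x \<in> carrier A \<Longrightarrow> a \<odot>\<^bsub>B\<^esub> h x = h (a \<odot>\<^bsub>A\<^esub> x)" for x y a
    using h by (auto simp: alg_hom_def)
  have E: "\<And>thesis. (\<And>x. x \<in> carrier A \<Longrightarrow> y = h x \<Longrightarrow> thesis) \<Longrightarrow> thesis" if "y \<in> carrier B" for y
    using that unfolding onto[symmetric] by auto
  have B: "h x \<in> carrier B" if "x \<in> carrier A" for x using that onto by auto
  have "abelian_group B"
  proof (rule abelian_groupI)
    fix x assume "x \<in> carrier B"
    from E[OF this] obtain x' where x: "x' \<in> carrier A" "x = h x'" .
    show "\<zero>\<^bsub>B\<^esub> \<oplus>\<^bsub>B\<^esub> x = x"
      using add[OF A.M.zero_closed x(1)] x by (simp add: zero)
    show "\<exists>y\<in>carrier B. y \<oplus>\<^bsub>B\<^esub> x = \<zero>\<^bsub>B\<^esub>"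
    proof
      show "h (\<ominus>\<^bsub>A\<^esub> x') \<oplus>\<^bsub>B\<^esub> x = \<zero>\<^bsub>B\<^esub>"
        using add[of "\<ominus>\<^bsub>A\<^esub> x'" x'] x by (simp add: A.M.l_neg zero)
      show "h (\<ominus>\<^bsub>A\<^esub> x') \<in> carrier B" using x by (simp add: B)
    qed
    fix y assume "y \<in> carrier B"
    from E[OF this] obtain y' where y: "y' \<in> carrier A" "y = h y'" .
    show "x \<oplus>\<^bsub>B\<^esub> y \<in> carrier B" using x y by (simp add: add B)
    show "x \<oplus>\<^bsub>B\<^esub> y = y \<oplus>\<^bsub>B\<^esub> x" using x y by (simp add: add A.M.add.m_comm)
    fix z assume "z \<in> carrier B"
    from E[OF this] obtain z' where z: "z' \<in> carrier A" "z = h z'" .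
    show "x \<oplus>\<^bsub>B\<^esub> y \<oplus>\<^bsub>B\<^esub> z = x \<oplus>\<^bsub>B\<^esub> (y \<oplus>\<^bsub>B\<^esub> z)"
      using x y z by (simp add: add A.M.add.m_assoc)
  next
    show "\<zero>\<^bsub>B\<^esub> \<in> carrier B" unfolding zero[symmetric] by (simp add: B)
  qed
  moreover have "module_axioms scalars B"
    unfolding module_axioms_def scalars_simps using B
    by (auto elim!: E simp: add mult smult A.smult_add A.add_smult A.smult_smult)
  ultimately have "module scalars B"
    using A.module_axioms by (simp add: module_def)
  moreover have "nonassoc_algebra_axioms B"
    unfolding nonassoc_algebra_axioms_def using B 
    by (auto elim!: E simp: add mult smult A.mult_add_left A.mult_add_right A.mult_smult_left
        A.mult_smult_right)
  ultimately show ?thesis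
    by (simp add: nonassoc_algebra_def)
qed

lemma lie_algebra_hom_image:
  fixes A :: "('k::field, 'a) module" and B :: "('k, 'b) module"
  assumes "algebra_hom A B h" and onto: "h ` carrier A = carrier B"
    and rel: "\<And>r. r \<in> lie_relations A \<Longrightarrow> h r = \<zero>\<^bsub>B\<^esub>"
  shows "lie_algebra B"
proof -
  interpret h: algebra_hom A B h by fact
  show ?thesis unfolding lie_algebra_iff
  proof (intro conjI ballI)
    show "nonassoc_algebra B" by unfold_locales
    fix x assume "x \<in> carrier B"
    then obtain x' where x [simp]: "x' \<in> carrier A" "x = h x'" unfolding onto[symmetric] by (rule imageE)
    have "x' \<otimes>\<^bsub>A\<^esub> x' \<in> lie_relations A" by (auto simp: lie_relations_def)
    then show "x \<otimes>\<^bsub>B\<^esub> x = \<zero>\<^bsub>B\<^esub>" using rel[of "x' \<otimes>\<^bsub>A\<^esub> x'"] by simp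
    fix y z assume "y \<in> carrier B" "z \<in> carrier B" 
    then obtain y' z' where [simp]: "y' \<in> carrier A" "y = h y'" "z' \<in> carrier A" "z = h z'"
      unfolding onto[symmetric] by (elim imageE)
    have "(x' \<otimes>\<^bsub>A\<^esub> y') \<otimes>\<^bsub>A\<^esub> z' \<oplus>\<^bsub>A\<^esub> (y' \<otimes>\<^bsub>A\<^esub> z') \<otimes>\<^bsub>A\<^esub> x' \<oplus>\<^bsub>A\<^esub> (z' \<otimes>\<^bsub>A\<^esub> x') \<otimes>\<^bsub>A\<^esub> y' \<in> lie_relations A"
      unfolding lie_relations_def by (rule UnI2, rule CollectI, (rule exI)+, (rule conjI)+, rule refl) simp_all
    from rel[OF this] show "(x \<otimes>\<^bsub>B\<^esub> y) \<otimes>\<^bsub>B\<^esub> z \<oplus>\<^bsub>B\<^esub> (y \<otimes>\<^bsub>B\<^esub> z) \<otimes>\<^bsub>B\<^esub> x \<oplus>\<^bsub>B\<^esub> (z \<otimes>\<^bsub>B\<^esub> x) \<otimes>\<^bsub>B\<^esub> y = \<zero>\<^bsub>B\<^esub>" 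
      by simp
  qed
qed

lemma (in nonassoc_algebra) lie_relations_subset: "lie_relations A \<subseteq> carrier A"
  by (auto simp: lie_relations_def)

lemma lie_algebra_relations:
  "lie_algebra A \<Longrightarrow> r \<in> lie_relations A \<Longrightarrow> r = \<zero>\<^bsub>A\<^esub>"
  by (auto simp: lie_relations_def lie_algebra_iff)

section \<open>Quotient algebras\<close>

context nonassoc_algebra begin

lemma ideal_abelian_subgroup: "ideal_of A I \<Longrightarrow> abelian_subgroup I A"
  by (intro abelian_subgroupI3 additive_subgroup.intro)
    (auto simp: ideal_of_def submodule_def intro: M.abelian_group_axioms)

lemma quot_hom:
  assumes I: "ideal_of A I"
  shows "(\<lambda>x. I +> x) \<in> alg_hom A (quot_alg A I)"
proof -
  interpret I: abelian_subgroup I A by (rule ideal_abelian_subgroup) fact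
  have sub: "submodule I scalars A" using I by (simp add: ideal_of_def)
  note D = submoduleD[OF sub]
  have eq: "I +> a = I +> b" if "a \<in> carrier A" "b \<in> carrier A" "a \<ominus> b \<in> I" for a b
  proof -
    have "a \<in> I +> b" using that I.a_rcos_module[OF that(2,1)] by (simp add: a_minus_def)
    from add.repr_independence[folded a_r_coset_def, OF this that(2) I.a_subgroup] show ?thesis by simp
  qed
  have mem: "\<exists>i\<in>I. c = i \<oplus> a" if "c \<in> I +> a" for c a
    using that by (auto simp: a_r_coset_def')
  have self: "a \<in> I +> a" if "a \<in> carrier A" for a
    by (rule I.a_rcos_self[OF that])
  show ?thesis unfolding alg_hom_def quot_alg_def
  proof (intro CollectI conjI ballI allI Pi_I; simp)
    fix x assume x: "x \<in> carrier A"
    show "I +> x \<in> a_rcosets I" using x I.a_subset by (rule a_rcosetsI[rotated])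
    show "I +> a \<odot>\<^bsub>A\<^esub> x = (\<Union>x\<in>I +> x. I +> a \<odot>\<^bsub>A\<^esub> x)" for a
    proof -
      \<comment> \<open>Scalar multiplication and product of cosets are unions over representatives.
        All cosets in such a union agree, so it collapses to a single one.\<close>
      have "I +> a \<odot>\<^bsub>A\<^esub> c = I +> a \<odot>\<^bsub>A\<^esub> x" if c: "c \<in> I +> x" for c
      proof -
        from mem[OF c] obtain i where i: "i \<in> I" "c = i \<oplus> x" by auto
        then have "a \<odot>\<^bsub>A\<^esub> c \<ominus> a \<odot>\<^bsub>A\<^esub> x = a \<odot>\<^bsub>A\<^esub> i"
          using x D(1) by (simp add: smult_add a_minus_def M.add.m_assoc M.r_neg)
        then show ?thesis using i x D by (intro eq) auto
      qed
      then have "(\<Union>c\<in>I +> x. I +> a \<odot>\<^bsub>A\<^esub> c) = (\<Union>c\<in>I +> x. I +> a \<odot>\<^bsub>A\<^esub> x)"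
        by (rule SUP_cong[OF refl])
      moreover have "I +> x \<noteq> {}" using self[OF x] by (metis emptyE)
      ultimately show ?thesis by (simp only: UN_constant if_False)
    qed
    fix y assume y: "y \<in> carrier A"
    show "I +> (x \<oplus> y) = (I +> x) <+> (I +> y)" using x y by (simp add: I.a_rcos_sum)
    show "I +> x \<otimes> y = rcoset_mult A I (I +> x) (I +> y)"
    proof -
      have "I +> c \<otimes> d = I +> x \<otimes> y" if c: "c \<in> I +> x" and d: "d \<in> I +> y" for c d
      proof -
        from mem[OF c] mem[OF d] obtain i j where i: "i \<in> I" "c = i \<oplus> x" and j: "j \<in> I" "d = j \<oplus> y" 
          by auto
        then have C: "i \<in> carrier A" "j \<in> carrier A" using D(1) by auto
        have "c \<otimes> d = (i \<otimes> (j \<oplus> y) \<oplus> x \<otimes> j) \<oplus> x \<otimes> y"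
          using x y C by (simp add: i j mult_add_left mult_add_right M.add.m_ac)
        then have "c \<otimes> d \<ominus> x \<otimes> y = i \<otimes> (j \<oplus> y) \<oplus> x \<otimes> j"
          using x y C by (simp add: a_minus_def M.add.m_assoc M.r_neg)
        moreover have "i \<otimes> (j \<oplus> y) \<oplus> x \<otimes> j \<in> I" 
          using I i j x y C by (intro D(3)) (auto simp: ideal_of_def)
        ultimately show ?thesis using x y C by (intro eq) (auto simp: i j)
      qed
      then have "rcoset_mult A I (I +> x) (I +> y) = (\<Union>c\<in>I +> x. \<Union>d\<in>I +> y. I +> x \<otimes> y)"
        unfolding rcoset_mult_def by (intro SUP_cong[OF refl])
      moreover have "I +> x \<noteq> {}" "I +> y \<noteq> {}" using self[OF x] self[OF y] by (metis emptyE)+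
      ultimately show ?thesis by (simp only: UN_constant if_False)
    qed
  qed
qed

lemma quot_onto: "(\<lambda>x. I +> x) ` carrier A = carrier (quot_alg A I)"
  by (auto simp: quot_alg_def A_RCOSETS_def')

lemma quot_algebra_hom:
  assumes I: "ideal_of A I"
  shows "algebra_hom A (quot_alg A I) (\<lambda>x. I +> x)"
proof -
  interpret I: abelian_subgroup I A by (rule ideal_abelian_subgroup) fact
  have "nonassoc_algebra (quot_alg A I)"
  proof (rule hom_image_nonassoc_algebra[OF nonassoc_algebra_axioms quot_hom[OF I] quot_onto])
    show "I +> \<zero> = \<zero>\<^bsub>quot_alg A I\<^esub>" using I.a_subset by (simp add: quot_alg_def)
  qed
  then show ?thesis using quot_hom[OF I] nonassoc_algebra_axioms by (intro algebra_homI)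
qed

lemma quot_kernel:
  assumes I: "ideal_of A I" and x: "x \<in> carrier A"
  shows "I +> x = \<zero>\<^bsub>quot_alg A I\<^esub> \<longleftrightarrow> x \<in> I"
proof -
  interpret I: abelian_subgroup I A by (rule ideal_abelian_subgroup) fact
  have "\<zero>\<^bsub>quot_alg A I\<^esub> = I" by (simp add: quot_alg_def)
  moreover have "I +> x = I \<Longrightarrow> x \<in> I" using I.a_rcos_self[OF x] by simp
  moreover have "x \<in> I \<Longrightarrow> I +> x = I" by (rule I.a_rcos_const)
  ultimately show ?thesis by metis
qed

end

section \<open>The free nonassociative algebra\<close>

definition magma_monomial :: "nat magma \<Rightarrow> nat magma \<Rightarrow> 'k::field"
  where "magma_monomial w = (\<lambda>v. if v = w then 1 else 0)"

lemma nonassoc_gen_monomial: "nonassoc_gen i = magma_monomial (Gen i)"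
  by (simp add: nonassoc_gen_def magma_monomial_def)

lemma free_nonassoc_sel [simp]:
  "monoid.mult (free_nonassoc n) = nonassoc_mult" "ring.zero (free_nonassoc n) = (\<lambda>w. 0)"
  "add (free_nonassoc n) = (\<lambda>f g w. f w + g w)" "module.smult (free_nonassoc n) = (\<lambda>a f w. a * f w)"
  by (simp_all add: free_nonassoc_def)

lemma in_carrier_free_nonassoc: "f \<in> carrier (free_nonassoc n) \<longleftrightarrow>
    finite {w. f w \<noteq> 0} \<and> (\<forall>w. f w \<noteq> 0 \<longrightarrow> set_magma w \<subseteq> {1..n})"
  by (simp add: free_nonassoc_def)

lemma magma_monomial_carrier:
  "set_magma w \<subseteq> {1..n} \<Longrightarrow> magma_monomial w \<in> carrier (free_nonassoc n)"
  by (simp add: in_carrier_free_nonassoc magma_monomial_def)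

lemma nonassoc_mult_apply:
  "nonassoc_mult f g w = (case w of Gen i \<Rightarrow> 0 | Br u v \<Rightarrow> f u * g v)"
  by (cases w) simp_all

lemma magma_monomial_Br:
  "magma_monomial (Br u v) = nonassoc_mult (magma_monomial u) (magma_monomial v)"
  by (auto simp: fun_eq_iff nonassoc_mult_apply magma_monomial_def split: magma.splits)

lemma nonassoc_algebra_free_nonassoc:
  "nonassoc_algebra (free_nonassoc n :: ('k::field, nat magma \<Rightarrow> 'k) module)"
proof -
  have add: "(\<lambda>w. f w + g w) \<in> carrier (free_nonassoc n)"
    if "f \<in> carrier (free_nonassoc n)" "g \<in> carrier (free_nonassoc n)" for f g :: "nat magma \<Rightarrow> 'k"
  proof -
    have "finite {w. f w + g w \<noteq> 0}"
      by (rule finite_subset[of _ "{w. f w \<noteq> 0} \<union> {w. g w \<noteq> 0}"])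
        (use that in \<open>auto simp: in_carrier_free_nonassoc\<close>)
    moreover have "set_magma w \<subseteq> {1..n}" if "f w + g w \<noteq> 0" for w
    proof -
      from that have "f w \<noteq> 0 \<or> g w \<noteq> 0" by auto
      then show ?thesis
        using \<open>f \<in> _\<close> \<open>g \<in> _\<close> unfolding in_carrier_free_nonassoc by metis
    qed
    ultimately show ?thesis by (simp add: in_carrier_free_nonassoc)
  qed
  have smult: "(\<lambda>w. a * f w) \<in> carrier (free_nonassoc n)"
    if "f \<in> carrier (free_nonassoc n)" for f :: "nat magma \<Rightarrow> 'k" and a
  proof -
    have "finite {w. a * f w \<noteq> 0}"
      by (rule finite_subset[of _ "{w. f w \<noteq> 0}"])
        (use that in \<open>auto simp: in_carrier_free_nonassoc\<close>)
    then show ?thesis using that by (simp add: in_carrier_free_nonassoc)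
  qed
  have mult: "nonassoc_mult f g \<in> carrier (free_nonassoc n)"
    if "f \<in> carrier (free_nonassoc n)" "g \<in> carrier (free_nonassoc n)" for f g :: "nat magma \<Rightarrow> 'k"
  proof -
    have "finite {w. nonassoc_mult f g w \<noteq> 0}"
    proof (rule finite_subset)
      show "{w. nonassoc_mult f g w \<noteq> 0} \<subseteq> (\<lambda>(u, v). Br u v) ` ({w. f w \<noteq> 0} \<times> {w. g w \<noteq> 0})"
      proof
        fix w assume "w \<in> {w. nonassoc_mult f g w \<noteq> 0}"
        then obtain u v where "w = Br u v" "f u \<noteq> 0" "g v \<noteq> 0" by (cases w) auto
        then show "w \<in> (\<lambda>(u, v). Br u v) ` ({w. f w \<noteq> 0} \<times> {w. g w \<noteq> 0})" by force
      qed
      show "finite ((\<lambda>(u, v). Br u v) ` ({w. f w \<noteq> 0} \<times> {w. g w \<noteq> 0}))"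
        using that by (simp add: in_carrier_free_nonassoc)
    qed
    moreover have "set_magma w \<subseteq> {1..n}" if "nonassoc_mult f g w \<noteq> 0" for w
      using that \<open>f \<in> _\<close> \<open>g \<in> _\<close> by (cases w) (simp_all add: in_carrier_free_nonassoc)
    ultimately show ?thesis by (simp add: in_carrier_free_nonassoc)
  qed
  have zero: "(\<lambda>w. 0::'k) \<in> carrier (free_nonassoc n)" by (simp add: in_carrier_free_nonassoc)
  have "abelian_group (free_nonassoc n :: ('k, nat magma \<Rightarrow> 'k) module)"
  proof (rule abelian_groupI)
    fix f :: "nat magma \<Rightarrow> 'k" assume "f \<in> carrier (free_nonassoc n)"
    then show "\<exists>y\<in>carrier (free_nonassoc n). y \<oplus>\<^bsub>free_nonassoc n\<^esub> f = \<zero>\<^bsub>free_nonassoc n\<^esub>"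
      by (intro bexI[of _ "\<lambda>w. (-1) * f w"] smult) simp
  qed (simp_all add: add zero ac_simps)
  moreover have "module_axioms scalars (free_nonassoc n :: ('k, nat magma \<Rightarrow> 'k) module)"
    unfolding module_axioms_def scalars_simps by (simp add: smult algebra_simps)
  ultimately have "module scalars (free_nonassoc n :: ('k, nat magma \<Rightarrow> 'k) module)"
    by (simp add: module_def cring_from_type_algebra)
  moreover have "nonassoc_algebra_axioms (free_nonassoc n :: ('k, nat magma \<Rightarrow> 'k) module)"
    unfolding nonassoc_algebra_axioms_def 
    by (auto simp: mult fun_eq_iff nonassoc_mult_apply algebra_simps split: magma.splits)
  ultimately show ?thesis by (simp add: nonassoc_algebra_def)
qed

interpretation free_nonassoc: nonassoc_algebra "free_nonassoc n" for n
  by (rule nonassoc_algebra_free_nonassoc)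

text \<open>The monomials span: a finitely supported \<open>f\<close> is assembled from the
  monomials of its support, one at a time.\<close>

lemma submodule_monomials:
  assumes S: "submodule S scalars (free_nonassoc n)"
    and f: "f \<in> carrier (free_nonassoc n)" and mono: "\<And>w. f w \<noteq> 0 \<Longrightarrow> magma_monomial w \<in> S"
  shows "f \<in> S"
proof -
  note D = free_nonassoc.submoduleD[OF S, simplified]
  \<comment> \<open>\<open>W\<close> only bounds the support, so the induction hypothesis applies to
    \<open>f(u := 0)\<close> whether or not \<open>f u\<close> vanishes.\<close>
  have "\<forall>f. {w. f w \<noteq> 0} \<subseteq> W \<longrightarrow> (\<forall>w. f w \<noteq> 0 \<longrightarrow> magma_monomial w \<in> S) \<longrightarrow> f \<in> S"
    if "finite W" for W
    using that
  proof induction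
    case empty
    then show ?case
    proof (intro allI impI)
      fix f :: "nat magma \<Rightarrow> 'a" assume "{w. f w \<noteq> 0} \<subseteq> {}"
      then have "f = (\<lambda>w. 0)" by (simp add: fun_eq_iff)
      then show "f \<in> S" using D(2) by simp
    qed
  next
    case (insert u W)
    show ?case
    proof (intro allI impI)
      fix f :: "nat magma \<Rightarrow> 'a" 
      assume f: "{w. f w \<noteq> 0} \<subseteq> insert u W" "\<forall>w. f w \<noteq> 0 \<longrightarrow> magma_monomial w \<in> S"
      define g where "g = f(u := 0)"
      have "{w. g w \<noteq> 0} \<subseteq> W" "\<forall>w. g w \<noteq> 0 \<longrightarrow> magma_monomial w \<in> S"
        using f by (auto simp: g_def)
      with insert.IH have "g \<in> S" by blast
      show "f \<in> S"
      proof (cases "f u = 0")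
        case True
        then have "f = g" by (simp add: g_def fun_upd_idem)
        with \<open>g \<in> S\<close> show ?thesis by simp
      next
        case False
        then have "(\<lambda>w. f u * magma_monomial u w) \<in> S" using f D(4) by blast
        from D(3)[OF \<open>g \<in> S\<close> this] 
        have "(\<lambda>w. g w + f u * magma_monomial u w) \<in> S" .
        moreover have "(\<lambda>w. g w + f u * magma_monomial u w) = f"
          by (auto simp: g_def magma_monomial_def)
        ultimately show ?thesis by simp
      qed
    qed
  qed
  from this[of "{w. f w \<noteq> 0}"] f mono show ?thesis by (simp add: in_carrier_free_nonassoc)
qed

lemma subalgebra_generators:
  assumes S: "subalgebra_of (free_nonassoc n) S" and gen: "\<And>i. i \<in> {1..n} \<Longrightarrow> nonassoc_gen i \<in> S"
  shows "S = carrier (free_nonassoc n)"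
proof
  show "S \<subseteq> carrier (free_nonassoc n)"
    using S by (simp add: subalgebra_of_def free_nonassoc.submodule_iff)
  have mono: "set_magma w \<subseteq> {1..n} \<Longrightarrow> magma_monomial w \<in> S" for w
  proof (induction w)
    case (Gen i)
    then show ?case using gen[of i] by (simp add: nonassoc_gen_monomial)
  next
    case (Br u v)
    then show ?case using S by (simp add: magma_monomial_Br subalgebra_of_def)
  qed
  show "carrier (free_nonassoc n) \<subseteq> S"
  proof
    fix f :: "nat magma \<Rightarrow> 'a" assume f: "f \<in> carrier (free_nonassoc n)"
    show "f \<in> S"
      by (rule submodule_monomials[OF _ f]) 
        (use S f mono in \<open>auto simp: subalgebra_of_def in_carrier_free_nonassoc\<close>)
  qed
qed

lemma eval_magma_closed:
  assumes "nonassoc_algebra B" "\<And>i. i \<in> {1..n} \<Longrightarrow> b i \<in> carrier B"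
  shows "set_magma w \<subseteq> {1..n::nat} \<Longrightarrow> eval_magma B b w \<in> carrier B"
proof -
  interpret B: nonassoc_algebra B by fact
  show "set_magma w \<subseteq> {1..n} \<Longrightarrow> ?thesis" using assms(2) by (induction w) simp_all
qed

lemma nonassoc_gen_carrier [simp]: "i \<in> {1..n} \<Longrightarrow> nonassoc_gen i \<in> carrier (free_nonassoc n)"
  by (simp add: nonassoc_gen_monomial magma_monomial_carrier)

lemma hom_monomial:
  assumes "nonassoc_algebra B" "h \<in> alg_hom (free_nonassoc n) B" "set_magma w \<subseteq> {1..n}"
  shows "h (magma_monomial w) = eval_magma B (\<lambda>i. h (nonassoc_gen i)) w"
proof -
  interpret h: algebra_hom "free_nonassoc n" B h
    using assms nonassoc_algebra_free_nonassoc by (intro algebra_homI)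
  show ?thesis using assms(3)
  proof (induction w)
    case (Br u v)
    then show ?case 
      using h.hom_mult[of "magma_monomial u" "magma_monomial v"]
      by (simp add: magma_monomial_Br magma_monomial_carrier)
  qed (simp add: nonassoc_gen_monomial)
qed

section \<open>The universal property of the free nonassociative algebra\<close>

definition free_ext :: "('k::field, 'a) module \<Rightarrow> (nat \<Rightarrow> 'a) \<Rightarrow> (nat magma \<Rightarrow> 'k) \<Rightarrow> 'a"
  where "free_ext B b f = (\<Oplus>\<^bsub>B\<^esub>w\<in>{w. f w \<noteq> 0}. f w \<odot>\<^bsub>B\<^esub> eval_magma B b w)"

context nonassoc_algebra begin

context
  fixes n and b :: "nat \<Rightarrow> 'a"
  assumes b: "\<And>i. i \<in> {1..n} \<Longrightarrow> b i \<in> carrier A"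
begin

lemma eval_closed: "set_magma w \<subseteq> {1..n} \<Longrightarrow> eval_magma A b w \<in> carrier A"
  by (rule eval_magma_closed[OF nonassoc_algebra_axioms, of n b]) (use b in simp_all)

text \<open>Terms outside the support vanish. A common index set for two supports reduces additivity
  of \<open>free_ext\<close> to additivity of finite sums.\<close>

lemma free_ext_eq:
  assumes "finite C" "{w. f w \<noteq> 0} \<subseteq> C" "\<And>w. w \<in> C \<Longrightarrow> set_magma w \<subseteq> {1..n}"
  shows "free_ext A b f = (\<Oplus>w\<in>C. f w \<odot>\<^bsub>A\<^esub> eval_magma A b w)"
  unfolding free_ext_def
  by (rule M.add.finprod_mono_neutral_cong_left) (use assms eval_closed in \<open>auto simp: Pi_iff\<close>)

lemma free_ext_monomial:
  "set_magma w \<subseteq> {1..n} \<Longrightarrow> free_ext A b (magma_monomial w) = eval_magma A b w"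
  using eval_closed[of w]
  by (subst free_ext_eq[of "{w}"]) (auto simp: magma_monomial_def)

lemma free_ext_closed: "f \<in> carrier (free_nonassoc n) \<Longrightarrow> free_ext A b f \<in> carrier A"
  unfolding free_ext_def
  by (rule M.finsum_closed) (simp add: Pi_iff in_carrier_free_nonassoc eval_closed)

lemma free_ext_add:
  assumes "f \<in> carrier (free_nonassoc n)" "g \<in> carrier (free_nonassoc n)"
  shows "free_ext A b (\<lambda>w. f w + g w) = free_ext A b f \<oplus> free_ext A b g"
proof -
  define C where "C = {w. f w \<noteq> 0} \<union> {w. g w \<noteq> 0}"
  have C: "finite C" "\<And>w. w \<in> C \<Longrightarrow> set_magma w \<subseteq> {1..n}"
    using assms by (auto simp: C_def in_carrier_free_nonassoc)
  have E: "\<And>w. w \<in> C \<Longrightarrow> eval_magma A b w \<in> carrier A" using C(2) eval_closed by simp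
  have sub: "{w. f w \<noteq> 0} \<subseteq> C" "{w. g w \<noteq> 0} \<subseteq> C" "{w. f w + g w \<noteq> 0} \<subseteq> C" by (auto simp: C_def)
  have "(\<Oplus>w\<in>C. (f w + g w) \<odot>\<^bsub>A\<^esub> eval_magma A b w) =
      (\<Oplus>w\<in>C. f w \<odot>\<^bsub>A\<^esub> eval_magma A b w \<oplus> g w \<odot>\<^bsub>A\<^esub> eval_magma A b w)"
    using E by (intro M.finsum_cong') (simp_all add: add_smult Pi_iff)
  also have "\<dots> = (\<Oplus>w\<in>C. f w \<odot>\<^bsub>A\<^esub> eval_magma A b w) \<oplus> (\<Oplus>w\<in>C. g w \<odot>\<^bsub>A\<^esub> eval_magma A b w)"
    using E by (intro M.finsum_addf) (simp_all add: Pi_iff)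
  finally show ?thesis
    using free_ext_eq[OF C(1) sub(1)] free_ext_eq[OF C(1) sub(2)] free_ext_eq[OF C(1) sub(3)] C(2)
    by simp
qed

lemma free_ext_smult:
  assumes "f \<in> carrier (free_nonassoc n)"
  shows "free_ext A b (\<lambda>w. a * f w) = a \<odot>\<^bsub>A\<^esub> free_ext A b f"
proof -
  define C where "C = {w. f w \<noteq> 0}"
  have C: "finite C" "\<And>w. w \<in> C \<Longrightarrow> set_magma w \<subseteq> {1..n}"
    using assms by (auto simp: C_def in_carrier_free_nonassoc)
  have E: "\<And>w. w \<in> C \<Longrightarrow> eval_magma A b w \<in> carrier A" using C(2) eval_closed by simp
  have sub: "{w. f w \<noteq> 0} \<subseteq> C" "{w. a * f w \<noteq> 0} \<subseteq> C" by (auto simp: C_def)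
  have "(\<Oplus>w\<in>C. (a * f w) \<odot>\<^bsub>A\<^esub> eval_magma A b w) =
      (\<Oplus>w\<in>C. a \<odot>\<^bsub>A\<^esub> (f w \<odot>\<^bsub>A\<^esub> eval_magma A b w))"
    using E by (intro M.finsum_cong') (simp_all add: smult_smult Pi_iff)
  also have "\<dots> = a \<odot>\<^bsub>A\<^esub> (\<Oplus>w\<in>C. f w \<odot>\<^bsub>A\<^esub> eval_magma A b w)"
    using E C by (intro finsum_smult_ldistr[symmetric]) (simp_all add: Pi_iff)
  finally show ?thesis
    using free_ext_eq[OF C(1) sub(1)] free_ext_eq[OF C(1) sub(2)] C(2) by simp
qed

lemma free_ext_zero: "free_ext A b (\<lambda>w. 0) = \<zero>"
  by (simp add: free_ext_def)

lemma free_ext_mult: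
  assumes f: "f \<in> carrier (free_nonassoc n)" and g: "g \<in> carrier (free_nonassoc n)"
  shows "free_ext A b (nonassoc_mult f g) = free_ext A b f \<otimes> free_ext A b g"
proof -
  let ?F = "free_nonassoc n :: ('k, nat magma \<Rightarrow> 'k) module"
  have [simp]: "x \<in> carrier ?F \<Longrightarrow> y \<in> carrier ?F \<Longrightarrow> nonassoc_mult x y \<in> carrier ?F" for x y
    using free_nonassoc.mult_closed[of x n y] by simp
  \<comment> \<open>Bilinearity is exploited one argument at a time: here the left factor is a
    monomial and the right one runs through a submodule; afterwards the left factor varies as
    well.\<close>
  have *: "g \<in> {g \<in> carrier ?F. free_ext A b (nonassoc_mult (magma_monomial u) g) =
      eval_magma A b u \<otimes> free_ext A b g}" if u: "set_magma u \<subseteq> {1..n}" for u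
  proof (rule submodule_monomials[OF _ g])
    show "submodule {g \<in> carrier ?F. free_ext A b (nonassoc_mult (magma_monomial u) g) =
        eval_magma A b u \<otimes> free_ext A b g} scalars ?F"
      unfolding free_nonassoc.submodule_iff
    proof (intro conjI ballI allI)
      note simps = free_ext_add free_ext_smult free_ext_closed mult_add_right mult_smult_right
        magma_monomial_carrier[OF u] eval_closed[OF u] free_ext_zero
      note F = free_nonassoc.M.zero_closed[of n, simplified] free_nonassoc.M.a_closed[of _ n, simplified]
        free_nonassoc.smult_in[of _ n, simplified]
      note mu = free_nonassoc.mult_add_right[of "magma_monomial u" n, simplified]
        free_nonassoc.mult_smult_right[of "magma_monomial u" n, simplified]
        free_nonassoc.mult_zero_right[of "magma_monomial u" n, simplified]
      let ?S = "{g \<in> carrier ?F. free_ext A b (nonassoc_mult (magma_monomial u) g) =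
        eval_magma A b u \<otimes> free_ext A b g}"
      show "\<zero>\<^bsub>?F\<^esub> \<in> ?S" by (simp add: simps F mu)
      fix x assume "x \<in> ?S"
      then show "a \<odot>\<^bsub>?F\<^esub> x \<in> ?S" for a by (simp add: simps F mu)
      fix y assume "y \<in> ?S"
      with \<open>x \<in> ?S\<close> show "x \<oplus>\<^bsub>?F\<^esub> y \<in> ?S" by (simp add: simps F mu)
    qed auto
    fix w assume "g w \<noteq> 0"
    then have w: "set_magma w \<subseteq> {1..n}" using g by (simp add: in_carrier_free_nonassoc)
    then show "magma_monomial w \<in> {g \<in> carrier ?F. free_ext A b (nonassoc_mult (magma_monomial u) g) =
        eval_magma A b u \<otimes> free_ext A b g}"
      using u by (simp add: magma_monomial_carrier free_ext_monomial flip: magma_monomial_Br)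
  qed
  have "f \<in> {f \<in> carrier ?F. free_ext A b (nonassoc_mult f g) = free_ext A b f \<otimes> free_ext A b g}"
  proof (rule submodule_monomials[OF _ f])
    show "submodule {f \<in> carrier ?F. free_ext A b (nonassoc_mult f g) =
        free_ext A b f \<otimes> free_ext A b g} scalars ?F"
      unfolding free_nonassoc.submodule_iff
    proof (intro conjI ballI allI)
      note simps = free_ext_add free_ext_smult free_ext_closed mult_add_left mult_smult_left
        g free_ext_zero
      note F = free_nonassoc.M.zero_closed[of n, simplified] free_nonassoc.M.a_closed[of _ n, simplified]
        free_nonassoc.smult_in[of _ n, simplified]
      note mu = free_nonassoc.mult_add_left[of _ n _ g, simplified]
        free_nonassoc.mult_smult_left[of _ n g, simplified]
        free_nonassoc.mult_zero_left[of g n, simplified]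
      let ?S = "{f \<in> carrier ?F. free_ext A b (nonassoc_mult f g) = free_ext A b f \<otimes> free_ext A b g}"
      show "\<zero>\<^bsub>?F\<^esub> \<in> ?S" by (simp add: simps F mu)
      fix x assume "x \<in> ?S"
      then show "a \<odot>\<^bsub>?F\<^esub> x \<in> ?S" for a by (simp add: simps F mu)
      fix y assume "y \<in> ?S"
      with \<open>x \<in> ?S\<close> show "x \<oplus>\<^bsub>?F\<^esub> y \<in> ?S" by (simp add: simps F mu)
    qed auto
    fix w assume "f w \<noteq> 0"
    then have w: "set_magma w \<subseteq> {1..n}" using f by (simp add: in_carrier_free_nonassoc)
    then show "magma_monomial w \<in> {f \<in> carrier ?F. free_ext A b (nonassoc_mult f g) = free_ext A b f \<otimes> free_ext A b g}"
      using *[OF w] by (simp add: magma_monomial_carrier free_ext_monomial)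
  qed
  then show ?thesis by simp
qed

lemma free_ext_hom: "free_ext A b \<in> alg_hom (free_nonassoc n) A"
  by (simp add: alg_hom_def free_ext_closed free_ext_add free_ext_smult free_ext_mult)

lemma free_ext_gen: "i \<in> {1..n} \<Longrightarrow> free_ext A b (nonassoc_gen i) = b i"
  by (simp add: nonassoc_gen_monomial free_ext_monomial)

lemma free_ext_algebra_hom: "algebra_hom (free_nonassoc n) A (free_ext A b)"
  by (intro algebra_homI nonassoc_algebra_free_nonassoc nonassoc_algebra_axioms free_ext_hom)

end

end

lemma free_hom_unique:
  assumes "algebra_hom (free_nonassoc n) B g" "algebra_hom (free_nonassoc n) B h"
    and "\<And>i. i \<in> {1..n} \<Longrightarrow> g (nonassoc_gen i) = h (nonassoc_gen i)"
    and "f \<in> carrier (free_nonassoc n)"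
  shows "g f = h f"
  using subalgebra_generators[OF subalgebra_equalizer[OF assms(1,2)]] assms(3,4) by auto

section \<open>Lie powers and polynilpotent series\<close>

lemma (in nonassoc_algebra) minus_eq_zero_iff:
  assumes "x \<in> carrier A" "y \<in> carrier A"
  shows "x \<ominus> y = \<zero> \<longleftrightarrow> x = y"
proof
  assume "x \<ominus> y = \<zero>"
  then have "\<ominus> (\<ominus> y) = x" using assms by (intro M.minus_equality) (simp_all add: a_minus_def)
  then show "x = y" using assms by simp
qed (use assms in \<open>simp add: a_minus_def M.r_neg\<close>)

locale lie = nonassoc_algebra A for A :: "('k::field, 'a) module" (structure) +
  assumes lie_algebra: "lie_algebra A"
begin

lemma bracket_self: "x \<in> carrier A \<Longrightarrow> x \<otimes> x = \<zero>"
  using lie_algebra by (simp add: lie_algebra_iff)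

lemma bracket_anticomm:
  assumes "x \<in> carrier A" "y \<in> carrier A"
  shows "y \<otimes> x = \<ominus> (x \<otimes> y)"
proof -
  have "\<zero> = (x \<oplus> y) \<otimes> (x \<oplus> y)" using assms by (simp add: bracket_self)
  also have "\<dots> = x \<otimes> (x \<oplus> y) \<oplus> y \<otimes> (x \<oplus> y)" using assms by (intro mult_add_left) simp_all
  also have "\<dots> = y \<otimes> x \<oplus> x \<otimes> y"
    using assms by (simp add: mult_add_right bracket_self M.add.m_comm)
  finally show ?thesis using assms by (intro M.minus_equality[symmetric]) simp_all
qed

lemma mult_uminus_left: "x \<in> carrier A \<Longrightarrow> y \<in> carrier A \<Longrightarrow> (\<ominus> x) \<otimes> y = \<ominus> (x \<otimes> y)"
  by (simp add: minus_eq_smult mult_smult_left)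

lemma mult_uminus_right: "x \<in> carrier A \<Longrightarrow> y \<in> carrier A \<Longrightarrow> x \<otimes> (\<ominus> y) = \<ominus> (x \<otimes> y)"
  by (simp add: minus_eq_smult mult_smult_right)

text \<open>The Jacobi identity, rearranged by anticommutativity into the rule that bracketing with
  \<open>z\<close> is a derivation.\<close>

lemma bracket_right_derivation:
  assumes x: "x \<in> carrier A" and y: "y \<in> carrier A" and z: "z \<in> carrier A"
  shows "(x \<otimes> y) \<otimes> z = (x \<otimes> z) \<otimes> y \<oplus> x \<otimes> (y \<otimes> z)"
proof -
  have "(x \<otimes> y) \<otimes> z \<oplus> (y \<otimes> z) \<otimes> x \<oplus> (z \<otimes> x) \<otimes> y = \<zero>"
    using lie_algebra x y z by (simp add: lie_algebra_iff)
  moreover have "(y \<otimes> z) \<otimes> x = \<ominus> (x \<otimes> (y \<otimes> z))"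
    using x y z by (intro bracket_anticomm) simp_all
  moreover have "(z \<otimes> x) \<otimes> y = \<ominus> ((x \<otimes> z) \<otimes> y)"
    using x y z by (simp add: bracket_anticomm[of x z] mult_uminus_left)
  ultimately have "(x \<otimes> y) \<otimes> z \<oplus> (\<ominus> (x \<otimes> (y \<otimes> z)) \<oplus> \<ominus> ((x \<otimes> z) \<otimes> y)) = \<zero>"
    using x y z by (simp add: M.add.m_assoc)
  then have "(x \<otimes> y) \<otimes> z \<oplus> \<ominus> ((x \<otimes> z) \<otimes> y \<oplus> x \<otimes> (y \<otimes> z)) = \<zero>"
    using x y z by (simp add: M.minus_add M.add.m_comm)
  then show ?thesis
    using x y z minus_eq_zero_iff[of "(x \<otimes> y) \<otimes> z" "(x \<otimes> z) \<otimes> y \<oplus> x \<otimes> (y \<otimes> z)"]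
    by (simp add: a_minus_def)
qed

lemma bracket_left_derivation:
  assumes x: "x \<in> carrier A" and y: "y \<in> carrier A" and z: "z \<in> carrier A"
  shows "x \<otimes> (y \<otimes> z) = (x \<otimes> y) \<otimes> z \<oplus> y \<otimes> (x \<otimes> z)"
proof -
  have "(y \<otimes> x) \<otimes> z \<oplus> (x \<otimes> y) \<otimes> z = \<zero>"
    using x y z by (simp add: bracket_anticomm[of x y] mult_uminus_left M.l_neg)
  moreover have "(x \<otimes> y) \<otimes> z \<oplus> y \<otimes> (x \<otimes> z) = x \<otimes> (y \<otimes> z)"
  proof -
    have "(y \<otimes> z) \<otimes> x = (y \<otimes> x) \<otimes> z \<oplus> y \<otimes> (z \<otimes> x)" by (rule bracket_right_derivation) fact+
    then have "\<ominus> (x \<otimes> (y \<otimes> z)) = \<ominus> ((x \<otimes> y) \<otimes> z) \<oplus> \<ominus> (y \<otimes> (x \<otimes> z))"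
      using x y z by (simp add: bracket_anticomm[of x "y \<otimes> z"] bracket_anticomm[of x y] bracket_anticomm[of x z]
          mult_uminus_left mult_uminus_right)
    then have "\<ominus> (x \<otimes> (y \<otimes> z)) = \<ominus> ((x \<otimes> y) \<otimes> z \<oplus> y \<otimes> (x \<otimes> z))"
      using x y z by (simp add: M.minus_add)
    then show ?thesis using x y z by (metis M.minus_minus M.a_closed mult_closed)
  qed
  ultimately show ?thesis by simp
qed

lemma lie_power_submodule: "submodule H scalars A \<Longrightarrow> submodule (lie_power A H m) scalars A"
proof (induction m)
  case (Suc m)
  then show ?case
    by (auto intro!: submodule_lin_span dest: submoduleD(1))
qed simp

lemma lie_power_bracket:
  assumes "submodule H scalars A" "m \<ge> 1" "x \<in> lie_power A H m" "y \<in> H"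
  shows "x \<otimes> y \<in> lie_power A H (Suc m)"
  using assms by (auto intro!: lin_span_inc)

lemma lie_power_induct:
  assumes H: "submodule H scalars A" and m: "m \<ge> 1" and T: "submodule T scalars A"
    and gen: "\<And>x y. x \<in> lie_power A H m \<Longrightarrow> y \<in> H \<Longrightarrow> x \<otimes> y \<in> T"
  shows "lie_power A H (Suc m) \<subseteq> T"
  using m by simp (rule lin_span_minimal[OF _ T], use gen in blast)

lemma idealD:
  assumes "ideal_of A I"
  shows "submodule I scalars A" "x \<in> I \<Longrightarrow> y \<in> carrier A \<Longrightarrow> x \<otimes> y \<in> I"
    "x \<in> I \<Longrightarrow> y \<in> carrier A \<Longrightarrow> y \<otimes> x \<in> I" "x \<in> I \<Longrightarrow> x \<in> carrier A"
  using assms submoduleD(1) by (auto simp: ideal_of_def)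

lemma lie_idealI:
  assumes "submodule S scalars A" "\<And>x y. x \<in> S \<Longrightarrow> y \<in> carrier A \<Longrightarrow> x \<otimes> y \<in> S"
  shows "ideal_of A S"
proof (rule idealI[OF assms])
  fix x y assume "x \<in> S" "y \<in> carrier A"
  then show "y \<otimes> x \<in> S"
    using assms(2)[of x y] submoduleD[OF assms(1)] bracket_anticomm[of x y] by simp
qed

text \<open>By the derivation rule, \<open>(x y) z\<close> splits into \<open>(x z) y\<close>, where
  \<open>x z\<close> stays in the previous power by induction, and \<open>x (y z)\<close>, where
  \<open>y z\<close> stays in the ideal \<open>H\<close>.\<close>

lemma lie_power_ideal:
  assumes H: "ideal_of A H"
  shows "ideal_of A (lie_power A H m)"
proof (induction m)
  case 0
  then show ?case using H by simp
next
  case (Suc m)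
  show ?case
  proof (cases "m = 0")
    case True
    then show ?thesis using H by simp
  next
    case False
    let ?P = "lie_power A H (Suc m)"
    have sub: "submodule ?P scalars A" by (rule lie_power_submodule[OF idealD(1)[OF H]])
    note D = submoduleD[OF sub] and C = idealD(4)[OF H] idealD(4)[OF Suc]
    have "?P \<subseteq> {x \<in> ?P. \<forall>y\<in>carrier A. x \<otimes> y \<in> ?P}"
    proof (rule lie_power_induct[OF idealD(1)[OF H]])
      show "1 \<le> m" using False by simp
      show "submodule {x \<in> ?P. \<forall>y\<in>carrier A. x \<otimes> y \<in> ?P} scalars A"
        unfolding submodule_iff using D
        by (auto simp: mult_add_left mult_smult_left simp del: lie_power.simps)
      fix x y assume x: "x \<in> lie_power A H m" and y: "y \<in> H"
      have b: "x \<otimes> y \<in> ?P" if "x \<in> lie_power A H m" "y \<in> H" for x y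
        using lie_power_bracket[OF idealD(1)[OF H] _ that] False by simp
      have "(x \<otimes> y) \<otimes> z \<in> ?P" if z: "z \<in> carrier A" for z
      proof -
        have "(x \<otimes> z) \<otimes> y \<in> ?P" "x \<otimes> (y \<otimes> z) \<in> ?P"
          using x y z idealD[OF H] idealD[OF Suc] by (auto intro!: b simp del: lie_power.simps)
        then show ?thesis
          using bracket_right_derivation[of x y z] x y z C D(3) by (simp del: lie_power.simps)
      qed
      then show "x \<otimes> y \<in> {x \<in> ?P. \<forall>y\<in>carrier A. x \<otimes> y \<in> ?P}"
        using b[OF x y] by (simp del: lie_power.simps)
    qed
    then show ?thesis
      by (intro lie_idealI sub) (auto simp del: lie_power.simps)
  qed
qed

lemma lie_power_decreasing:
  assumes H: "ideal_of A H" and m: "m \<ge> 1"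
  shows "lie_power A H (Suc m) \<subseteq> lie_power A H m"
proof (rule lie_power_induct[OF idealD(1)[OF H] m])
  show "submodule (lie_power A H m) scalars A" by (rule lie_power_submodule[OF idealD(1)[OF H]])
  fix x y assume "x \<in> lie_power A H m" "y \<in> H"
  then show "x \<otimes> y \<in> lie_power A H m"
    using idealD(2)[OF lie_power_ideal[OF H]] idealD(4)[OF H] by blast
qed

text \<open>The derivation rule gives \<open>x (p q) = (x p) q - (x q) p\<close>, and each term on
  the right is bracketed twice with elements of \<open>H\<close>. So a factor from the square counts
  double, as \<open>unipotent_bij\<close> requires.\<close>

lemma lie_power_bracket_square:
  assumes H: "ideal_of A H" and m: "m \<ge> 1" and x: "x \<in> lie_power A H m" 
    and y: "y \<in> lie_power A H 2"
  shows "x \<otimes> y \<in> lie_power A H (Suc (Suc m))"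
proof -
  let ?P = "lie_power A H (Suc (Suc m))"
  have sub: "submodule ?P scalars A" by (rule lie_power_submodule[OF idealD(1)[OF H]])
  note D = submoduleD[OF sub]
  have xC: "x \<in> carrier A" using x by (rule idealD(4)[OF lie_power_ideal[OF H]])
  have "lie_power A H (Suc 1) \<subseteq> {y \<in> carrier A. x \<otimes> y \<in> ?P}"
  proof (rule lie_power_induct[OF idealD(1)[OF H]])
    show "submodule {y \<in> carrier A. x \<otimes> y \<in> ?P} scalars A"
      unfolding submodule_iff using D xC
      by (auto simp: mult_add_right mult_smult_right simp del: lie_power.simps)
    fix p q assume "p \<in> lie_power A H 1" "q \<in> H"
    then have p: "p \<in> H" and q: "q \<in> H" by simp_all
    note C = idealD(4)[OF H p] idealD(4)[OF H q]
    have br: "(x \<otimes> p) \<otimes> q \<in> ?P" if "p \<in> H" "q \<in> H" for p q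
      by (rule lie_power_bracket[OF idealD(1)[OF H] _ lie_power_bracket[OF idealD(1)[OF H]]])
        (use m x that in simp_all)
    have "(x \<otimes> p) \<otimes> q = (x \<otimes> q) \<otimes> p \<oplus> x \<otimes> (p \<otimes> q)"
      by (rule bracket_right_derivation) (use C xC in simp_all)
    then have "x \<otimes> (p \<otimes> q) = (x \<otimes> p) \<otimes> q \<ominus> (x \<otimes> q) \<otimes> p"
      using C xC by (simp add: a_minus_def M.add.m_ac M.r_neg M.r_neg1 M.r_neg2)
    also have "\<dots> \<in> ?P" using br[OF p q] br[OF q p] D(6) by blast
    finally show "p \<otimes> q \<in> {y \<in> carrier A. x \<otimes> y \<in> ?P}" using C by (simp del: lie_power.simps)
  qed simp
  then show ?thesis using y by (auto simp: numeral_2_eq_2 simp del: lie_power.simps)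
qed

end

text \<open>Unlike \<open>polynilpotent_ideal\<close>, the series may start at any submodule. In the
  affine algebra it will start at the elements of filtration degree 1, because the series of the
  whole algebra carries no information about degrees.\<close>

definition polynilpotent_series :: "('k::field, 'a) module \<Rightarrow> 'a set \<Rightarrow> nat list \<Rightarrow> 'a set"
  where "polynilpotent_series A S cs = foldl (\<lambda>H c. lie_power A H (c + 1)) S cs"

lemma polynilpotent_series_simps [simp]:
  "polynilpotent_series A S [] = S"
  "polynilpotent_series A S (cs @ [c]) = lie_power A (polynilpotent_series A S cs) (c + 1)"
  by (simp_all add: polynilpotent_series_def)

lemma polynilpotent_ideal_series: "polynilpotent_ideal A cs = polynilpotent_series A (carrier A) cs"
  by (simp add: polynilpotent_ideal_def polynilpotent_series_def)

context lie begin

lemma polynilpotent_series_submodule: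
  "submodule S scalars A \<Longrightarrow> submodule (polynilpotent_series A S cs) scalars A"
  by (induction cs rule: rev_induct) (simp_all add: lie_power_submodule del: lie_power.simps)

lemma polynilpotent_series_ideal:
  "ideal_of A S \<Longrightarrow> ideal_of A (polynilpotent_series A S cs)"
  by (induction cs rule: rev_induct) (simp_all add: lie_power_ideal del: lie_power.simps)

lemma polynilpotent_ideal_ideal: "ideal_of A (polynilpotent_ideal A cs)"
  by (simp add: polynilpotent_ideal_series polynilpotent_series_ideal ideal_carrier)

lemma lie_power_filtration:
  assumes V: "\<And>a. submodule (V a) scalars A"
    and br: "\<And>a b x y. x \<in> V a \<Longrightarrow> y \<in> V b \<Longrightarrow> x \<otimes> y \<in> V (a + b)"
    and H: "submodule H scalars A" "H \<subseteq> V a" and m: "m \<ge> 1"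
  shows "lie_power A H m \<subseteq> V (m * a)"
  using m
proof (induction m rule: dec_induct)
  case base
  then show ?case using H by simp
next
  case (step m)
  have "lie_power A H (Suc m) \<subseteq> V (m * a + a)"
    by (rule lie_power_induct[OF H(1) step(1) V]) (use br step(3) H(2) in blast)
  then show ?case by (simp add: add.commute del: lie_power.simps)
qed

text \<open>A step with class \<open>c\<close> multiplies the filtration degree by
  \<open>c + 1\<close>, whence the product over all classes.\<close>

lemma polynilpotent_series_filtration:
  assumes V: "\<And>a. submodule (V a) scalars A"
    and br: "\<And>a b x y. x \<in> V a \<Longrightarrow> y \<in> V b \<Longrightarrow> x \<otimes> y \<in> V (a + b)"
    and S: "submodule S scalars A" "S \<subseteq> V 1"
  shows "polynilpotent_series A S cs \<subseteq> V (prod_list (map Suc cs))"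
proof (induction cs rule: rev_induct)
  case Nil
  then show ?case using S by simp
next
  case (snoc c cs)
  have "lie_power A (polynilpotent_series A S cs) (Suc c) \<subseteq> V (Suc c * prod_list (map Suc cs))"
    by (rule lie_power_filtration[OF V br polynilpotent_series_submodule[OF S(1)] snoc]) simp_all
  then show ?case by (simp add: ac_simps del: lie_power.simps)
qed

end

section \<open>Series under homomorphisms; factoring a homomorphism through a quotient\<close>

locale lie_hom = algebra_hom A B h + A: lie A + B: lie B
  for A :: "('k::field, 'a) module" and B :: "('k, 'b) module" and h
begin

lemma lie_power_image:
  assumes H: "submodule H scalars A" "submodule H' scalars B" "h ` H \<subseteq> H'"
  shows "h ` lie_power A H m \<subseteq> lie_power B H' m"
proof (induction m)
  case (Suc m)
  show ?case
  proof (cases "m = 0")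
    case False
    then have m: "m \<ge> 1" by simp
    have "lie_power A H (Suc m) \<subseteq> {x \<in> carrier A. h x \<in> lie_power B H' (Suc m)}"
    proof (rule A.lie_power_induct[OF H(1) m submodule_preimage])
      show "submodule (lie_power B H' (Suc m)) scalars B" by (rule B.lie_power_submodule[OF H(2)])
      fix x y assume x: "x \<in> lie_power A H m" and y: "y \<in> H"
      have C: "x \<in> carrier A" "y \<in> carrier A"
        using A.submoduleD(1)[OF A.lie_power_submodule[OF H(1)] x] A.submoduleD(1)[OF H(1) y] .
      have "h x \<otimes>\<^bsub>B\<^esub> h y \<in> lie_power B H' (Suc m)"
        by (rule B.lie_power_bracket[OF H(2) m]) (use x y Suc H(3) in auto)
      then show "x \<otimes>\<^bsub>A\<^esub> y \<in> {x \<in> carrier A. h x \<in> lie_power B H' (Suc m)}"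
        using C by (simp del: lie_power.simps)
    qed
    then show ?thesis by blast
  qed (use H in simp)
qed (use H in simp)

lemma lie_power_image_onto:
  assumes H: "submodule H scalars A"
  shows "lie_power B (h ` H) m \<subseteq> h ` lie_power A H m"
proof (induction m)
  case (Suc m)
  show ?case
  proof (cases "m = 0")
    case False
    then have m: "m \<ge> 1" by simp
    show ?thesis
    proof (rule B.lie_power_induct[OF submodule_image[OF H] m])
      show "submodule (h ` lie_power A H (Suc m)) scalars B"
        by (rule submodule_image[OF A.lie_power_submodule[OF H]])
      fix x y assume "x \<in> lie_power B (h ` H) m" and "y \<in> h ` H"
      then obtain x' y' where x: "x' \<in> lie_power A H m" "x = h x'" and y: "y' \<in> H" "y = h y'"
        using Suc by blast
      have C: "x' \<in> carrier A" "y' \<in> carrier A"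
        using A.submoduleD(1)[OF A.lie_power_submodule[OF H] x(1)] A.submoduleD(1)[OF H y(1)] .
      have "x' \<otimes>\<^bsub>A\<^esub> y' \<in> lie_power A H (Suc m)"
        by (rule A.lie_power_bracket[OF H m x(1) y(1)])
      then show "x \<otimes>\<^bsub>B\<^esub> y \<in> h ` lie_power A H (Suc m)"
        using hom_mult[OF C] x y by (metis imageI)
    qed
  qed simp
qed simp

lemma polynilpotent_series_image:
  assumes "submodule S scalars A" "submodule S' scalars B" "h ` S \<subseteq> S'"
  shows "h ` polynilpotent_series A S cs \<subseteq> polynilpotent_series B S' cs"
  using assms
  by (induction cs rule: rev_induct)
    (simp_all add: lie_power_image A.polynilpotent_series_submodule
      B.polynilpotent_series_submodule del: lie_power.simps)

lemma polynilpotent_series_image_onto: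
  assumes S: "submodule S scalars A"
  shows "polynilpotent_series B (h ` S) cs = h ` polynilpotent_series A S cs"
proof (induction cs rule: rev_induct)
  case (snoc c cs)
  note sub = A.polynilpotent_series_submodule[OF S, of cs]
  have "lie_power B (h ` polynilpotent_series A S cs) (c + 1) = h ` lie_power A (polynilpotent_series A S cs) (c + 1)"
    by (rule equalityI[OF lie_power_image_onto[OF sub] lie_power_image[OF sub submodule_image[OF sub]]]) simp
  then show ?case by (simp add: snoc del: lie_power.simps)
qed simp

end

lemma lie_homI: "lie_algebra A \<Longrightarrow> lie_algebra B \<Longrightarrow> h \<in> alg_hom A B \<Longrightarrow> lie_hom A B h"
  by (simp add: lie_hom_def lie_def lie_axioms_def algebra_hom_def algebra_hom_axioms_def lie_algebra_iff)

text \<open>A preimage under \<open>p\<close> is chosen; two choices differ by an element of the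
  kernel of \<open>p\<close>, which \<open>g\<close> kills. The result is made extensional because
  the elements of \<open>alg_Aut\<close> are.\<close>

lemma factor_hom:
  assumes p: "algebra_hom A Q p" "p ` carrier A = carrier Q" and g: "algebra_hom A B g"
    and ker: "\<And>x. x \<in> carrier A \<Longrightarrow> p x = \<zero>\<^bsub>Q\<^esub> \<Longrightarrow> g x = \<zero>\<^bsub>B\<^esub>"
  obtains g' where "g' \<in> alg_hom Q B" "g' \<in> extensional (carrier Q)"
    "\<And>x. x \<in> carrier A \<Longrightarrow> g' (p x) = g x"
proof -
  interpret p: algebra_hom A Q p by fact
  interpret g: algebra_hom A B g by fact
  define r where "r y = (SOME x. x \<in> carrier A \<and> p x = y)" for y
  have r: "r y \<in> carrier A" "p (r y) = y" if "y \<in> carrier Q" for y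
  proof -
    have "\<exists>x. x \<in> carrier A \<and> p x = y" using that unfolding p(2)[symmetric] by auto
    from someI_ex[OF this] show "r y \<in> carrier A" "p (r y) = y" by (simp_all add: r_def)
  qed
  define g' where "g' = (\<lambda>y\<in>carrier Q. g (r y))"
  have g': "g' (p x) = g x" if x: "x \<in> carrier A" for x
  proof -
    have rx: "r (p x) \<in> carrier A" "p (r (p x)) = p x" using r[of "p x"] x by simp_all
    then have "p (r (p x) \<ominus>\<^bsub>A\<^esub> x) = \<zero>\<^bsub>Q\<^esub>" using x by (simp add: a_minus_def p.B.M.r_neg)
    then have "g (r (p x)) \<ominus>\<^bsub>B\<^esub> g x = \<zero>\<^bsub>B\<^esub>" using ker[of "r (p x) \<ominus>\<^bsub>A\<^esub> x"] rx x by simp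
    then have "g (r (p x)) = g x" using rx x by (simp add: g.B.minus_eq_zero_iff)
    then show ?thesis using x by (simp add: g'_def)
  qed
  have ex: "\<exists>x. x \<in> carrier A \<and> y = p x" if "y \<in> carrier Q" for y
    using r[OF that] by metis
  have "g' \<in> alg_hom Q B"
    unfolding alg_hom_def
  proof (intro CollectI conjI ballI allI Pi_I)
    fix x assume "x \<in> carrier Q"
    then obtain x' where x: "x' \<in> carrier A" "x = p x'" using ex by blast
    show "g' x \<in> carrier B" using x by (simp add: g')
    show "g' (a \<odot>\<^bsub>Q\<^esub> x) = a \<odot>\<^bsub>B\<^esub> g' x" for a
      using x g'[of "a \<odot>\<^bsub>A\<^esub> x'"] by (simp add: g')
    fix y assume "y \<in> carrier Q"
    then obtain y' where y: "y' \<in> carrier A" "y = p y'" using ex by blast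
    show "g' (x \<oplus>\<^bsub>Q\<^esub> y) = g' x \<oplus>\<^bsub>B\<^esub> g' y"
      using x y g'[of "x' \<oplus>\<^bsub>A\<^esub> y'"] by (simp add: g')
    show "g' (x \<otimes>\<^bsub>Q\<^esub> y) = g' x \<otimes>\<^bsub>B\<^esub> g' y"
      using x y g'[of "x' \<otimes>\<^bsub>A\<^esub> y'"] by (simp add: g')
  qed
  with g' show ?thesis using that[of g'] by (simp add: g'_def)
qed

section \<open>Relatively free algebras and lifts of tame automorphisms\<close>

text \<open>The kernel of the projection onto the free polynilpotent algebra, pulled back to the
  free nonassociative algebra so that one can argue there instead of with cosets of cosets.\<close>

definition polynilpotent_relations :: "nat list \<Rightarrow> nat \<Rightarrow> (nat magma \<Rightarrow> 'k::field) set"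
  where "polynilpotent_relations cs n = {f \<in> carrier (free_nonassoc n).
    lie_ideal n +>\<^bsub>free_nonassoc n\<^esub> f \<in> polynilpotent_ideal (free_lie n) cs}"

lemma ideal_lie_ideal: "ideal_of (free_nonassoc n) (lie_ideal n)"
  unfolding lie_ideal_def by (rule free_nonassoc.ideal_hull[OF free_nonassoc.lie_relations_subset])

lemma free_lie_hom: "algebra_hom (free_nonassoc n) (free_lie n) (\<lambda>f. lie_ideal n +>\<^bsub>free_nonassoc n\<^esub> f)"
  unfolding free_lie_def by (rule free_nonassoc.quot_algebra_hom[OF ideal_lie_ideal])

lemma free_lie_onto:
  "(\<lambda>f. lie_ideal n +>\<^bsub>free_nonassoc n\<^esub> f) ` carrier (free_nonassoc n) = carrier (free_lie n)"
  unfolding free_lie_def by (rule free_nonassoc.quot_onto)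

lemma free_lie_kernel:
  "f \<in> carrier (free_nonassoc n) \<Longrightarrow>
    lie_ideal n +>\<^bsub>free_nonassoc n\<^esub> f = \<zero>\<^bsub>free_lie n\<^esub> \<longleftrightarrow> f \<in> lie_ideal n"
  unfolding free_lie_def by (rule free_nonassoc.quot_kernel[OF ideal_lie_ideal])

lemma lie_algebra_free_lie: "lie_algebra (free_lie n)"
proof (rule lie_algebra_hom_image[OF free_lie_hom free_lie_onto])
  fix r assume "r \<in> lie_relations (free_nonassoc n)"
  moreover from this have "r \<in> lie_ideal n" unfolding lie_ideal_def by (rule hull_inc)
  ultimately show "lie_ideal n +>\<^bsub>free_nonassoc n\<^esub> r = \<zero>\<^bsub>free_lie n\<^esub>"
    using free_lie_kernel free_nonassoc.lie_relations_subset by blast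
qed

lemma hom_lie_ideal:
  fixes B :: "('k::field, 'b) module"
  assumes B: "lie_algebra B" and g: "algebra_hom (free_nonassoc n) B g" and f: "f \<in> lie_ideal n"
  shows "g f = \<zero>\<^bsub>B\<^esub>"
proof -
  interpret g: algebra_hom "free_nonassoc n" B g by fact
  let ?F = "free_nonassoc n :: ('k, nat magma \<Rightarrow> 'k) module"
  let ?K = "{f \<in> carrier ?F. g f = \<zero>\<^bsub>B\<^esub>}"
  have "submodule ?K scalars ?F"
    using g.submodule_preimage[OF g.B.submodule_zero] by simp
  then have "ideal_of ?F ?K"
    by (intro free_nonassoc.idealI) (auto simp del: free_nonassoc_sel)
  moreover have "lie_relations ?F \<subseteq> ?K"
  proof
    fix r assume r: "r \<in> lie_relations ?F"
    have rel: "g r \<in> lie_relations B"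
      using r unfolding lie_relations_def
    proof (elim UnE CollectE exE conjE)
      fix x assume "r = x \<otimes>\<^bsub>?F\<^esub> x" "x \<in> carrier ?F"
      then show "g r \<in> {x \<otimes>\<^bsub>B\<^esub> x |x. x \<in> carrier B} \<union> {(x \<otimes>\<^bsub>B\<^esub> y) \<otimes>\<^bsub>B\<^esub> z \<oplus>\<^bsub>B\<^esub> (y \<otimes>\<^bsub>B\<^esub> z) \<otimes>\<^bsub>B\<^esub> x \<oplus>\<^bsub>B\<^esub> (z \<otimes>\<^bsub>B\<^esub> x) \<otimes>\<^bsub>B\<^esub> y |x y z.
          x \<in> carrier B \<and> y \<in> carrier B \<and> z \<in> carrier B}"
        by (intro UnI1 CollectI exI[of _ "g x"]) (simp del: free_nonassoc_sel)
    next
      fix x y z assume "r = (x \<otimes>\<^bsub>?F\<^esub> y) \<otimes>\<^bsub>?F\<^esub> z \<oplus>\<^bsub>?F\<^esub> (y \<otimes>\<^bsub>?F\<^esub> z) \<otimes>\<^bsub>?F\<^esub> x \<oplus>\<^bsub>?F\<^esub> (z \<otimes>\<^bsub>?F\<^esub> x) \<otimes>\<^bsub>?F\<^esub> y"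
        "x \<in> carrier ?F" "y \<in> carrier ?F" "z \<in> carrier ?F"
      then show "g r \<in> {x \<otimes>\<^bsub>B\<^esub> x |x. x \<in> carrier B} \<union> {(x \<otimes>\<^bsub>B\<^esub> y) \<otimes>\<^bsub>B\<^esub> z \<oplus>\<^bsub>B\<^esub> (y \<otimes>\<^bsub>B\<^esub> z) \<otimes>\<^bsub>B\<^esub> x \<oplus>\<^bsub>B\<^esub> (z \<otimes>\<^bsub>B\<^esub> x) \<otimes>\<^bsub>B\<^esub> y |x y z.
          x \<in> carrier B \<and> y \<in> carrier B \<and> z \<in> carrier B}"
        by (intro UnI2 CollectI exI[of _ "g x"] exI[of _ "g y"] exI[of _ "g z"]) (simp del: free_nonassoc_sel)
    qed
    have "r \<in> carrier ?F" using r free_nonassoc.lie_relations_subset by blast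
    then show "r \<in> ?K" using lie_algebra_relations[OF B rel] by simp
  qed
  ultimately have "lie_ideal n \<subseteq> ?K" unfolding lie_ideal_def by (intro hull_minimal)
  with f show ?thesis by blast
qed

text \<open>\<open>g\<close> kills the Lie ideal and hence factors through the free Lie algebra,
  whose series is mapped into that of \<open>B\<close> started at \<open>S\<close>. Applied to the
  relatively free algebra this lets maps of generators extend; applied to the affine algebra it
  bounds the order of relations in t.\<close>

lemma hom_polynilpotent_relations:
  fixes B :: "('k::field, 'b) module"
  assumes B: "lie_algebra B" and g: "algebra_hom (free_nonassoc n) B g"
    and S: "submodule S scalars B" "g ` carrier (free_nonassoc n) \<subseteq> S"
    and f: "f \<in> polynilpotent_relations cs n"
  shows "g f \<in> polynilpotent_series B S cs"
proof -
  let ?p = "\<lambda>f :: nat magma \<Rightarrow> 'k. lie_ideal n +>\<^bsub>free_nonassoc n\<^esub> f"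
  have ker: "g f = \<zero>\<^bsub>B\<^esub>" if "f \<in> carrier (free_nonassoc n)" "?p f = \<zero>\<^bsub>free_lie n\<^esub>" for f
    using that hom_lie_ideal[OF B g] by (simp add: free_lie_kernel)
  obtain g' where g': "g' \<in> alg_hom (free_lie n) B" "\<And>f. f \<in> carrier (free_nonassoc n) \<Longrightarrow> g' (?p f) = g f"
    by (rule factor_hom[OF free_lie_hom free_lie_onto g]) (rule ker that; assumption)+
  interpret g': lie_hom "free_lie n" B g' by (rule lie_homI[OF lie_algebra_free_lie B g'(1)])
  have "g' ` carrier (free_lie n) \<subseteq> S"
    using S(2) g'(2) unfolding free_lie_onto[symmetric] by auto
  then have "g' ` polynilpotent_ideal (free_lie n) cs \<subseteq> polynilpotent_series B S cs"
    unfolding polynilpotent_ideal_series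
    by (rule g'.polynilpotent_series_image[OF g'.A.submodule_carrier S(1)])
  moreover have "f \<in> carrier (free_nonassoc n)" "?p f \<in> polynilpotent_ideal (free_lie n) cs"
    using f by (simp_all add: polynilpotent_relations_def)
  ultimately show ?thesis using g'(2)[of f] by (metis image_subset_iff)
qed

text \<open>An interface to \<open>free_polynilpotent\<close> that hides its carrier of cosets of
  cosets. The inclusion \<open>proj_kernel\<close> and the law \<open>polynilpotent\<close> together
  give the universal property.\<close>

locale relatively_free = lie A for A :: "('k::field, 'a) module" (structure) +
  fixes x :: "nat \<Rightarrow> 'a" and n :: nat and cs :: "nat list" and proj :: "(nat magma \<Rightarrow> 'k) \<Rightarrow> 'a"
  assumes proj_alg_hom: "proj \<in> alg_hom (free_nonassoc n) A"
    and proj_onto: "proj ` carrier (free_nonassoc n) = carrier A"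
    and proj_gen: "i \<in> {1..n} \<Longrightarrow> proj (nonassoc_gen i) = x i"
    and proj_kernel: "f \<in> carrier (free_nonassoc n) \<Longrightarrow> proj f = \<zero> \<Longrightarrow> f \<in> polynilpotent_relations cs n"
    and polynilpotent: "polynilpotent_ideal A cs = {\<zero>}"

lemma relatively_free_free_polynilpotent:
  "relatively_free (free_polynilpotent cs n :: ('k::field, (nat magma \<Rightarrow> 'k) set set) module)
    (free_polynilpotent_gen cs n) n cs
    (\<lambda>f. polynilpotent_ideal (free_lie n) cs +>\<^bsub>free_lie n\<^esub> (lie_ideal n +>\<^bsub>free_nonassoc n\<^esub> f))"
proof -
  interpret L: lie "free_lie n :: ('k, (nat magma \<Rightarrow> 'k) set) module"
    using lie_algebra_free_lie[of n, where ?'a = 'k] by (simp add: lie_def lie_axioms_def lie_algebra_iff)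
  let ?A = "free_polynilpotent cs n :: ('k, (nat magma \<Rightarrow> 'k) set set) module"
  let ?I = "polynilpotent_ideal (free_lie n) cs :: (nat magma \<Rightarrow> 'k) set set"
  let ?q = "\<lambda>C. ?I +>\<^bsub>free_lie n\<^esub> C"
  let ?p = "\<lambda>f :: nat magma \<Rightarrow> 'k. lie_ideal n +>\<^bsub>free_nonassoc n\<^esub> f"
  have I: "ideal_of (free_lie n) ?I" by (rule L.polynilpotent_ideal_ideal)
  interpret q: algebra_hom "free_lie n" ?A ?q
    unfolding free_polynilpotent_def by (rule L.quot_algebra_hom[OF I])
  have onto: "?q ` carrier (free_lie n) = carrier ?A"
    unfolding free_polynilpotent_def by (rule L.quot_onto)
  have ker: "?q C = \<zero>\<^bsub>?A\<^esub> \<longleftrightarrow> C \<in> ?I" if "C \<in> carrier (free_lie n)" for C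
    unfolding free_polynilpotent_def by (rule L.quot_kernel[OF I that])
  interpret p: algebra_hom "free_nonassoc n" "free_lie n" ?p by (rule free_lie_hom)
  have lieA: "lie_algebra ?A"
  proof (rule lie_algebra_hom_image[OF q.algebra_hom_axioms onto])
    fix r assume "r \<in> lie_relations (free_lie n :: ('k, (nat magma \<Rightarrow> 'k) set) module)"
    from lie_algebra_relations[OF lie_algebra_free_lie this] show "?q r = \<zero>\<^bsub>?A\<^esub>"
      by simp
  qed
  interpret A: lie ?A using lieA by (simp add: lie_def lie_axioms_def lie_algebra_iff)
  interpret q': lie_hom "free_lie n" ?A ?q by (rule lie_homI[OF L.lie_algebra lieA q.hom])
  show ?thesis
  proof (unfold_locales, goal_cases)
    case 1
    show ?case by (rule alg_hom_comp[OF p.hom q.hom])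
  next
    case 2
    have "(\<lambda>f. ?q (?p f)) ` carrier (free_nonassoc n) = ?q ` (?p ` carrier (free_nonassoc n))"
      by (simp add: image_image)
    then show ?case by (simp only: free_lie_onto onto)
  next
    case (3 i)
    show ?case by (simp add: free_polynilpotent_gen_def free_lie_gen_def)
  next
    case (4 f)
    then show ?case using ker[of "?p f"] by (simp add: polynilpotent_relations_def)
  next
    case 5
    \<comment> \<open>The series commutes with surjections, so the ideal of the quotient is the
      image of the very ideal that was divided out.\<close>
    have "polynilpotent_ideal ?A cs = ?q ` ?I"
      using q'.polynilpotent_series_image_onto[OF L.submodule_carrier, of cs]
      by (simp only: polynilpotent_ideal_series onto[unfolded polynilpotent_ideal_series])
    also have "\<dots> \<subseteq> {\<zero>\<^bsub>?A\<^esub>}" using ker L.idealD(4)[OF I] by blast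
    finally show ?case using q.B.submoduleD(2)[OF A.idealD(1)[OF A.polynilpotent_ideal_ideal]] by blast
  qed
qed

lemma (in nonassoc_algebra) group_alg_Aut: "group (alg_Aut A)"
proof -
  have "subgroup (Bij (carrier A) \<inter> alg_hom A A) (BijGroup (carrier A))"
  proof (rule subgroup.intro)
    show "Bij (carrier A) \<inter> alg_hom A A \<subseteq> carrier (BijGroup (carrier A))" by (simp add: BijGroup_def)
  next
    fix f g assume f: "f \<in> Bij (carrier A) \<inter> alg_hom A A" and g: "g \<in> Bij (carrier A) \<inter> alg_hom A A"
    have "compose (carrier A) f g \<in> alg_hom A A"
      using f g by (simp add: alg_hom_def compose_def Pi_iff)
    then show "f \<otimes>\<^bsub>BijGroup (carrier A)\<^esub> g \<in> Bij (carrier A) \<inter> alg_hom A A"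
      using f g by (simp add: BijGroup_def compose_Bij)
  next
    show "\<one>\<^bsub>BijGroup (carrier A)\<^esub> \<in> Bij (carrier A) \<inter> alg_hom A A"
      using id_Bij by (simp add: BijGroup_def alg_hom_def)
  next
    fix f assume f: "f \<in> Bij (carrier A) \<inter> alg_hom A A"
    then have bij: "bij_betw f (carrier A) (carrier A)" and fh: "f \<in> alg_hom A A" by (simp_all add: Bij_def)
    let ?g = "inv_into (carrier A) f"
    have gC: "?g y \<in> carrier A" and fg: "f (?g y) = y" if "y \<in> carrier A" for y
      using that bij by (auto simp: bij_betw_def inv_into_into f_inv_into_f)
    have gf: "?g (f y) = y" if "y \<in> carrier A" for y
      using that bij by (simp add: bij_betw_def)
    have hom: "f (x \<oplus> y) = f x \<oplus> f y" "f (x \<otimes> y) = f x \<otimes> f y" "f (a \<odot>\<^bsub>A\<^esub> x) = a \<odot>\<^bsub>A\<^esub> f x"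
      if "x \<in> carrier A" "y \<in> carrier A" for x y a
      using fh that by (auto simp: alg_hom_def)
    have "(\<lambda>y\<in>carrier A. ?g y) \<in> alg_hom A A"
      unfolding alg_hom_def
    proof (intro CollectI conjI ballI allI Pi_I)
      fix x assume x: "x \<in> carrier A"
      then show "restrict ?g (carrier A) x \<in> carrier A" by (simp add: gC)
      show "restrict ?g (carrier A) (a \<odot>\<^bsub>A\<^esub> x) = a \<odot>\<^bsub>A\<^esub> restrict ?g (carrier A) x" for a
        using gf[of "a \<odot>\<^bsub>A\<^esub> ?g x"] hom(3)[of "?g x" "?g x" a] x by (simp add: gC fg)
      fix y assume y: "y \<in> carrier A"
      show "restrict ?g (carrier A) (x \<oplus> y) = restrict ?g (carrier A) x \<oplus> restrict ?g (carrier A) y"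
        using gf[of "?g x \<oplus> ?g y"] hom(1)[of "?g x" "?g y"] x y by (simp add: gC fg)
      show "restrict ?g (carrier A) (x \<otimes> y) = restrict ?g (carrier A) x \<otimes> restrict ?g (carrier A) y"
        using gf[of "?g x \<otimes> ?g y"] hom(2)[of "?g x" "?g y"] x y by (simp add: gC fg)
    qed
    then show "inv\<^bsub>BijGroup (carrier A)\<^esub> f \<in> Bij (carrier A) \<inter> alg_hom A A"
      using f by (simp add: inv_BijGroup restrict_inv_into_Bij)
  qed
  then show ?thesis unfolding alg_Aut_def by (rule group.subgroup_imp_group[OF group_BijGroup])
qed

lemma alg_Aut_carrier:
  "\<phi> \<in> carrier (alg_Aut A) \<longleftrightarrow>
    \<phi> \<in> alg_hom A A \<and> \<phi> \<in> extensional (carrier A) \<and> bij_betw \<phi> (carrier A) (carrier A)"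
  by (auto simp: alg_Aut_def Bij_def)

lemma alg_Aut_mult:
  "\<phi> \<in> carrier (alg_Aut A) \<Longrightarrow> \<psi> \<in> carrier (alg_Aut A) \<Longrightarrow> y \<in> carrier A \<Longrightarrow>
    (\<phi> \<otimes>\<^bsub>alg_Aut A\<^esub> \<psi>) y = \<phi> (\<psi> y)"
  by (simp add: alg_Aut_def BijGroup_def compose_def)

lemma alg_Aut_one: "y \<in> carrier A \<Longrightarrow> \<one>\<^bsub>alg_Aut A\<^esub> y = y"
  by (simp add: alg_Aut_def BijGroup_def)

context relatively_free begin

abbreviation "F \<equiv> free_nonassoc n :: ('k, nat magma \<Rightarrow> 'k) module"

sublocale proj: algebra_hom F A proj
  by (rule algebra_homI[OF nonassoc_algebra_free_nonassoc nonassoc_algebra_axioms proj_alg_hom])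

lemma gen_closed [simp]: "i \<in> {1..n} \<Longrightarrow> x i \<in> carrier A"
  using proj.hom_closed[OF nonassoc_gen_carrier] by (simp add: proj_gen)

lemma projE:
  assumes "y \<in> carrier A"
  obtains f where "f \<in> carrier F" "y = proj f"
  using assms unfolding proj_onto[symmetric] by auto

lemma subalgebra_gens:
  assumes S: "subalgebra_of A S" and gen: "\<And>i. i \<in> {1..n} \<Longrightarrow> x i \<in> S"
  shows "S = carrier A"
proof
  show "S \<subseteq> carrier A" using S by (simp add: subalgebra_of_def submodule_iff)
  have "{f \<in> carrier F. proj f \<in> S} = carrier F"
    by (rule subalgebra_generators[OF proj.subalgebra_preimage[OF S]]) (simp add: gen proj_gen)
  then show "carrier A \<subseteq> S" unfolding proj_onto[symmetric] by auto
qed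

lemma hom_eq_on_gens:
  assumes "algebra_hom A B g" "algebra_hom A B h" "\<And>i. i \<in> {1..n} \<Longrightarrow> g (x i) = h (x i)" "y \<in> carrier A"
  shows "g y = h y"
  using subalgebra_gens[OF subalgebra_equalizer[OF assms(1,2)]] assms(3,4) by auto

text \<open>\<open>free_ext A b\<close> sends the kernel of \<open>proj\<close> into the
  polynilpotent ideal of \<open>A\<close>, which is zero; so it descends along
  \<open>proj\<close>.\<close>

lemma ext_hom:
  assumes b: "\<And>i. i \<in> {1..n} \<Longrightarrow> b i \<in> carrier A"
  obtains \<phi> where "\<phi> \<in> alg_hom A A" "\<phi> \<in> extensional (carrier A)" "\<And>i. i \<in> {1..n} \<Longrightarrow> \<phi> (x i) = b i"
    "\<And>f. f \<in> carrier F \<Longrightarrow> \<phi> (proj f) = free_ext A b f"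
proof -
  have b': "algebra_hom F A (free_ext A b)" by (rule free_ext_algebra_hom[OF b])
  interpret b: algebra_hom F A "free_ext A b" by fact
  have ker: "free_ext A b f = \<zero>" if f: "f \<in> carrier F" "proj f = \<zero>" for f
  proof -
    have "free_ext A b f \<in> polynilpotent_series A (carrier A) cs"
      by (rule hom_polynilpotent_relations[OF lie_algebra b' submodule_carrier _ proj_kernel[OF f]]) auto
    then show ?thesis using polynilpotent by (simp add: polynilpotent_ideal_series)
  qed
  obtain \<phi> where \<phi>: "\<phi> \<in> alg_hom A A" "\<phi> \<in> extensional (carrier A)"
      "\<And>f. f \<in> carrier F \<Longrightarrow> \<phi> (proj f) = free_ext A b f"
    by (rule factor_hom[OF proj.algebra_hom_axioms proj_onto b']) (rule ker that; assumption)+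
  moreover have "\<phi> (x i) = b i" if "i \<in> {1..n}" for i
    using \<phi>(3)[OF nonassoc_gen_carrier[OF that]] free_ext_gen[OF b that] proj_gen[OF that] by simp
  ultimately show ?thesis using that by blast
qed

section \<open>Lifting tame automorphisms to tuples of nonassociative polynomials\<close>

lemma aut_hom: "\<phi> \<in> carrier (alg_Aut A) \<Longrightarrow> algebra_hom A A \<phi>"
  by (simp add: alg_Aut_carrier algebra_homI nonassoc_algebra_axioms)

lemma aut_group: "group (alg_Aut A)"
  by (rule group_alg_Aut)

lemma inv_aut_apply:
  assumes \<psi>: "\<psi> \<in> carrier (alg_Aut A)" and y: "y \<in> carrier A"
  shows "(inv\<^bsub>alg_Aut A\<^esub> \<psi>) (\<psi> y) = y"
proof -
  have "(inv\<^bsub>alg_Aut A\<^esub> \<psi> \<otimes>\<^bsub>alg_Aut A\<^esub> \<psi>) y = (inv\<^bsub>alg_Aut A\<^esub> \<psi>) (\<psi> y)"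
    by (rule alg_Aut_mult[OF group.inv_closed[OF aut_group \<psi>] \<psi> y])
  then show ?thesis using y by (simp add: group.l_inv[OF aut_group \<psi>] alg_Aut_one)
qed

text \<open>An elementary automorphism fixes the subalgebra of the other generators and in
  particular \<open>f\<close>, so its inverse sends x_i to \<open>inverse \<alpha>\<close> times x_i
  - f. Consequently tame automorphisms are products of elementary ones alone, and no inverse ever
  has to be lifted.\<close>

lemma elementary_inverse:
  assumes e: "e \<in> elementary_automorphisms A x n"
  shows "inv\<^bsub>alg_Aut A\<^esub> e \<in> elementary_automorphisms A x n"
proof -
  obtain i \<alpha> f where eA: "e \<in> carrier (alg_Aut A)" and i: "i \<in> {1..n}" and \<alpha>: "\<alpha> \<noteq> 0"
    and f: "f \<in> subalgebra_of A hull (x ` ({1..n} - {i}))"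
    and ei: "e (x i) = \<alpha> \<odot>\<^bsub>A\<^esub> x i \<oplus> f" and ej: "\<And>j. j \<in> {1..n} - {i} \<Longrightarrow> e (x j) = x j"
    using e unfolding elementary_automorphisms_def by auto
  let ?H = "subalgebra_of A hull (x ` ({1..n} - {i}))"
  let ?e = "inv\<^bsub>alg_Aut A\<^esub> e"
  have e'A: "?e \<in> carrier (alg_Aut A)" by (rule group.inv_closed[OF aut_group eA])
  interpret e: algebra_hom A A e by (rule aut_hom[OF eA])
  interpret e': algebra_hom A A ?e by (rule aut_hom[OF e'A])
  have sub: "x ` ({1..n} - {i}) \<subseteq> carrier A" using gen_closed by auto
  have H: "subalgebra_of A ?H" by (rule subalgebra_hull[OF sub])
  then have Hs: "submodule ?H scalars A" by (simp add: subalgebra_of_def)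
  note D = submoduleD[OF Hs]
  have idH: "algebra_hom A A (\<lambda>y. y)"
    by (intro algebra_homI nonassoc_algebra_axioms) (simp add: alg_hom_def)
  have "?H \<subseteq> {y \<in> carrier A. e y = y}"
    by (rule hull_minimal) (use ej gen_closed subalgebra_equalizer[OF e.algebra_hom_axioms idH] in auto)
  then have ef: "e f = f" using f by auto
  have "?e (x j) = x j" if "j \<in> {1..n} - {i}" for j
    using inv_aut_apply[OF eA gen_closed[of j]] ej[OF that] that by simp
  moreover have "?e (x i) = inverse \<alpha> \<odot>\<^bsub>A\<^esub> x i \<oplus> (- inverse \<alpha>) \<odot>\<^bsub>A\<^esub> f"
  proof -
    have "e (inverse \<alpha> \<odot>\<^bsub>A\<^esub> x i \<oplus> (- inverse \<alpha>) \<odot>\<^bsub>A\<^esub> f) =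
        inverse \<alpha> \<odot>\<^bsub>A\<^esub> (\<alpha> \<odot>\<^bsub>A\<^esub> x i \<oplus> f) \<oplus> (- inverse \<alpha>) \<odot>\<^bsub>A\<^esub> f"
      using gen_closed[OF i] D(1)[OF f] by (simp add: ei ef)
    also have "\<dots> = x i \<oplus> (inverse \<alpha> \<odot>\<^bsub>A\<^esub> f \<oplus> (- inverse \<alpha>) \<odot>\<^bsub>A\<^esub> f)"
      using gen_closed[OF i] D(1)[OF f] \<alpha> by (simp add: smult_add smult_smult M.add.m_assoc)
    also have "\<dots> = x i"
      using gen_closed[OF i] D(1)[OF f] by (simp flip: add_smult)
    finally show ?thesis
      using inv_aut_apply[OF eA, of "inverse \<alpha> \<odot>\<^bsub>A\<^esub> x i \<oplus> (- inverse \<alpha>) \<odot>\<^bsub>A\<^esub> f"]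
        gen_closed[OF i] D(1)[OF f] by simp
  qed
  moreover have "inverse \<alpha> \<noteq> 0" using \<alpha> by simp
  moreover have "(- inverse \<alpha>) \<odot>\<^bsub>A\<^esub> f \<in> ?H" by (rule D(4)[OF f])
  ultimately show ?thesis
    using e'A i unfolding elementary_automorphisms_def by blast
qed

text \<open>If \<open>p\<close> lifts \<theta>, this tuple lifts the composite of \<theta> with x_i
  \<mapsto> \<alpha> x_i + f: the composite sends x_i to \<alpha> \<theta>(x_i) + \<theta>(f), and
  \<theta>(f) is lifted by substituting \<open>p\<close> in \<open>f\<close>. Composing on this side
  changes one component only.\<close>

definition elementary_tuple :: "(nat \<Rightarrow> nat magma \<Rightarrow> 'k) \<Rightarrow> nat \<Rightarrow> 'k \<Rightarrow> (nat magma \<Rightarrow> 'k) \<Rightarrow> nat \<Rightarrow> nat magma \<Rightarrow> 'k"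
  where "elementary_tuple p i \<alpha> f j =
    (if j = i then (\<alpha> \<odot>\<^bsub>F\<^esub> p i) \<oplus>\<^bsub>F\<^esub> free_ext F p f else p j)"

definition lifts :: "(nat \<Rightarrow> nat magma \<Rightarrow> 'k) \<Rightarrow> ('a \<Rightarrow> 'a) \<Rightarrow> bool"
  where "lifts p \<phi> \<longleftrightarrow> (\<forall>j\<in>{1..n}. p j \<in> carrier F \<and> proj (p j) = \<phi> (x j))"

lemma lifts_elementary:
  assumes \<theta>: "\<theta> \<in> carrier (alg_Aut A)" "lifts p \<theta>" and e: "e \<in> elementary_automorphisms A x n"
  obtains i \<alpha> f where "i \<in> {1..n}" "\<alpha> \<noteq> 0" "f \<in> carrier F"
    "f \<in> subalgebra_of F hull (nonassoc_gen ` ({1..n} - {i}))"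
    "lifts (elementary_tuple p i \<alpha> f) (\<theta> \<otimes>\<^bsub>alg_Aut A\<^esub> e)"
proof -
  obtain i \<alpha> f where eA: "e \<in> carrier (alg_Aut A)" and i: "i \<in> {1..n}" and \<alpha>: "\<alpha> \<noteq> 0"
    and f: "f \<in> subalgebra_of A hull (x ` ({1..n} - {i}))"
    and ei: "e (x i) = \<alpha> \<odot>\<^bsub>A\<^esub> x i \<oplus> f" and ej: "\<And>j. j \<in> {1..n} - {i} \<Longrightarrow> e (x j) = x j"
    using e unfolding elementary_automorphisms_def by auto
  have p: "\<And>j. j \<in> {1..n} \<Longrightarrow> p j \<in> carrier F" "\<And>j. j \<in> {1..n} \<Longrightarrow> proj (p j) = \<theta> (x j)"
    using \<theta>(2) by (simp_all add: lifts_def)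
  have im: "x ` ({1..n} - {i}) = proj ` (nonassoc_gen ` ({1..n} - {i}))"
    unfolding image_image by (rule image_cong[OF refl]) (simp add: proj_gen)
  have sub: "nonassoc_gen ` ({1..n} - {i}) \<subseteq> carrier F"
    using nonassoc_gen_carrier by blast
  obtain g where g: "g \<in> subalgebra_of F hull (nonassoc_gen ` ({1..n} - {i}))" "g \<in> carrier F" "proj g = f"
    by (rule proj.subalgebra_hull_image[OF sub f[unfolded im]])
  interpret \<theta>: algebra_hom A A \<theta> by (rule aut_hom[OF \<theta>(1)])
  interpret p: algebra_hom F F "free_ext F p" by (rule free_nonassoc.free_ext_algebra_hom[OF p(1)])
  have \<theta>f: "\<theta> f = proj (free_ext F p g)"
  proof -
    have 1: "algebra_hom F A (\<lambda>g. \<theta> (proj g))"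
      by (intro algebra_homI nonassoc_algebra_free_nonassoc nonassoc_algebra_axioms alg_hom_comp[OF proj.hom \<theta>.hom])
    have 2: "algebra_hom F A (\<lambda>g. proj (free_ext F p g))"
      by (intro algebra_homI nonassoc_algebra_free_nonassoc nonassoc_algebra_axioms alg_hom_comp[OF p.hom proj.hom])
    have "\<theta> (proj g) = proj (free_ext F p g)"
    proof (rule free_hom_unique[OF 1 2 _ g(2)])
      fix j assume j: "j \<in> {1..n}"
      show "\<theta> (proj (nonassoc_gen j)) = proj (free_ext F p (nonassoc_gen j))"
        using proj_gen[OF j] p(2)[OF j] free_nonassoc.free_ext_gen[OF p(1) j] by simp
    qed
    then show ?thesis by (simp add: g(3))
  qed
  have fC: "f \<in> carrier A" using g by auto
  have "lifts (elementary_tuple p i \<alpha> g) (\<theta> \<otimes>\<^bsub>alg_Aut A\<^esub> e)"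
    unfolding lifts_def
  proof (intro ballI conjI)
    fix j assume j: "j \<in> {1..n}"
    show "elementary_tuple p i \<alpha> g j \<in> carrier F"
      using p(1)[OF j] p.hom_closed[OF g(2)] free_nonassoc.M.a_closed free_nonassoc.smult_in
      unfolding elementary_tuple_def by (metis)
    show "proj (elementary_tuple p i \<alpha> g j) = (\<theta> \<otimes>\<^bsub>alg_Aut A\<^esub> e) (x j)"
    proof (cases "j = i")
      case True
      have "proj (elementary_tuple p i \<alpha> g i) = \<alpha> \<odot>\<^bsub>A\<^esub> \<theta> (x i) \<oplus> \<theta> f"
        using p[OF i] p.hom_closed[OF g(2)] proj.hom_add[OF free_nonassoc.smult_in[OF p(1)[OF i]] p.hom_closed[OF g(2)], of \<alpha>]
          proj.hom_smult[OF p(1)[OF i], of \<alpha>]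
        unfolding elementary_tuple_def \<theta>f by (simp del: free_nonassoc_sel)
      also have "\<dots> = \<theta> (e (x i))" using gen_closed[OF i] fC by (simp add: ei)
      finally show ?thesis using True alg_Aut_mult[OF \<theta>(1) eA gen_closed[OF i]] by simp
    next
      case False
      then show ?thesis using alg_Aut_mult[OF \<theta>(1) eA gen_closed[OF j]] j ej p(2)[OF j]
        by (simp add: elementary_tuple_def)
    qed
  qed
  with i \<alpha> g(1,2) show ?thesis using that by blast
qed

text \<open>Lifts are not unique and \<Phi> need not be determined by the automorphism, so a
  particular lift is built along a factorization into elementary automorphisms.\<close>

lemma tame_lifts:
  assumes \<psi>: "\<psi> \<in> tame_automorphisms A x n"
    and base: "\<Phi> nonassoc_gen"
    and step: "\<And>p i \<alpha> f. \<Phi> p \<Longrightarrow> (\<And>j. j \<in> {1..n} \<Longrightarrow> p j \<in> carrier F) \<Longrightarrow> i \<in> {1..n} \<Longrightarrow> \<alpha> \<noteq> 0 \<Longrightarrow>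
      f \<in> carrier F \<Longrightarrow> f \<in> subalgebra_of F hull (nonassoc_gen ` ({1..n} - {i})) \<Longrightarrow>
      \<Phi> (elementary_tuple p i \<alpha> f)"
  shows "\<psi> \<in> carrier (alg_Aut A) \<and> (\<exists>p. \<Phi> p \<and> lifts p \<psi>)"
proof -
  let ?G = "alg_Aut A"
  interpret G: group ?G by (rule aut_group)
  \<comment> \<open>Quantifying over \<theta> means that a lift of \<theta> is continued by \<psi>
    on the right; the case of a product is then mere associativity.\<close>
  have *: "\<psi> \<in> carrier ?G \<and> (\<forall>\<theta>\<in>carrier ?G. (\<exists>p. \<Phi> p \<and> lifts p \<theta>) \<longrightarrow> (\<exists>p. \<Phi> p \<and> lifts p (\<theta> \<otimes>\<^bsub>?G\<^esub> \<psi>)))"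
    using \<psi> unfolding tame_automorphisms_def
  proof induction
    case one
    then show ?case by simp
  next
    case (incl e)
    then have "e \<in> carrier ?G" by (simp add: elementary_automorphisms_def)
    then show ?case using lifts_elementary[OF _ _ incl] step unfolding lifts_def by metis
  next
    case (inv e)
    then have "inv\<^bsub>?G\<^esub> e \<in> carrier ?G" by (simp add: elementary_automorphisms_def)
    then show ?case using lifts_elementary[OF _ _ elementary_inverse[OF inv]] step unfolding lifts_def by metis
  next
    case (eng \<psi>1 \<psi>2)
    then show ?case by (metis G.m_assoc G.m_closed)
  qed
  moreover have "lifts nonassoc_gen \<one>\<^bsub>?G\<^esub>"
    unfolding lifts_def by (simp add: proj_gen alg_Aut_one)
  ultimately have "\<exists>p. \<Phi> p \<and> lifts p (\<one>\<^bsub>?G\<^esub> \<otimes>\<^bsub>?G\<^esub> \<psi>)" using base G.one_closed by blast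
  with * show ?thesis by simp
qed

end

section \<open>Truncation by degree\<close>

lemma (in nonassoc_algebra) add_minus_cancel:
  "a \<in> carrier A \<Longrightarrow> b \<in> carrier A \<Longrightarrow> a \<oplus> (b \<ominus> a) = b"
  by (simp add: a_minus_def M.a_comm[of b] M.r_neg2)

definition degree_above :: "nat \<Rightarrow> nat \<Rightarrow> (nat magma \<Rightarrow> 'k::field) set"
  where "degree_above n m = {r \<in> carrier (free_nonassoc n). \<forall>w. r w \<noteq> 0 \<longrightarrow> m < magma_degree w}"

lemma ideal_degree_above:
  "ideal_of (free_nonassoc n) (degree_above n m :: (nat magma \<Rightarrow> 'k::field) set)"
proof (rule free_nonassoc.idealI)
  let ?F = "free_nonassoc n :: ('k, nat magma \<Rightarrow> 'k) module"
  show "submodule (degree_above n m) scalars ?F"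
    unfolding free_nonassoc.submodule_iff
  proof (intro conjI ballI allI)
    show "degree_above n m \<subseteq> carrier ?F" by (auto simp: degree_above_def)
    show "\<zero>\<^bsub>?F\<^esub> \<in> degree_above n m"
      using free_nonassoc.M.zero_closed[of n] by (simp add: degree_above_def)
    fix f :: "nat magma \<Rightarrow> 'k" assume f: "f \<in> degree_above n m"
    show "a \<odot>\<^bsub>?F\<^esub> f \<in> degree_above n m" for a
      using f free_nonassoc.smult_in[of f n a] by (simp add: degree_above_def)
    fix g :: "nat magma \<Rightarrow> 'k" assume g: "g \<in> degree_above n m"
    have "m < magma_degree w" if "f w + g w \<noteq> 0" for w
    proof -
      from that have "f w \<noteq> 0 \<or> g w \<noteq> 0" by auto
      then show ?thesis using f g by (auto simp: degree_above_def)
    qed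
    then show "f \<oplus>\<^bsub>?F\<^esub> g \<in> degree_above n m"
      using f g free_nonassoc.M.a_closed[of f n g] by (simp add: degree_above_def)
  qed
  fix f g :: "nat magma \<Rightarrow> 'k" assume f: "f \<in> degree_above n m" and g: "g \<in> carrier ?F"
  have "m < magma_degree w" if "nonassoc_mult f g w \<noteq> 0" for w
    using that f by (cases w) (auto simp: degree_above_def intro: trans_less_add1)
  then show "f \<otimes>\<^bsub>?F\<^esub> g \<in> degree_above n m"
    using f g free_nonassoc.mult_closed[of f n g] by (simp add: degree_above_def)
  have "m < magma_degree w" if "nonassoc_mult g f w \<noteq> 0" for w
    using that f by (cases w) (auto simp: degree_above_def intro: trans_less_add2)
  then show "g \<otimes>\<^bsub>?F\<^esub> f \<in> degree_above n m"
    using f g free_nonassoc.mult_closed[of g n f] by (simp add: degree_above_def)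
qed

context relatively_free begin

lemma eval_magma_proj: "set_magma w \<subseteq> {1..n} \<Longrightarrow> eval_magma A x w = proj (magma_monomial w)"
proof -
  assume w: "set_magma w \<subseteq> {1..n}"
  then have "eval_magma A x w = eval_magma A (\<lambda>i. proj (nonassoc_gen i)) w"
  proof (induction w)
    case (Gen i)
    then show ?case using proj_gen[of i] by simp
  qed simp
  also have "\<dots> = proj (magma_monomial w)"
    by (rule hom_monomial[OF nonassoc_algebra_axioms proj_alg_hom w, symmetric])
  finally show ?thesis .
qed

lemma ideal_proj_degree_above: "ideal_of A (proj ` degree_above n m)"
proof (rule lie_idealI)
  note I = ideal_degree_above[of n m, where ?'k = 'k]
  show "submodule (proj ` degree_above n m) scalars A"
    by (rule proj.submodule_image) (use I in \<open>simp add: ideal_of_def\<close>)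
  fix y z assume "y \<in> proj ` degree_above n m" and z: "z \<in> carrier A"
  then obtain f where f: "f \<in> degree_above n m" "y = proj f" by blast
  obtain g where g: "g \<in> carrier F" "z = proj g" by (rule projE[OF z])
  have "f \<in> carrier F" using f by (simp add: degree_above_def)
  then have "y \<otimes> z = proj (f \<otimes>\<^bsub>F\<^esub> g)" using f g by (simp del: free_nonassoc_sel)
  moreover have "f \<otimes>\<^bsub>F\<^esub> g \<in> degree_above n m" using I f(1) g(1) unfolding ideal_of_def by blast
  ultimately show "y \<otimes> z \<in> proj ` degree_above n m" by simp
qed

text \<open>This trades the graded components of \<open>A\<close> for images of polynomials all of
  whose monomials have large degree, so the decomposition of \<open>A\<close> itself is never
  analysed.\<close>

lemma higher_components_subset:
  "lin_span A (\<Union>d\<in>{m<..}. homogeneous_component A x n d) \<subseteq> proj ` degree_above n m"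
proof (rule lin_span_minimal)
  show sub: "submodule (proj ` degree_above n m) scalars A" by (rule idealD(1)[OF ideal_proj_degree_above])
  have "homogeneous_component A x n d \<subseteq> proj ` degree_above n m" if "m < d" for d
    unfolding homogeneous_component_def
  proof (rule lin_span_minimal[OF _ sub], rule image_subsetI)
    fix w assume "w \<in> {w. set_magma w \<subseteq> {1..n} \<and> magma_degree w = d}"
    then have w: "set_magma w \<subseteq> {1..n}" "magma_degree w = d" by simp_all
    then have "(magma_monomial w :: nat magma \<Rightarrow> 'k) \<in> degree_above n m"
      using \<open>m < d\<close> magma_monomial_carrier[OF w(1)]
      by (auto simp: degree_above_def magma_monomial_def split: if_splits)
    then show "eval_magma A x w \<in> proj ` degree_above n m"
      using eval_magma_proj[OF w(1)] by simp
  qed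
  then show "(\<Union>d\<in>{m<..}. homogeneous_component A x n d) \<subseteq> proj ` degree_above n m" by blast
qed

text \<open>The displacement of a product is
  \<open>(\<theta> y - y) \<theta> z + y (\<theta> z - z)\<close>. Hence the elements displaced only
  within \<open>I\<close> form a subalgebra.\<close>

lemma hom_near_identity:
  assumes \<theta>: "algebra_hom A A \<theta>" and I: "ideal_of A I"
    and gen: "\<And>j. j \<in> {1..n} \<Longrightarrow> \<theta> (x j) \<ominus> x j \<in> I" and y: "y \<in> carrier A"
  shows "\<theta> y \<ominus> y \<in> I"
proof -
  interpret \<theta>: algebra_hom A A \<theta> by fact
  note D = submoduleD[OF idealD(1)[OF I]]
  have "subalgebra_of A {y \<in> carrier A. \<theta> y \<ominus> y \<in> I}"
  proof (rule subalgebraI)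
    show "{y \<in> carrier A. \<theta> y \<ominus> y \<in> I} \<subseteq> carrier A" by simp
    show "\<zero> \<in> {y \<in> carrier A. \<theta> y \<ominus> y \<in> I}" using D(2) D(5)[OF D(2)] by (simp add: a_minus_def)
    fix y assume "y \<in> {y \<in> carrier A. \<theta> y \<ominus> y \<in> I}"
    then have y: "y \<in> carrier A" "\<theta> y \<ominus> y \<in> I" by simp_all
    have "\<theta> (a \<odot>\<^bsub>A\<^esub> y) \<ominus> a \<odot>\<^bsub>A\<^esub> y = a \<odot>\<^bsub>A\<^esub> (\<theta> y \<ominus> y)" for a
      using y(1) by (simp add: a_minus_def smult_add minus_eq_smult smult_smult mult.commute)
    then show "a \<odot>\<^bsub>A\<^esub> y \<in> {y \<in> carrier A. \<theta> y \<ominus> y \<in> I}" for a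
      using D(4)[OF y(2)] y(1) by simp
    fix z assume "z \<in> {y \<in> carrier A. \<theta> y \<ominus> y \<in> I}"
    then have z: "z \<in> carrier A" "\<theta> z \<ominus> z \<in> I" by simp_all
    have "\<theta> (y \<oplus> z) \<ominus> (y \<oplus> z) = (\<theta> y \<ominus> y) \<oplus> (\<theta> z \<ominus> z)"
      using y(1) z(1) by (simp add: a_minus_def M.minus_add M.add.m_ac)
    then show "y \<oplus> z \<in> {y \<in> carrier A. \<theta> y \<ominus> y \<in> I}"
      using D(3)[OF y(2) z(2)] y(1) z(1) by simp
    have "\<theta> (y \<otimes> z) \<ominus> (y \<otimes> z) = (\<theta> y \<ominus> y) \<otimes> \<theta> z \<oplus> y \<otimes> (\<theta> z \<ominus> z)"
      using y(1) z(1) 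
      by (simp add: a_minus_def mult_add_left mult_add_right mult_uminus_left mult_uminus_right
          M.add.m_assoc M.r_neg1 M.r_neg2)
    moreover have "(\<theta> y \<ominus> y) \<otimes> \<theta> z \<in> I" "y \<otimes> (\<theta> z \<ominus> z) \<in> I"
      using idealD(2)[OF I y(2) \<theta>.hom_closed[OF z(1)]] idealD(3)[OF I z(2) y(1)] .
    ultimately show "y \<otimes> z \<in> {y \<in> carrier A. \<theta> y \<ominus> y \<in> I}"
      using D(3) y(1) z(1) by simp
  qed
  then have "{y \<in> carrier A. \<theta> y \<ominus> y \<in> I} = carrier A"
    by (rule subalgebra_gens) (use gen gen_closed in auto)
  with y have "y \<in> {y \<in> carrier A. \<theta> y \<ominus> y \<in> I}" by (simp only:)
  then show ?thesis by simp
qed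

text \<open>The composite of \<phi> with the inverse of \<psi> is the identity up to high degree on
  the generators, hence on every element. It is applied to \<open>\<psi> (x j)\<close>.\<close>

lemma IA_difference:
  assumes \<phi>: "\<phi> \<in> carrier (alg_Aut A)" and \<psi>: "\<psi> \<in> carrier (alg_Aut A)"
    and IA: "\<phi> \<otimes>\<^bsub>alg_Aut A\<^esub> inv\<^bsub>alg_Aut A\<^esub> \<psi> \<in> IA_group A x n m" and j: "j \<in> {1..n}"
  shows "\<phi> (x j) \<ominus> \<psi> (x j) \<in> proj ` degree_above n m"
proof -
  let ?\<theta> = "\<phi> \<otimes>\<^bsub>alg_Aut A\<^esub> inv\<^bsub>alg_Aut A\<^esub> \<psi>"
  interpret G: group "alg_Aut A" by (rule aut_group)
  interpret \<psi>: algebra_hom A A \<psi> by (rule aut_hom[OF \<psi>])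
  have \<theta>: "?\<theta> \<in> carrier (alg_Aut A)" using \<phi> \<psi> by simp
  have "?\<theta> (\<psi> (x j)) \<ominus> \<psi> (x j) \<in> proj ` degree_above n m"
  proof (rule hom_near_identity[OF aut_hom[OF \<theta>] ideal_proj_degree_above])
    fix j assume "j \<in> {1..n}"
    then show "?\<theta> (x j) \<ominus> x j \<in> proj ` degree_above n m"
      using IA higher_components_subset unfolding IA_group_def by blast
  qed (use gen_closed[OF j] in simp)
  moreover have "?\<theta> (\<psi> (x j)) = \<phi> (x j)"
    using alg_Aut_mult[OF \<phi> G.inv_closed[OF \<psi>] \<psi>.hom_closed[OF gen_closed[OF j]]]
      inv_aut_apply[OF \<psi> gen_closed[OF j]] by simp
  ultimately show ?thesis by simp
qed

text \<open>Approximate tameness in the form in which it will be refuted: any chosen lift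
  \<open>q\<close> differs from a tuple with \<Phi> only by terms of large degree and relations of
  the variety. An invariant blind to both cannot tell \<phi> from a tame automorphism.\<close>

lemma approximately_tame_lifts:
  assumes tame: "approximately_tame A x n \<phi>" and q: "lifts q \<phi>" and m: "m \<ge> 1"
    and base: "\<Phi> nonassoc_gen"
    and step: "\<And>p i \<alpha> f. \<Phi> p \<Longrightarrow> (\<And>j. j \<in> {1..n} \<Longrightarrow> p j \<in> carrier F) \<Longrightarrow> i \<in> {1..n} \<Longrightarrow> \<alpha> \<noteq> 0 \<Longrightarrow>
      f \<in> carrier F \<Longrightarrow> f \<in> subalgebra_of F hull (nonassoc_gen ` ({1..n} - {i})) \<Longrightarrow>
      \<Phi> (elementary_tuple p i \<alpha> f)"
  obtains p where "\<Phi> p" "\<And>j. j \<in> {1..n} \<Longrightarrow> p j \<in> carrier F"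
    "\<And>j. j \<in> {1..n} \<Longrightarrow> \<exists>r\<in>degree_above n m. \<exists>s\<in>polynilpotent_relations cs n. q j = p j \<oplus>\<^bsub>F\<^esub> (r \<oplus>\<^bsub>F\<^esub> s)"
proof -
  obtain \<psi> where \<phi>: "\<phi> \<in> carrier (alg_Aut A)" and \<psi>: "\<psi> \<in> tame_automorphisms A x n"
    and IA: "\<phi> \<otimes>\<^bsub>alg_Aut A\<^esub> inv\<^bsub>alg_Aut A\<^esub> \<psi> \<in> IA_group A x n m"
    using tame m unfolding approximately_tame_def by blast
  have "\<psi> \<in> carrier (alg_Aut A) \<and> (\<exists>p. \<Phi> p \<and> lifts p \<psi>)"
    by (rule tame_lifts[where \<Phi> = \<Phi>, OF \<psi> base]) (rule step; assumption)
  then obtain p where \<psi>A: "\<psi> \<in> carrier (alg_Aut A)" and \<Phi>: "\<Phi> p" and p: "lifts p \<psi>" by blast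
  show ?thesis
  proof (rule that[OF \<Phi>])
    fix j assume j: "j \<in> {1..n}"
    have pj: "p j \<in> carrier F" "proj (p j) = \<psi> (x j)" and qj: "q j \<in> carrier F" "proj (q j) = \<phi> (x j)"
      using p q j by (simp_all add: lifts_def)
    then show "p j \<in> carrier F" by simp
    obtain r where r: "r \<in> degree_above n m" "\<phi> (x j) \<ominus> \<psi> (x j) = proj r"
      using IA_difference[OF \<phi> \<psi>A IA j] by blast
    have rC: "r \<in> carrier F" using r by (simp add: degree_above_def)
    define s where "s = q j \<ominus>\<^bsub>F\<^esub> p j \<ominus>\<^bsub>F\<^esub> r"
    have sC: "s \<in> carrier F" using pj qj rC by (simp add: s_def del: free_nonassoc_sel)
    have "proj s = (\<phi> (x j) \<ominus> \<psi> (x j)) \<ominus> proj r" using pj qj rC by (simp add: s_def del: free_nonassoc_sel)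
    then have "proj s = \<zero>" using r(2) rC by (simp add: a_minus_def M.r_neg)
    then have "s \<in> polynilpotent_relations cs n" by (rule proj_kernel[OF sC])
    moreover have "q j = p j \<oplus>\<^bsub>F\<^esub> (r \<oplus>\<^bsub>F\<^esub> s)"
    proof -
      note cancel = free_nonassoc.add_minus_cancel[of _ n]
      show ?thesis unfolding s_def using pj qj by (simp only: cancel rC free_nonassoc.M.minus_closed)
    qed
    ultimately show "\<exists>r\<in>degree_above n m. \<exists>s\<in>polynilpotent_relations cs n. q j = p j \<oplus>\<^bsub>F\<^esub> (r \<oplus>\<^bsub>F\<^esub> s)"
      using r(1) by blast
  qed
qed

end

section \<open>Two constructions of automorphisms\<close>

lemma (in algebra_hom) hom_inj_iff:
  "inj_on h (carrier A) \<longleftrightarrow> (\<forall>a\<in>carrier A. h a = \<zero>\<^bsub>B\<^esub> \<longrightarrow> a = \<zero>\<^bsub>A\<^esub>)"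
proof
  assume inj: "inj_on h (carrier A)"
  show "\<forall>a\<in>carrier A. h a = \<zero>\<^bsub>B\<^esub> \<longrightarrow> a = \<zero>\<^bsub>A\<^esub>"
  proof (intro ballI impI)
    fix a assume "a \<in> carrier A" "h a = \<zero>\<^bsub>B\<^esub>"
    then show "a = \<zero>\<^bsub>A\<^esub>" using inj_onD[OF inj, of a "\<zero>\<^bsub>A\<^esub>"] by simp
  qed
next
  assume *: "\<forall>a\<in>carrier A. h a = \<zero>\<^bsub>B\<^esub> \<longrightarrow> a = \<zero>\<^bsub>A\<^esub>"
  show "inj_on h (carrier A)"
  proof (rule inj_onI)
    fix a b assume ab: "a \<in> carrier A" "b \<in> carrier A" "h a = h b"
    then have "h (a \<ominus>\<^bsub>A\<^esub> b) = \<zero>\<^bsub>B\<^esub>" by (simp add: a_minus_def B.M.r_neg)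
    then have "a \<ominus>\<^bsub>A\<^esub> b = \<zero>\<^bsub>A\<^esub>" using * ab by simp
    then show "a = b" using A.minus_eq_zero_iff ab by simp
  qed
qed

context relatively_free begin

lemma hom_mult_difference:
  assumes "algebra_hom A A \<theta>" "y \<in> carrier A" "z \<in> carrier A"
  shows "\<theta> (y \<otimes> z) \<ominus> (y \<otimes> z) = (\<theta> y \<ominus> y) \<otimes> \<theta> z \<oplus> y \<otimes> (\<theta> z \<ominus> z)"
proof -
  interpret \<theta>: algebra_hom A A \<theta> by fact
  show ?thesis using assms(2,3)
    by (simp add: a_minus_def mult_add_left mult_add_right mult_uminus_left mult_uminus_right
        M.add.m_assoc M.r_neg1 M.r_neg2)
qed

text \<open>The map induces the identity on \<open>A / J\<close> and on all quotients
  \<open>J^m / J^(m+1)\<close>; for m > 1 this follows from m = 1 by the formula for the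
  displacement of a product. Since the chain of powers ends at zero, \<phi> is bijective.\<close>

lemma unipotent_bij:
  assumes \<phi>: "algebra_hom A A \<phi>" and J: "ideal_of A J" and nil: "lie_power A J (Suc c) = {\<zero>}"
    and N: "\<And>a. a \<in> carrier A \<Longrightarrow> \<phi> a \<ominus> a \<in> J" and N2: "\<And>a. a \<in> J \<Longrightarrow> \<phi> a \<ominus> a \<in> lie_power A J 2"
  shows "bij_betw \<phi> (carrier A) (carrier A)"
proof -
  interpret \<phi>: algebra_hom A A \<phi> by fact
  note P = lie_power_ideal[OF J] and Js = idealD(1)[OF J]
  note PD = submoduleD[OF lie_power_submodule[OF Js]] and JD = submoduleD[OF Js]
  have pow_step: "\<forall>a\<in>lie_power A J m. \<phi> a \<ominus> a \<in> lie_power A J (Suc m)" if "m \<ge> 1" for m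
    using that
  proof (induction m rule: dec_induct)
    case base
    then show ?case using N2 by (simp add: numeral_2_eq_2)
  next
    case (step m)
    have "lie_power A J (Suc m) \<subseteq> {a \<in> carrier A. \<phi> a \<ominus> a \<in> lie_power A J (Suc (Suc m))}"
    proof (rule lie_power_induct[OF Js step(1)])
      show "submodule {a \<in> carrier A. \<phi> a \<ominus> a \<in> lie_power A J (Suc (Suc m))} scalars A"
        unfolding submodule_iff
      proof (intro conjI ballI allI)
        let ?P = "lie_power A J (Suc (Suc m))"
        show "{a \<in> carrier A. \<phi> a \<ominus> a \<in> ?P} \<subseteq> carrier A" by blast
        show "\<zero> \<in> {a \<in> carrier A. \<phi> a \<ominus> a \<in> ?P}"
          using PD(2)[of "Suc (Suc m)"] by (simp add: a_minus_def M.r_neg del: lie_power.simps)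
        fix y assume y: "y \<in> {a \<in> carrier A. \<phi> a \<ominus> a \<in> ?P}"
        have "\<phi> (b \<odot>\<^bsub>A\<^esub> y) \<ominus> b \<odot>\<^bsub>A\<^esub> y = b \<odot>\<^bsub>A\<^esub> (\<phi> y \<ominus> y)" for b
          using y by (simp add: a_minus_def smult_add minus_eq_smult smult_smult mult.commute)
        then show "b \<odot>\<^bsub>A\<^esub> y \<in> {a \<in> carrier A. \<phi> a \<ominus> a \<in> ?P}" for b
          using PD(4)[of "\<phi> y \<ominus> y" "Suc (Suc m)" b] y by (simp del: lie_power.simps)
        fix z assume z: "z \<in> {a \<in> carrier A. \<phi> a \<ominus> a \<in> ?P}"
        have "\<phi> (y \<oplus> z) \<ominus> (y \<oplus> z) = (\<phi> y \<ominus> y) \<oplus> (\<phi> z \<ominus> z)"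
          using y z by (simp add: a_minus_def M.minus_add M.add.m_ac)
        then show "y \<oplus> z \<in> {a \<in> carrier A. \<phi> a \<ominus> a \<in> ?P}"
          using PD(3)[of "\<phi> y \<ominus> y" "Suc (Suc m)" "\<phi> z \<ominus> z"] y z by (simp del: lie_power.simps)
      qed
      fix y z assume y: "y \<in> lie_power A J m" and z: "z \<in> J"
      have C: "y \<in> carrier A" "z \<in> carrier A" using PD(1)[OF y] JD(1)[OF z] .
      have "\<phi> z = z \<oplus> (\<phi> z \<ominus> z)" using C by (simp add: add_minus_cancel)
      then have \<phi>z: "\<phi> z \<in> J" using JD(3)[OF z N[OF C(2)]] by simp
      have 1: "(\<phi> y \<ominus> y) \<otimes> \<phi> z \<in> lie_power A J (Suc (Suc m))"
        by (rule lie_power_bracket[OF Js _ _ \<phi>z]) (use step y in auto)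
      have 2: "y \<otimes> (\<phi> z \<ominus> z) \<in> lie_power A J (Suc (Suc m))"
        by (rule lie_power_bracket_square[OF J step(1) y N2[OF z]])
      show "y \<otimes> z \<in> {a \<in> carrier A. \<phi> a \<ominus> a \<in> lie_power A J (Suc (Suc m))}"
        using hom_mult_difference[OF \<phi> C] PD(3)[OF 1 2] C by (simp del: lie_power.simps)
    qed
    then show ?case by blast
  qed
  have "inj_on \<phi> (carrier A)"
    unfolding \<phi>.hom_inj_iff
  proof (intro ballI impI)
    fix a assume a: "a \<in> carrier A" "\<phi> a = \<zero>"
    \<comment> \<open>A kernel element is the negative of its own displacement, which lies one power
      deeper than the element itself. So it lies in every power.\<close>
    have neg: "a = \<ominus> (\<phi> a \<ominus> a)" using a by (simp add: a_minus_def)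
    have "a \<in> lie_power A J m" if "m \<ge> 1" for m
      using that
    proof (induction m rule: dec_induct)
      case base
      show ?case using JD(5)[OF N[OF a(1)]] neg by simp
    next
      case (step m)
      then have "\<phi> a \<ominus> a \<in> lie_power A J (Suc m)" using pow_step by blast
      from PD(5)[OF this] show ?case using neg by (simp del: lie_power.simps)
    qed
    from this[of "Suc c"] show "a = \<zero>" using nil by (simp del: lie_power.simps)
  qed
  moreover have "\<phi> ` carrier A = carrier A"
  proof
    show "\<phi> ` carrier A \<subseteq> carrier A" by auto
    note im = submoduleD[OF \<phi>.submodule_image[OF submodule_carrier]]
    have eq: "a = \<phi> a \<ominus> (\<phi> a \<ominus> a)" if "a \<in> carrier A" for a
      using that by (simp add: a_minus_def M.minus_add M.r_neg1 M.r_neg2 M.r_neg M.add.m_assoc[symmetric])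
    \<comment> \<open>Downward from \<open>J^(c+1) = 0\<close>: in
      \<open>a = \<phi> a - (\<phi> a - a)\<close> the subtracted term lies in the next power, which
      is already known to be in the image.\<close>
    have "lie_power A J (Suc c - d) \<subseteq> \<phi> ` carrier A" if "d \<le> c" for d
      using that
    proof (induction d)
      case 0
      then show ?case using nil im(2) by (simp del: lie_power.simps)
    next
      case (Suc d)
      show ?case
      proof
        fix a assume a: "a \<in> lie_power A J (Suc c - Suc d)"
        have aC: "a \<in> carrier A" by (rule PD(1)[OF a])
        have "\<phi> a \<ominus> a \<in> lie_power A J (Suc (Suc c - Suc d))"
          using pow_step[of "Suc c - Suc d"] a Suc.prems by (simp del: lie_power.simps)
        moreover have "Suc (Suc c - Suc d) = Suc c - d" using Suc.prems by simp
        ultimately have "\<phi> a \<ominus> a \<in> \<phi> ` carrier A" using Suc by (metis Suc_leD subsetD)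
        from im(6)[OF imageI[OF aC] this] have "\<phi> a \<ominus> (\<phi> a \<ominus> a) \<in> \<phi> ` carrier A" .
        then show "a \<in> \<phi> ` carrier A" using eq[OF aC] by simp
      qed
    qed
    from this[of c] have J_im: "J \<subseteq> \<phi> ` carrier A" by simp
    show "carrier A \<subseteq> \<phi> ` carrier A"
    proof
      fix a assume a: "a \<in> carrier A"
      from im(6)[OF imageI[OF a] subsetD[OF J_im N[OF a]]]
      have "\<phi> a \<ominus> (\<phi> a \<ominus> a) \<in> \<phi> ` carrier A" .
      then show "a \<in> \<phi> ` carrier A" using eq[OF a] by simp
    qed
  qed
  ultimately show ?thesis by (simp add: bij_betw_def)
qed

text \<open>Modulo \<open>J^2\<close> the map 1 + ad u is multiplicative, because the only excess
  term \<open>(u y) (u z)\<close> lies in \<open>J^2\<close>. So \<phi> coincides with it modulo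
  \<open>J^2\<close> on all of \<open>A\<close>, and \<open>unipotent_bij\<close> applies.\<close>

lemma inner_like_automorphism:
  assumes J: "ideal_of A J" and nil: "lie_power A J (Suc c) = {\<zero>}" and u: "u \<in> J"
  obtains \<phi> where "\<phi> \<in> carrier (alg_Aut A)" "\<And>i. i \<in> {1..n} \<Longrightarrow> \<phi> (x i) = x i \<oplus> u \<otimes> x i"
proof -
  have uC: "u \<in> carrier A" by (rule idealD(4)[OF J u])
  obtain \<phi> where \<phi>: "\<phi> \<in> alg_hom A A" "\<phi> \<in> extensional (carrier A)"
      "\<And>i. i \<in> {1..n} \<Longrightarrow> \<phi> (x i) = x i \<oplus> u \<otimes> x i"
    by (rule ext_hom[of "\<lambda>i. x i \<oplus> u \<otimes> x i"]) (use uC in auto)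
  have \<phi>h: "algebra_hom A A \<phi>" by (intro algebra_homI nonassoc_algebra_axioms \<phi>(1))
  interpret \<phi>: algebra_hom A A \<phi> by fact
  let ?Q = "lie_power A J 2"
  note Js = idealD(1)[OF J]
  have Q: "ideal_of A ?Q" by (rule lie_power_ideal[OF J])
  note D = submoduleD[OF idealD(1)[OF Q]] and JD = submoduleD[OF Js]
  have QJ: "?Q \<subseteq> J" using lie_power_decreasing[OF J, of 1] by (simp add: numeral_2_eq_2)
  have br: "y \<otimes> z \<in> ?Q" if "y \<in> J" "z \<in> J" for y z
    using lie_power_bracket[OF Js, of 1 y z] that by (simp add: numeral_2_eq_2)
  define E where "E = {a \<in> carrier A. \<exists>q\<in>?Q. \<phi> a = (a \<oplus> u \<otimes> a) \<oplus> q}"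
  have EI: "a \<in> E" if "a \<in> carrier A" "q \<in> ?Q" "\<phi> a = (a \<oplus> u \<otimes> a) \<oplus> q" for a q
    unfolding E_def using that by blast
  have EE: "\<exists>q. q \<in> ?Q \<and> \<phi> a = (a \<oplus> u \<otimes> a) \<oplus> q \<and> a \<in> carrier A" if "a \<in> E" for a
    using that unfolding E_def by blast
  have "subalgebra_of A E"
  proof (rule subalgebraI)
    show "E \<subseteq> carrier A" unfolding E_def by blast
    show "\<zero> \<in> E" by (rule EI[OF _ D(2)]) (use uC in simp_all)
    fix y assume "y \<in> E"
    from EE[OF this] obtain q where y: "y \<in> carrier A" "q \<in> ?Q" "\<phi> y = (y \<oplus> u \<otimes> y) \<oplus> q" by blast
    have qC: "q \<in> carrier A" by (rule D(1)[OF y(2)])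
    have "\<phi> (a \<odot>\<^bsub>A\<^esub> y) = (a \<odot>\<^bsub>A\<^esub> y \<oplus> u \<otimes> (a \<odot>\<^bsub>A\<^esub> y)) \<oplus> a \<odot>\<^bsub>A\<^esub> q" for a
      using y(1) uC qC by (simp add: y(3) smult_add mult_smult_right)
    then show "a \<odot>\<^bsub>A\<^esub> y \<in> E" for a
      using y(1) by (intro EI[OF _ D(4)[OF y(2)]]) simp_all
    fix z assume "z \<in> E"
    from EE[OF this] obtain r where z: "z \<in> carrier A" "r \<in> ?Q" "\<phi> z = (z \<oplus> u \<otimes> z) \<oplus> r" by blast
    have rC: "r \<in> carrier A" by (rule D(1)[OF z(2)])
    have "\<phi> (y \<oplus> z) = ((y \<oplus> z) \<oplus> u \<otimes> (y \<oplus> z)) \<oplus> (q \<oplus> r)"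
      using y(1) z(1) uC qC rC by (simp add: y(3) z(3) mult_add_right M.add.m_ac)
    then show "y \<oplus> z \<in> E"
      using y(1) z(1) by (intro EI[OF _ D(3)[OF y(2) z(2)]]) simp_all
    have uy: "u \<otimes> y \<in> J" "u \<otimes> z \<in> J" using idealD(2)[OF J u] y(1) z(1) by simp_all
    have "\<phi> (y \<otimes> z) = (y \<oplus> u \<otimes> y) \<otimes> (z \<oplus> u \<otimes> z) \<oplus> ((y \<oplus> u \<otimes> y) \<otimes> r \<oplus> q \<otimes> \<phi> z)"
      using y(1) z(1) uC qC rC by (simp add: y(3) z(3) mult_add_left mult_add_right M.add.m_ac)
    also have "(y \<oplus> u \<otimes> y) \<otimes> (z \<oplus> u \<otimes> z) = (y \<otimes> z \<oplus> u \<otimes> (y \<otimes> z)) \<oplus> (u \<otimes> y) \<otimes> (u \<otimes> z)"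
      using y(1) z(1) uC by (simp add: bracket_left_derivation[of u y z] mult_add_left mult_add_right M.add.m_ac)
    finally have "\<phi> (y \<otimes> z) = (y \<otimes> z \<oplus> u \<otimes> (y \<otimes> z)) \<oplus>
        ((u \<otimes> y) \<otimes> (u \<otimes> z) \<oplus> ((y \<oplus> u \<otimes> y) \<otimes> r \<oplus> q \<otimes> \<phi> z))"
      using y(1) z(1) uC qC rC by (simp add: M.add.m_assoc)
    moreover have "(u \<otimes> y) \<otimes> (u \<otimes> z) \<oplus> ((y \<oplus> u \<otimes> y) \<otimes> r \<oplus> q \<otimes> \<phi> z) \<in> ?Q"
      using y(1) z(1) uC by (intro D(3) br uy idealD(3)[OF Q z(2)] idealD(2)[OF Q y(2)]) simp_all
    ultimately show "y \<otimes> z \<in> E" using y(1) z(1) by (intro EI) simp_all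
  qed
  then have E: "E = carrier A"
  proof (rule subalgebra_gens)
    fix i assume i: "i \<in> {1..n}"
    show "x i \<in> E" unfolding E_def
    proof (intro CollectI conjI bexI)
      show "x i \<in> carrier A" by (rule gen_closed[OF i])
      show "\<phi> (x i) = x i \<oplus> u \<otimes> x i \<oplus> \<zero>" using gen_closed[OF i] uC by (simp add: \<phi>(3)[OF i])
      show "\<zero> \<in> ?Q" by (rule D(2))
    qed
  qed
  have diff: "\<exists>q\<in>?Q. \<phi> a \<ominus> a = u \<otimes> a \<oplus> q" if a: "a \<in> carrier A" for a
  proof -
    from a have "a \<in> E" by (simp only: E)
    from EE[OF this] obtain q where q: "q \<in> ?Q" "\<phi> a = (a \<oplus> u \<otimes> a) \<oplus> q" by blast
    then have "\<phi> a \<ominus> a = u \<otimes> a \<oplus> q" 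
      using a uC D(1)[OF q(1)] by (simp add: a_minus_def M.add.m_assoc M.add.m_comm[of a] M.r_neg)
    with q show ?thesis by blast
  qed
  have "bij_betw \<phi> (carrier A) (carrier A)"
  proof (rule unipotent_bij[OF \<phi>h J nil])
    fix a assume a: "a \<in> carrier A"
    obtain q where "q \<in> ?Q" "\<phi> a \<ominus> a = u \<otimes> a \<oplus> q" using diff[OF a] by blast
    then show "\<phi> a \<ominus> a \<in> J" using JD(3) idealD(2)[OF J u a] QJ by auto
  next
    fix a assume a: "a \<in> J"
    obtain q where "q \<in> ?Q" "\<phi> a \<ominus> a = u \<otimes> a \<oplus> q" using diff[OF JD(1)[OF a]] by blast
    then show "\<phi> a \<ominus> a \<in> ?Q" using D(3) br[OF u a] by simp
  qed
  then show ?thesis using that \<phi> by (simp add: alg_Aut_carrier)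
qed

section \<open>Automorphisms adding a nilpotent operator applied to one generator\<close>

abbreviation ads :: "'a list \<Rightarrow> 'a \<Rightarrow> 'a"
  where "ads ws z \<equiv> foldr (\<otimes>) ws z"

lemma ads_closed: "set ws \<subseteq> carrier A \<Longrightarrow> z \<in> carrier A \<Longrightarrow> ads ws z \<in> carrier A"
  by (induction ws) auto

lemma ads_add: "set ws \<subseteq> carrier A \<Longrightarrow> y \<in> carrier A \<Longrightarrow> z \<in> carrier A \<Longrightarrow>
    ads ws (y \<oplus> z) = ads ws y \<oplus> ads ws z"
  by (induction ws) (auto simp: ads_closed mult_add_right)

lemma ads_uminus: "set ws \<subseteq> carrier A \<Longrightarrow> z \<in> carrier A \<Longrightarrow> ads ws (\<ominus> z) = \<ominus> ads ws z"
  by (induction ws) (auto simp: ads_closed mult_uminus_right)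

lemma ads_ideal: "ideal_of A I \<Longrightarrow> set ws \<subseteq> carrier A \<Longrightarrow> z \<in> I \<Longrightarrow> ads ws z \<in> I"
  by (induction ws) (auto intro: idealD(3))

text \<open>A single factor from \<open>J\<close> suffices: it moves an element into
  \<open>J\<close>, or one power deeper, and the other factors preserve ideals.\<close>

lemma ads_lie_power:
  assumes J: "ideal_of A J" and ws: "set ws \<subseteq> carrier A" and u: "u \<in> set ws" "u \<in> J"
  shows "z \<in> carrier A \<Longrightarrow> ads ws z \<in> J"
    and "m \<ge> 1 \<Longrightarrow> z \<in> lie_power A J m \<Longrightarrow> ads ws z \<in> lie_power A J (Suc m)"
proof -
  obtain us vs where ws_eq: "ws = us @ u # vs" using split_list[OF u(1)] by blast
  have C: "set us \<subseteq> carrier A" "set vs \<subseteq> carrier A" "u \<in> carrier A" using ws by (auto simp: ws_eq)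
  show "ads ws z \<in> J" if z: "z \<in> carrier A"
  proof -
    have "u \<otimes> ads vs z \<in> J" by (rule idealD(2)[OF J u(2) ads_closed[OF C(2) z]])
    from ads_ideal[OF J C(1) this] show ?thesis by (simp add: ws_eq)
  qed
  show "ads ws z \<in> lie_power A J (Suc m)" if m: "m \<ge> 1" and z: "z \<in> lie_power A J m"
  proof -
    note P = lie_power_ideal[OF J]
    have v: "ads vs z \<in> lie_power A J m" by (rule ads_ideal[OF P C(2) z])
    have "ads vs z \<otimes> u \<in> lie_power A J (Suc m)" by (rule lie_power_bracket[OF idealD(1)[OF J] m v u(2)])
    from submoduleD(5)[OF idealD(1)[OF P] this]
    have "u \<otimes> ads vs z \<in> lie_power A J (Suc m)"
      using bracket_anticomm[of "ads vs z" u] idealD(4)[OF P v] C(3) by (simp del: lie_power.simps)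
    from ads_ideal[OF P C(1) this] show ?thesis by (simp add: ws_eq del: lie_power.simps)
  qed
qed

lemma hom_ads:
  assumes "algebra_hom A A \<theta>" "set ws \<subseteq> carrier A" "\<And>w. w \<in> set ws \<Longrightarrow> \<theta> w = w" "z \<in> carrier A"
  shows "\<theta> (ads ws z) = ads ws (\<theta> z)"
proof -
  interpret \<theta>: algebra_hom A A \<theta> by fact
  show ?thesis using assms(2,3) by (induction ws) (simp_all add: ads_closed[OF _ assms(4)])
qed

text \<open>Let T be the product of the operators ad w for w in \<open>ws\<close>. An endomorphism
  fixing the other generators fixes each w and therefore commutes with T. So x_s \<mapsto> (1 + T)
  x_s is inverted by x_s \<mapsto> (1 + T)^(-1) x_s, which makes sense because T is
  nilpotent.\<close>

lemma ads_automorphism: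
  assumes J: "ideal_of A J" and nil: "lie_power A J (Suc c) = {\<zero>}"
    and s: "s \<in> {1..n}" and ws: "set ws \<subseteq> subalgebra_of A hull (x ` ({1..n} - {s}))"
    and u: "u \<in> set ws" "u \<in> J"
  obtains \<phi> where "\<phi> \<in> carrier (alg_Aut A)" "\<phi> (x s) = x s \<oplus> ads ws (x s)"
    "\<And>i. i \<in> {1..n} - {s} \<Longrightarrow> \<phi> (x i) = x i"
proof -
  let ?H = "subalgebra_of A hull (x ` ({1..n} - {s}))"
  have "x ` ({1..n} - {s}) \<subseteq> carrier A" using gen_closed by blast
  from subalgebra_hull[OF this] have H: "?H \<subseteq> carrier A"
    by (simp add: subalgebra_of_def submodule_iff)
  with ws have wsC: "set ws \<subseteq> carrier A" by (rule subset_trans)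
  have xs: "x s \<in> carrier A" by (rule gen_closed[OF s])
  note Js = idealD(1)[OF J] and lp = ads_lie_power[OF J wsC u]
  note P = submoduleD[OF lie_power_submodule[OF Js]]
  have commute: "\<theta> (ads ws z) = ads ws (\<theta> z)"
    if \<theta>: "algebra_hom A A \<theta>" "\<And>i. i \<in> {1..n} - {s} \<Longrightarrow> \<theta> (x i) = x i" and z: "z \<in> carrier A" for \<theta> z
  proof (rule hom_ads[OF \<theta>(1) wsC _ z])
    have idH: "algebra_hom A A (\<lambda>y. y)"
      by (intro algebra_homI nonassoc_algebra_axioms) (simp add: alg_hom_def)
    have "?H \<subseteq> {y \<in> carrier A. \<theta> y = y}"
      by (rule hull_minimal) (use \<theta>(2) gen_closed subalgebra_equalizer[OF \<theta>(1) idH] in auto)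
    then show "\<theta> w = w" if "w \<in> set ws" for w using ws that by blast
  qed
  have zero: "d = \<zero>" if d: "d \<in> carrier A" "d \<oplus> ads ws d = \<zero>" for d
  proof -
    have neg: "d = \<ominus> ads ws d"
      using d ads_closed[OF wsC d(1)] by (intro M.minus_equality[symmetric]) simp_all
    have "d \<in> lie_power A J m" if "m \<ge> 1" for m
      using that
    proof (induction m rule: dec_induct)
      case base
      show ?case using submoduleD(5)[OF Js lp(1)[OF d(1)]] neg by simp
    next
      case (step m)
      from P(5)[OF lp(2)[OF step(1,3)]] show ?case using neg by (simp del: lie_power.simps)
    qed
    from this[of "Suc c"] show ?thesis using nil by (simp del: lie_power.simps)
  qed
  \<comment> \<open>The partial sums of the geometric series for (1 + T)^(-1) x_s. Consecutive ones
    differ by an element of \<open>J^(m+1)\<close>, so the sequence is stationary from index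
    \<open>c\<close> on.\<close>
  define S where "S = rec_nat (x s) (\<lambda>_ y. x s \<ominus> ads ws y)"
  have S0: "S 0 = x s" and SS: "S (Suc m) = x s \<ominus> ads ws (S m)" for m by (simp_all add: S_def)
  have SC: "S m \<in> carrier A" for m by (induction m) (simp_all add: S0 SS xs ads_closed[OF wsC])
  have "S (Suc m) \<ominus> S m \<in> lie_power A J (Suc m)" for m
  proof (induction m)
    case 0
    have "S (Suc 0) \<ominus> S 0 = \<ominus> ads ws (x s)"
      using xs ads_closed[OF wsC xs] by (simp add: S0 SS a_minus_def M.add.m_ac M.r_neg1 M.r_neg2)
    then show ?case using submoduleD(5)[OF Js lp(1)[OF xs]] by simp
  next
    case (Suc m)
    have "(x s \<ominus> p) \<ominus> (x s \<ominus> q) = \<ominus> (p \<ominus> q)" if "p \<in> carrier A" "q \<in> carrier A" for p q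
      using xs that add_minus_cancel[of "x s" "\<ominus> p", unfolded a_minus_def]
      by (simp add: a_minus_def M.minus_add M.add.m_ac)
    from this[OF ads_closed[OF wsC SC[of "Suc m"]] ads_closed[OF wsC SC[of m]]]
    have "S (Suc (Suc m)) \<ominus> S (Suc m) = \<ominus> (ads ws (S (Suc m)) \<ominus> ads ws (S m))"
      by (simp only: SS)
    also have "ads ws (S (Suc m)) \<ominus> ads ws (S m) = ads ws (S (Suc m) \<ominus> S m)"
      using SC[of m] SC[of "Suc m"] by (simp add: a_minus_def ads_add[OF wsC] ads_uminus[OF wsC])
    finally have "S (Suc (Suc m)) \<ominus> S (Suc m) = \<ominus> ads ws (S (Suc m) \<ominus> S m)" .
    with P(5)[OF lp(2)[OF _ Suc]] show ?case by (simp del: lie_power.simps)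
  qed
  from this[of c] have "S (Suc c) = S c" using nil SC minus_eq_zero_iff by (simp del: lie_power.simps)
  then have Sc: "S c \<oplus> ads ws (S c) = x s"
    using SS[of c] xs SC[of c] ads_closed[OF wsC SC[of c]]
    by (metis M.add.inv_solve_right' a_minus_def)
  have T: "ads ws (x s) \<in> carrier A" by (rule ads_closed[OF wsC xs])
  obtain \<phi> where \<phi>: "\<phi> \<in> alg_hom A A" "\<phi> \<in> extensional (carrier A)"
      "\<And>i. i \<in> {1..n} \<Longrightarrow> \<phi> (x i) = (if i = s then x s \<oplus> ads ws (x s) else x i)"
    by (rule ext_hom[of "\<lambda>i. if i = s then x s \<oplus> ads ws (x s) else x i"]) (use xs T in auto)
  obtain \<psi> where \<psi>: "\<psi> \<in> alg_hom A A" "\<psi> \<in> extensional (carrier A)"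
      "\<And>i. i \<in> {1..n} \<Longrightarrow> \<psi> (x i) = (if i = s then S c else x i)"
    by (rule ext_hom[of "\<lambda>i. if i = s then S c else x i"]) (use SC in auto)
  interpret \<phi>: algebra_hom A A \<phi> by (intro algebra_homI nonassoc_algebra_axioms \<phi>(1))
  interpret \<psi>: algebra_hom A A \<psi> by (intro algebra_homI nonassoc_algebra_axioms \<psi>(1))
  have \<phi>s: "\<phi> (x s) = x s \<oplus> ads ws (x s)" and \<psi>s: "\<psi> (x s) = S c" using \<phi>(3)[OF s] \<psi>(3)[OF s] by simp_all
  have \<phi>fix: "\<phi> (ads ws z) = ads ws (\<phi> z)" and \<psi>fix: "\<psi> (ads ws z) = ads ws (\<psi> z)" if "z \<in> carrier A" for z
    by (rule commute; use \<phi>.algebra_hom_axioms \<psi>.algebra_hom_axioms \<phi>(3) \<psi>(3) that in simp)+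
  have "\<psi> (\<phi> (x s)) = x s" using xs T by (simp add: \<phi>s \<psi>s \<psi>fix Sc)
  moreover have "\<phi> (S c) = x s"
  proof -
    \<comment> \<open>Both \<open>\<phi> (S c)\<close> and \<open>x s\<close> are sent to
      \<open>\<phi> (x s)\<close> by 1 + T, and 1 + T is injective by the fact
      \<open>zero\<close>.\<close>
    have "\<phi> (S c) \<oplus> ads ws (\<phi> (S c)) = x s \<oplus> ads ws (x s)"
      using \<phi>.hom_add[OF SC[of c] ads_closed[OF wsC SC[of c]]] SC[of c] by (simp add: \<phi>fix Sc \<phi>s)
    moreover have "(\<phi> (S c) \<ominus> x s) \<oplus> ads ws (\<phi> (S c) \<ominus> x s) =
        (\<phi> (S c) \<oplus> ads ws (\<phi> (S c))) \<ominus> (x s \<oplus> ads ws (x s))"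
      using xs SC[of c] T ads_closed[OF wsC \<phi>.hom_closed[OF SC[of c]]]
      by (simp add: a_minus_def ads_add[OF wsC] ads_uminus[OF wsC] M.minus_add M.add.m_ac)
    ultimately have "(\<phi> (S c) \<ominus> x s) \<oplus> ads ws (\<phi> (S c) \<ominus> x s) =
        (x s \<oplus> ads ws (x s)) \<ominus> (x s \<oplus> ads ws (x s))" by simp
    also have "\<dots> = \<zero>" using xs T minus_eq_zero_iff by simp
    finally have "(\<phi> (S c) \<ominus> x s) \<oplus> ads ws (\<phi> (S c) \<ominus> x s) = \<zero>" .
    from zero[OF M.minus_closed[OF \<phi>.hom_closed[OF SC[of c]] xs] this]
    show ?thesis using minus_eq_zero_iff[OF \<phi>.hom_closed[OF SC[of c]] xs] by (rule iffD1[rotated])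
  qed
  ultimately have gens: "\<psi> (\<phi> (x i)) = x i" "\<phi> (\<psi> (x i)) = x i" if "i \<in> {1..n}" for i
    using that by (cases "i = s"; simp add: \<phi>(3) \<psi>(3) \<psi>s)+
  have idH: "algebra_hom A A (\<lambda>y. y)"
    by (intro algebra_homI nonassoc_algebra_axioms) (simp add: alg_hom_def)
  have c1: "algebra_hom A A (\<lambda>y. \<psi> (\<phi> y))" "algebra_hom A A (\<lambda>y. \<phi> (\<psi> y))"
    by (intro algebra_homI nonassoc_algebra_axioms alg_hom_comp[OF \<phi>(1) \<psi>(1)] alg_hom_comp[OF \<psi>(1) \<phi>(1)])+
  have "\<psi> (\<phi> y) = y" "\<phi> (\<psi> y) = y" if "y \<in> carrier A" for y
    by (rule hom_eq_on_gens[OF c1(1) idH gens(1) that]; assumption)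
      (rule hom_eq_on_gens[OF c1(2) idH gens(2) that]; assumption)
  then have "bij_betw \<phi> (carrier A) (carrier A)"
    by (intro bij_betwI[of _ _ _ \<psi>]) auto
  then show ?thesis using that[of \<phi>] \<phi> \<phi>s by (simp add: alg_Aut_carrier)
qed

end

section \<open>Jacobian matrices\<close>

type_synonym 'r mat2 = "'r \<times> 'r \<times> 'r \<times> 'r"
type_synonym 'r vec2 = "'r \<times> 'r"

text \<open>The commutator of the matrices with rows (a, b) and (c, d). With quadruples the Lie
  axioms become ring identities between components.\<close>

fun mat2_bracket :: "'r::comm_ring_1 mat2 \<Rightarrow> 'r mat2 \<Rightarrow> 'r mat2"
  where "mat2_bracket (a, b, c, d) (a', b', c', d') =
    (b * c' - b' * c, a * b' + b * d' - a' * b - b' * d, c * a' + d * c' - c' * a - d' * c, c * b' - c' * b)"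

fun mat2_act :: "'r::comm_ring_1 mat2 \<Rightarrow> 'r vec2 \<Rightarrow> 'r vec2"
  where "mat2_act (a, b, c, d) (p, q) = (a * p + b * q, c * p + d * q)"

text \<open>The bracket of the semidirect product of gl_2 with the plane. The plane is an abelian
  ideal, so the plane part of a Lie element is linear in the plane parts of the generators, as a
  derivative must be.\<close>

fun aff_mult :: "'r::comm_ring_1 mat2 \<times> 'r vec2 \<Rightarrow> 'r mat2 \<times> 'r vec2 \<Rightarrow> 'r mat2 \<times> 'r vec2"
  where "aff_mult (m, z) (m', z') = (mat2_bracket m m', mat2_act m z' - mat2_act m' z)"

fun aff_smult :: "'k::field \<Rightarrow> 'k poly mat2 \<times> 'k poly vec2 \<Rightarrow> 'k poly mat2 \<times> 'k poly vec2"
  where "aff_smult k ((a, b, c, d), (p, q)) =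
    ((Polynomial.smult k a, Polynomial.smult k b, Polynomial.smult k c, Polynomial.smult k d),
     (Polynomial.smult k p, Polynomial.smult k q))"

definition aff :: "('k::field, 'k poly mat2 \<times> 'k poly vec2) module"
  where "aff = \<lparr>carrier = UNIV, monoid.mult = aff_mult, one = 0, ring.zero = 0, add = (+),
    module.smult = aff_smult\<rparr>"

lemma aff_sel [simp]:
  "carrier aff = UNIV" "monoid.mult aff = aff_mult" "ring.zero aff = 0" "add aff = (+)"
  "module.smult aff = aff_smult"
  by (simp_all add: aff_def)

lemma nonassoc_algebra_aff: "nonassoc_algebra (aff :: ('k::field, 'k poly mat2 \<times> 'k poly vec2) module)"
proof -
  have "abelian_group (aff :: ('k, 'k poly mat2 \<times> 'k poly vec2) module)"
  proof (rule abelian_groupI)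
    fix x :: "'k poly mat2 \<times> 'k poly vec2"
    show "\<exists>y\<in>carrier aff. y \<oplus>\<^bsub>aff\<^esub> x = \<zero>\<^bsub>aff\<^esub>"
      by (intro bexI[of _ "- x"]) simp_all
  qed (simp_all add: ac_simps)
  moreover have "module_axioms scalars (aff :: ('k, 'k poly mat2 \<times> 'k poly vec2) module)"
    unfolding module_axioms_def scalars_simps
    by (auto simp: smult_add_left smult_add_right)
  ultimately have "module scalars (aff :: ('k, 'k poly mat2 \<times> 'k poly vec2) module)"
    by (simp add: module_def cring_from_type_algebra)
  moreover have "nonassoc_algebra_axioms (aff :: ('k, 'k poly mat2 \<times> 'k poly vec2) module)"
    unfolding nonassoc_algebra_axioms_def
    by (auto simp: algebra_simps smult_add_left smult_add_right smult_diff_right)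
  ultimately show ?thesis by (simp add: nonassoc_algebra_def)
qed

lemma lie_algebra_aff: "lie_algebra (aff :: ('k::field, 'k poly mat2 \<times> 'k poly vec2) module)"
  unfolding lie_algebra_iff
  by (auto simp: nonassoc_algebra_aff zero_prod_def algebra_simps)

interpretation aff: lie aff
  by (simp add: lie_def lie_axioms_def lie_algebra_aff nonassoc_algebra_aff)

lemma aff_uminus: "\<ominus>\<^bsub>aff\<^esub> v = - v"
  by (rule aff.M.minus_equality) simp_all

abbreviation (input) point :: "(nat \<Rightarrow> 'k::field poly mat2) \<Rightarrow> (nat \<Rightarrow> 'k poly vec2) \<Rightarrow> nat \<Rightarrow> 'k poly mat2 \<times> 'k poly vec2"
  where "point P Z \<equiv> \<lambda>i. (P i, Z i)"

lemma aff_ext_hom: "algebra_hom (free_nonassoc n) aff (free_ext aff b)"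
  by (rule aff.free_ext_algebra_hom) simp

lemma aff_ext_simps:
  assumes "f \<in> carrier (free_nonassoc n)" "g \<in> carrier (free_nonassoc n)"
  shows "free_ext aff b (f \<oplus>\<^bsub>free_nonassoc n\<^esub> g) = free_ext aff b f + free_ext aff b g"
    "free_ext aff b (f \<otimes>\<^bsub>free_nonassoc n\<^esub> g) = aff_mult (free_ext aff b f) (free_ext aff b g)"
proof -
  interpret h: algebra_hom "free_nonassoc n" aff "free_ext aff b" by (rule aff_ext_hom)
  show "free_ext aff b (f \<oplus>\<^bsub>free_nonassoc n\<^esub> g) = free_ext aff b f + free_ext aff b g"
    "free_ext aff b (f \<otimes>\<^bsub>free_nonassoc n\<^esub> g) = aff_mult (free_ext aff b f) (free_ext aff b g)"
    using assms h.hom_add[of f g] h.hom_mult[of f g]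
    by (simp_all del: free_nonassoc_sel)
qed

lemma aff_ext_smult:
  assumes "f \<in> carrier (free_nonassoc n)"
  shows "free_ext aff b (a \<odot>\<^bsub>free_nonassoc n\<^esub> f) = aff_smult a (free_ext aff b f)"
proof -
  interpret h: algebra_hom "free_nonassoc n" aff "free_ext aff b" by (rule aff_ext_hom)
  show ?thesis using assms h.hom_smult[of f a] by (simp del: free_nonassoc_sel)
qed

lemma aff_ext_zero: "free_ext aff b \<zero>\<^bsub>free_nonassoc n\<^esub> = 0"
proof -
  interpret h: algebra_hom "free_nonassoc n" aff "free_ext aff b" by (rule aff_ext_hom)
  show ?thesis using h.hom_zero by (simp del: free_nonassoc_sel)
qed

lemma aff_ext_gen [simp]: "1 \<le> i \<Longrightarrow> free_ext aff b (nonassoc_gen i) = b i"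
  by (rule aff.free_ext_gen[of i]) simp_all

lemma aff_ext_monomial:
  "set_magma w \<subseteq> {1..n::nat} \<Longrightarrow> free_ext aff b (magma_monomial w) = eval_magma aff b w"
  by (rule aff.free_ext_monomial) simp_all

lemma aff_ext_comp:
  assumes p: "\<And>j. j \<in> {1..n} \<Longrightarrow> p j \<in> carrier (free_nonassoc n)" and f: "f \<in> carrier (free_nonassoc n)"
  shows "free_ext aff b (free_ext (free_nonassoc n) p f) = free_ext aff (\<lambda>j. free_ext aff b (p j)) f"
proof -
  interpret ph: algebra_hom "free_nonassoc n" "free_nonassoc n" "free_ext (free_nonassoc n) p"
    by (rule free_nonassoc.free_ext_algebra_hom) (rule p)
  interpret bh: algebra_hom "free_nonassoc n" aff "free_ext aff b" by (rule aff_ext_hom)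
  show ?thesis
  proof (rule free_hom_unique[OF _ aff_ext_hom _ f])
    show "algebra_hom (free_nonassoc n) aff (\<lambda>f. free_ext aff b (free_ext (free_nonassoc n) p f))"
      by (intro algebra_homI nonassoc_algebra_free_nonassoc nonassoc_algebra_aff alg_hom_comp[OF ph.hom bh.hom])
    fix i assume i: "i \<in> {1..n}"
    have "free_ext (free_nonassoc n) p (nonassoc_gen i) = p i"
      by (rule free_nonassoc.free_ext_gen[OF _ i]) (rule p)
    then show "free_ext aff b (free_ext (free_nonassoc n) p (nonassoc_gen i)) =
        free_ext aff (\<lambda>j. free_ext aff b (p j)) (nonassoc_gen i)"
      using i by simp
  qed
qed

lemma free_nonassoc_induct [consumes 1, case_names gen zero add smult mult]:
  assumes f: "f \<in> carrier (free_nonassoc n)"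
    and gen: "\<And>i. i \<in> {1..n} \<Longrightarrow> Q (nonassoc_gen i)"
    and zero: "Q \<zero>\<^bsub>free_nonassoc n\<^esub>"
    and add: "\<And>f g. f \<in> carrier (free_nonassoc n) \<Longrightarrow> g \<in> carrier (free_nonassoc n) \<Longrightarrow> Q f \<Longrightarrow> Q g \<Longrightarrow>
      Q (f \<oplus>\<^bsub>free_nonassoc n\<^esub> g)"
    and smult: "\<And>a f. f \<in> carrier (free_nonassoc n) \<Longrightarrow> Q f \<Longrightarrow> Q (a \<odot>\<^bsub>free_nonassoc n\<^esub> f)"
    and mult: "\<And>f g. f \<in> carrier (free_nonassoc n) \<Longrightarrow> g \<in> carrier (free_nonassoc n) \<Longrightarrow> Q f \<Longrightarrow> Q g \<Longrightarrow>
      Q (f \<otimes>\<^bsub>free_nonassoc n\<^esub> g)"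
  shows "Q f"
proof -
  have "subalgebra_of (free_nonassoc n) {f \<in> carrier (free_nonassoc n). Q f}"
    by (rule free_nonassoc.subalgebraI)
      (use zero add smult mult free_nonassoc.M.zero_closed free_nonassoc.M.a_closed
        free_nonassoc.smult_in free_nonassoc.mult_closed in \<open>simp_all del: free_nonassoc_sel\<close>)
  from subalgebra_generators[OF this] gen f show ?thesis by auto
qed

section \<open>Partial derivatives and the chain rule\<close>

definition vcomp :: "'r vec2 \<Rightarrow> nat \<Rightarrow> 'r"
  where "vcomp z e = (if e = 0 then fst z else snd z)"

text \<open>The index \<open>s\<close> enumerates the 2n coordinates of n plane vectors:
  \<open>s div 2 + 1\<close> is the generator, counted from 1, and \<open>s mod 2\<close> the
  coordinate. The rows of \<open>jacobian\<close> are numbered in the same way.\<close>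

definition basis_vec :: "nat \<Rightarrow> nat \<Rightarrow> 'r::comm_ring_1 vec2"
  where "basis_vec s i = (if s div 2 + 1 = i then (if s mod 2 = 0 then (1, 0) else (0, 1)) else (0, 0))"

text \<open>One entry of the matrix that represents a Fox derivative of \<open>f\<close>: row
  \<open>e\<close>, and the generator and column encoded by \<open>s\<close>.\<close>

definition partial :: "(nat \<Rightarrow> 'k::field poly mat2) \<Rightarrow> (nat magma \<Rightarrow> 'k) \<Rightarrow> nat \<Rightarrow> nat \<Rightarrow> 'k poly"
  where "partial P f e s = vcomp (snd (free_ext aff (point P (basis_vec s)) f)) e"

lemma vcomp_simps [simp]: "vcomp (p, q) 0 = p" "vcomp (p, q) (Suc 0) = q" "vcomp (z + z') e = vcomp z e + vcomp z' e"
    "vcomp (z - z') e = vcomp z e - vcomp z' e" "vcomp 0 e = 0"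
  by (auto simp: vcomp_def)

lemma vcomp_act:
  "vcomp (mat2_act m z) e = (if e = 0 then fst m else fst (snd (snd m))) * vcomp z 0 +
    (if e = 0 then fst (snd m) else snd (snd (snd m))) * vcomp z (Suc 0)"
  by (cases m; cases z) (auto simp: vcomp_def)

lemma vcomp_aff_smult: "vcomp (snd (aff_smult k v)) e = Polynomial.smult k (vcomp (snd v) e)"
  by (cases v) (auto simp: vcomp_def)

lemma fst_aff_smult: "fst v = fst v' \<Longrightarrow> fst (aff_smult k v) = fst (aff_smult k v')"
  by (cases v; cases v') auto

lemma snd_aff_mult: "snd (aff_mult v w) = mat2_act (fst v) (snd w) - mat2_act (fst w) (snd v)"
  by (cases v; cases w) auto

lemma fst_aff_mult: "fst (aff_mult v w) = mat2_bracket (fst v) (fst w)"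
  by (cases v; cases w) auto

text \<open>The plane is an ideal of the affine algebra, so passing to matrix parts is a
  homomorphism by itself.\<close>

lemma fst_ext_indep:
  assumes "f \<in> carrier (free_nonassoc n)"
  shows "fst (free_ext aff (point P Z) f) = fst (free_ext aff (point P Z') f)"
  using assms
proof (induction rule: free_nonassoc_induct)
  case (smult a f)
  then show ?case by (simp add: aff_ext_smult fst_aff_smult[OF smult(2)] del: free_nonassoc_sel)
qed (simp_all add: aff_ext_simps aff_ext_zero fst_aff_mult del: free_nonassoc_sel)

lemma poly_smult_sum: "Polynomial.smult k (sum f A) = (\<Sum>x\<in>A. Polynomial.smult k (f x))"
  by (induction A rule: infinite_finite_induct) (simp_all add: smult_add_right)

text \<open>A bracket acts on plane parts through matrix parts, and these do not depend on the
  tangent. The derivative along \<open>Z\<close> is thereby expanded in partial derivatives.\<close>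

lemma ext_linear:
  assumes "f \<in> carrier (free_nonassoc n)"
  shows "vcomp (snd (free_ext aff (point P Z) f)) e =
    (\<Sum>s<2*n. vcomp (Z (s div 2 + 1)) (s mod 2) * partial P f e s)"
proof -
  have "\<forall>e. vcomp (snd (free_ext aff (point P Z) f)) e =
      (\<Sum>s<2*n. vcomp (Z (s div 2 + 1)) (s mod 2) * partial P f e s)"
    using assms
  proof (induction rule: free_nonassoc_induct)
    case (gen i)
    show ?case
    proof
      fix e :: nat
      define e' where "e' = (if e = 0 then 0 else 1::nat)"
      have ve: "vcomp z e = vcomp z e'" for z :: "'a poly vec2" by (simp add: vcomp_def e'_def)
      have "(\<Sum>s<2*n. vcomp (Z (s div 2 + 1)) (s mod 2) * partial P (nonassoc_gen i) e s) =
          (\<Sum>s<2*n. if s = 2 * (i - 1) + e' then vcomp (Z i) e' else 0)"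
      proof (rule sum.cong[OF refl])
        fix s
        have "partial P (nonassoc_gen i) e s = vcomp (basis_vec s i) e'"
          using gen by (simp add: partial_def ve)
        also have "\<dots> = (if s = 2 * (i - 1) + e' then 1 else 0)"
        proof -
          have "s div 2 + 1 = i \<and> s mod 2 = e' \<longleftrightarrow> s = 2 * (i - 1) + e'"
          proof -
            have "e' < 2" "1 \<le> i" using gen by (simp_all add: e'_def)
            then show ?thesis by presburger
          qed
          then show ?thesis by (auto simp: basis_vec_def vcomp_def e'_def)
        qed
        finally show "vcomp (Z (s div 2 + 1)) (s mod 2) * partial P (nonassoc_gen i) e s =
            (if s = 2 * (i - 1) + e' then vcomp (Z i) e' else 0)"
          using gen by (auto simp: e'_def)
      qed
      also have "\<dots> = vcomp (Z i) e'"
        using gen by (subst sum.delta) (auto simp: e'_def)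
      finally show "vcomp (snd (free_ext aff (point P Z) (nonassoc_gen i))) e =
          (\<Sum>s<2*n. vcomp (Z (s div 2 + 1)) (s mod 2) * partial P (nonassoc_gen i) e s)"
        using gen by (simp add: ve)
    qed
  next
    case zero
    then show ?case using free_nonassoc.M.zero_closed[of n]
      by (simp add: partial_def aff_ext_zero del: free_nonassoc_sel)
  next
    case (add f g)
    then show ?case
      by (simp add: partial_def aff_ext_simps sum.distrib algebra_simps del: free_nonassoc_sel)
  next
    case (smult a f)
    then show ?case
      by (simp add: partial_def aff_ext_smult vcomp_aff_smult poly_smult_sum del: free_nonassoc_sel)
  next
    case (mult f g)
    have mf: "fst (free_ext aff (point P (basis_vec s)) f) = fst (free_ext aff (point P Z) f)" for s
      by (rule fst_ext_indep[OF mult(1)])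
    have mg: "fst (free_ext aff (point P (basis_vec s)) g) = fst (free_ext aff (point P Z) g)" for s
      by (rule fst_ext_indep[OF mult(2)])
    show ?case
      using mult unfolding partial_def
      by (simp add: aff_ext_simps snd_aff_mult vcomp_act mf mg sum_subtractf sum.distrib sum_distrib_left
          algebra_simps del: free_nonassoc_sel)
  qed
  then show ?thesis by simp
qed

definition jacobian :: "nat \<Rightarrow> (nat \<Rightarrow> 'k::field poly mat2) \<Rightarrow> (nat \<Rightarrow> nat magma \<Rightarrow> 'k) \<Rightarrow> 'k poly mat"
  where "jacobian n P p = mat (2*n) (2*n) (\<lambda>(r, s). partial P (p (r div 2 + 1)) (r mod 2) s)"

lemma jacobian_carrier [simp]: "jacobian n P p \<in> carrier_mat (2*n) (2*n)"
  by (simp add: jacobian_def)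

lemma row_index: "r < 2 * n \<Longrightarrow> r div 2 + 1 \<in> {1..n::nat}"
  by auto

text \<open>Substituting \<open>p\<close> and evaluating at \<open>P\<close> is the same as
  evaluating \<open>e\<close> at the matrix parts of \<open>p\<close>, along the tangent formed by
  the plane parts of \<open>p\<close>; \<open>ext_linear\<close> expands that tangent.\<close>

lemma jacobian_chain:
  assumes p: "\<And>j. j \<in> {1..n} \<Longrightarrow> p j \<in> carrier (free_nonassoc n)"
    and e: "\<And>j. j \<in> {1..n} \<Longrightarrow> e j \<in> carrier (free_nonassoc n)"
  shows "jacobian n P (\<lambda>j. free_ext (free_nonassoc n) p (e j)) =
    jacobian n (\<lambda>j. fst (free_ext aff (point P (\<lambda>_. 0)) (p j))) e * jacobian n P p"
    (is "?L = jacobian n ?P' e * _")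
proof (rule eq_matI)
  fix r s assume "r < dim_row (jacobian n ?P' e * jacobian n P p)" "s < dim_col (jacobian n ?P' e * jacobian n P p)"
  then have rs: "r < 2*n" "s < 2*n" by (simp_all add: jacobian_def)
  let ?f = "e (r div 2 + 1)" and ?b = "point P (basis_vec s)"
  have f: "?f \<in> carrier (free_nonassoc n)" by (rule e[OF row_index[OF rs(1)]])
  have comp: "free_ext aff ?b (free_ext (free_nonassoc n) p ?f) = free_ext aff (\<lambda>j. free_ext aff ?b (p j)) ?f"
    by (rule aff_ext_comp[OF p f])
  have eqb: "free_ext aff (\<lambda>j. free_ext aff ?b (p j)) ?f =
      free_ext aff (point ?P' (\<lambda>j. snd (free_ext aff ?b (p j)))) ?f"
  proof (rule free_hom_unique[OF aff_ext_hom aff_ext_hom _ f])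
    fix i assume i: "i \<in> {1..n}"
    show "free_ext aff (\<lambda>j. free_ext aff ?b (p j)) (nonassoc_gen i) =
        free_ext aff (point ?P' (\<lambda>j. snd (free_ext aff ?b (p j)))) (nonassoc_gen i)"
      using i fst_ext_indep[OF p[OF i], of P "\<lambda>_. 0" "basis_vec s"] by simp
  qed
  have "?L $$ (r, s) = partial P (free_ext (free_nonassoc n) p ?f) (r mod 2) s"
    using rs by (simp add: jacobian_def)
  also have "\<dots> = (\<Sum>s'<2*n. vcomp (snd (free_ext aff ?b (p (s' div 2 + 1)))) (s' mod 2) * partial ?P' ?f (r mod 2) s')"
    unfolding partial_def[of P] comp eqb by (rule ext_linear[OF f])
  also have "\<dots> = (\<Sum>s'<2*n. jacobian n ?P' e $$ (r, s') * jacobian n P p $$ (s', s))"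
    using rs by (intro sum.cong) (simp_all add: jacobian_def partial_def[of P] mult.commute)
  also have "\<dots> = (jacobian n ?P' e * jacobian n P p) $$ (r, s)"
    using rs by (simp add: scalar_prod_def jacobian_def atLeast0LessThan)
  finally show "?L $$ (r, s) = (jacobian n ?P' e * jacobian n P p) $$ (r, s)" .
qed (simp_all add: jacobian_def)

lemma partial_gen:
  "partial P (nonassoc_gen (r div 2 + 1)) (r mod 2) s = (if r = s then 1 else 0)"
proof -
  have "s div 2 + 1 = r div 2 + 1 \<and> s mod 2 = r mod 2 \<longleftrightarrow> r = s"
    by (metis add_right_imp_eq div_mult_mod_eq)
  then show ?thesis by (auto simp: partial_def basis_vec_def vcomp_def)
qed

lemma partial_add: "f \<in> carrier (free_nonassoc n) \<Longrightarrow> g \<in> carrier (free_nonassoc n) \<Longrightarrow>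
    partial P (f \<oplus>\<^bsub>free_nonassoc n\<^esub> g) e s = partial P f e s + partial P g e s"
  by (simp add: partial_def aff_ext_simps del: free_nonassoc_sel)

lemma partial_smult: "f \<in> carrier (free_nonassoc n) \<Longrightarrow>
    partial P (a \<odot>\<^bsub>free_nonassoc n\<^esub> f) e s = Polynomial.smult a (partial P f e s)"
  by (simp add: partial_def aff_ext_smult vcomp_aff_smult del: free_nonassoc_sel)

section \<open>Jacobian determinants of elementary automorphisms\<close>

lemma subalgebra_snd_zero:
  "subalgebra_of (free_nonassoc n) {f \<in> carrier (free_nonassoc n). snd (free_ext aff b f) = 0}"
proof -
  have [simp]: "snd (aff_smult a v) = 0" if "snd v = 0" for a and v :: "'a poly mat2 \<times> 'a poly vec2"
    using that by (cases v) (auto simp: zero_prod_def)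
  have [simp]: "mat2_act m 0 = 0" for m :: "'a poly mat2"
    by (cases m) (auto simp: zero_prod_def)
  show ?thesis
    by (rule free_nonassoc.subalgebraI)
      (use free_nonassoc.M.zero_closed[of n] free_nonassoc.M.a_closed[of _ n]
        free_nonassoc.smult_in[of _ n] free_nonassoc.mult_closed[of _ n]
        in \<open>simp_all add: aff_ext_simps aff_ext_smult aff_ext_zero snd_aff_mult del: free_nonassoc_sel\<close>)
qed

text \<open>Plane parts arise only from plane parts. So an \<open>f\<close> that avoids x_i has zero
  derivatives with respect to x_i.\<close>

lemma ext_snd_zero:
  assumes f: "f \<in> subalgebra_of (free_nonassoc n) hull (nonassoc_gen ` ({1..n} - {i}))"
    and b: "\<And>j. j \<in> {1..n} - {i} \<Longrightarrow> snd (b j) = 0"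
  shows "snd (free_ext aff b f) = 0"
proof -
  have "subalgebra_of (free_nonassoc n) hull (nonassoc_gen ` ({1..n} - {i})) \<subseteq>
      {f \<in> carrier (free_nonassoc n). snd (free_ext aff b f) = 0}"
    by (rule hull_minimal) (auto simp: b subalgebra_snd_zero)
  with f show ?thesis by blast
qed

text \<open>After a reordering the matrix would be block triangular with diagonal blocks. Instead,
  the permutations in the Leibniz formula are examined: a contributing one fixes every index outside
  \<open>S\<close>, and an index in \<open>S\<close> that moves would have to land on such a fixed
  point, against injectivity.\<close>

lemma det_triangular_rows:
  fixes M :: "'r::idom mat"
  assumes M: "M \<in> carrier_mat N N"
    and out: "\<And>r s. r < N \<Longrightarrow> s < N \<Longrightarrow> r \<notin> S \<Longrightarrow> r \<noteq> s \<Longrightarrow> M $$ (r, s) = 0"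
    and ins: "\<And>r s. r < N \<Longrightarrow> s < N \<Longrightarrow> r \<in> S \<Longrightarrow> s \<in> S \<Longrightarrow> r \<noteq> s \<Longrightarrow> M $$ (r, s) = 0"
  shows "det M = (\<Prod>r = 0..<N. M $$ (r, r))"
proof -
  have zero: "(\<Prod>r = 0..<N. M $$ (r, p r)) = 0" if p: "p permutes {0..<N}" "p \<noteq> id" for p
  proof (rule ccontr)
    assume "(\<Prod>r = 0..<N. M $$ (r, p r)) \<noteq> 0"
    then have nz: "M $$ (r, p r) \<noteq> 0" if "r < N" for r using that by simp
    have lt: "p r < N" if "r < N" for r using permutes_in_image[OF p(1), of r] that by simp
    have fixed: "p r = r" if r: "r < N" for r
    proof (cases "r \<in> S \<and> p r \<notin> S")
      case True
      then have "p (p r) = p r" using out[of "p r" "p (p r)"] nz[of "p r"] lt r by metis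
      then have "p r = r" using permutes_inj[OF p(1)] by (meson injD)
      then show ?thesis .
    next
      case False
      then show ?thesis using out[of r "p r"] ins[of r "p r"] nz[OF r] lt[OF r] r by metis
    qed
    have "p = id"
    proof
      show "p r = id r" for r using fixed permutes_not_in[OF p(1), of r] by (cases "r < N") auto
    qed
    with p(2) show False by simp
  qed
  have "det M = (\<Sum>p\<in>{p. p permutes {0..<N}}. signof p * (\<Prod>r = 0..<N. M $$ (r, p r)))"
    by (rule det_def'[OF M])
  also have "\<dots> = (\<Sum>p\<in>{id}. signof p * (\<Prod>r = 0..<N. M $$ (r, p r)))"
    by (rule sum.mono_neutral_right)
      (use zero permutes_id in \<open>auto simp: finite_permutations\<close>)
  finally show ?thesis by simp
qed

lemma prod_const_poly: "(\<Prod>r\<in>A. [:c r:]) = [:\<Prod>r\<in>A. c r:]"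
  by (induction A rule: infinite_finite_induct) (simp_all add: one_pCons ac_simps)

lemma jacobian_cong: "(\<And>j. j \<in> {1..n} \<Longrightarrow> p j = q j) \<Longrightarrow> jacobian n P p = jacobian n P q"
  by (rule eq_matI) (use row_index[of _ n] in \<open>auto simp: jacobian_def\<close>)

lemma jacobian_gen: "jacobian n P nonassoc_gen = 1\<^sub>m (2 * n)"
proof (rule eq_matI)
  fix r s assume "r < dim_row (1\<^sub>m (2 * n) :: 'a poly mat)" "s < dim_col (1\<^sub>m (2 * n) :: 'a poly mat)"
  then show "jacobian n P nonassoc_gen $$ (r, s) = 1\<^sub>m (2 * n) $$ (r, s)"
    using partial_gen[of P r s] by (simp add: jacobian_def)
qed (simp_all add: jacobian_def)

context relatively_free begin

text \<open>The derivatives of \<open>f\<close> occur only in the rows of x_i and outside the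
  columns of x_i, so they do not reach the determinant. The constant is chosen before
  \<open>P\<close> because the chain rule evaluates the elementary factor at a different
  point.\<close>

lemma jacobian_elementary_det:
  assumes i: "i \<in> {1..n}" and f: "f \<in> carrier F" "f \<in> subalgebra_of F hull (nonassoc_gen ` ({1..n} - {i}))"
  shows "\<exists>\<gamma>. \<forall>P. det (jacobian n P (\<lambda>j. if j = i then (\<alpha> \<odot>\<^bsub>F\<^esub> nonassoc_gen i) \<oplus>\<^bsub>F\<^esub> f else nonassoc_gen j)) = [:\<gamma>:]"
proof -
  let ?e = "\<lambda>j. if j = i then (\<alpha> \<odot>\<^bsub>F\<^esub> nonassoc_gen i) \<oplus>\<^bsub>F\<^esub> f else nonassoc_gen j"
  define S where "S = {r :: nat. r div 2 + 1 = i}"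
  define c where "c r = (if r \<in> S then \<alpha> else 1)" for r
  have g: "nonassoc_gen i \<in> carrier F" by (rule nonassoc_gen_carrier[OF i])
  have fz: "partial P f e s = 0" if "s \<in> S" for P e s
    unfolding partial_def using ext_snd_zero[OF f(2), of "point P (basis_vec s)"] that
    by (simp add: S_def basis_vec_def zero_prod_def vcomp_def)
  have ent_in: "partial P (?e (r div 2 + 1)) (r mod 2) s = (if r = s then [:\<alpha>:] else 0)"
    if "r \<in> S" "s \<in> S" for P r s
  proof -
    have "r div 2 + 1 = i" using that by (simp add: S_def)
    then have "partial P (nonassoc_gen i) (r mod 2) s = (if r = s then 1 else 0)"
      using partial_gen[of P r s] by simp
    then show ?thesis using \<open>r div 2 + 1 = i\<close> fz[OF that(2)]
      by (simp add: partial_add[OF free_nonassoc.smult_in[OF g] f(1)] partial_smult[OF g] one_pCons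
          del: free_nonassoc_sel)
  qed
  have ent_out: "partial P (?e (r div 2 + 1)) (r mod 2) s = (if r = s then 1 else 0)" if "r \<notin> S" for P r s
    using that partial_gen[of P r s] by (simp add: S_def)
  have "det (jacobian n P ?e) = [:\<Prod>r = 0..<2*n. c r:]" for P
  proof -
    have "det (jacobian n P ?e) = (\<Prod>r = 0..<2*n. jacobian n P ?e $$ (r, r))"
      by (rule det_triangular_rows[OF jacobian_carrier, where S = S])
        (simp_all add: jacobian_def ent_in ent_out del: One_nat_def add_Suc_right add_0_right free_nonassoc_sel)
    also have "\<dots> = (\<Prod>r = 0..<2*n. [:c r:])"
    proof (rule prod.cong[OF refl])
      fix r assume "r \<in> {0..<2*n}"
      then have "jacobian n P ?e $$ (r, r) = partial P (?e (r div 2 + 1)) (r mod 2) r"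
        by (simp add: jacobian_def)
      also have "\<dots> = [:c r:]"
        using ent_in[of r r P] ent_out[of r P r]
        by (cases "r \<in> S") (simp_all only: c_def refl if_True if_False one_pCons not_False_eq_True)
      finally show "jacobian n P ?e $$ (r, r) = [:c r:]" .
    qed
    finally show ?thesis by (simp add: prod_const_poly)
  qed
  then show ?thesis by blast
qed

text \<open>The new tuple arises from an elementary one by substituting \<open>p\<close>, so its
  determinant is the old constant times the elementary one taken at the shifted point, where it has
  the same value.\<close>

lemma constant_jacobian_step:
  assumes \<Phi>: "\<exists>\<gamma>. \<forall>P. det (jacobian n P p) = [:\<gamma>:]"
    and p: "\<And>j. j \<in> {1..n} \<Longrightarrow> p j \<in> carrier F" and i: "i \<in> {1..n}"
    and f: "f \<in> carrier F" "f \<in> subalgebra_of F hull (nonassoc_gen ` ({1..n} - {i}))"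
  shows "\<exists>\<gamma>. \<forall>P. det (jacobian n P (elementary_tuple p i \<alpha> f)) = [:\<gamma>:]"
proof -
  let ?e = "\<lambda>j. if j = i then (\<alpha> \<odot>\<^bsub>F\<^esub> nonassoc_gen i) \<oplus>\<^bsub>F\<^esub> f else nonassoc_gen j"
  have g: "nonassoc_gen i \<in> carrier F" by (rule nonassoc_gen_carrier[OF i])
  interpret ph: algebra_hom F F "free_ext F p" by (rule free_nonassoc.free_ext_algebra_hom) (rule p)
  have pg: "free_ext F p (nonassoc_gen j) = p j" if "j \<in> {1..n}" for j
    by (rule free_nonassoc.free_ext_gen[OF _ that]) (rule p)
  have e: "?e j \<in> carrier F" if "j \<in> {1..n}" for j
    using free_nonassoc.M.a_closed[OF free_nonassoc.smult_in[OF g] f(1)] nonassoc_gen_carrier[OF that] by metis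
  have eq: "elementary_tuple p i \<alpha> f j = free_ext F p (?e j)" if "j \<in> {1..n}" for j
  proof (cases "j = i")
    case True
    then show ?thesis
      using ph.hom_add[OF free_nonassoc.smult_in[OF g] f(1)] ph.hom_smult[OF g] pg[OF i]
      by (simp add: elementary_tuple_def del: free_nonassoc_sel)
  next
    case False
    then show ?thesis using pg[OF that] by (simp add: elementary_tuple_def)
  qed
  obtain \<gamma> where \<gamma>: "\<And>P. det (jacobian n P p) = [:\<gamma>:]" using \<Phi> by blast
  obtain \<delta> where \<delta>: "\<And>P. det (jacobian n P ?e) = [:\<delta>:]" using jacobian_elementary_det[OF i f] by blast
  have "det (jacobian n P (elementary_tuple p i \<alpha> f)) = [:\<delta> * \<gamma>:]" for P
  proof -
    have "jacobian n P (elementary_tuple p i \<alpha> f) = jacobian n P (\<lambda>j. free_ext F p (?e j))"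
      by (rule jacobian_cong) (rule eq)
    also have "\<dots> = jacobian n (\<lambda>j. fst (free_ext aff (point P (\<lambda>_. 0)) (p j))) ?e * jacobian n P p"
      by (rule jacobian_chain) (rule p e; assumption)+
    finally show ?thesis by (simp add: det_mult[OF jacobian_carrier jacobian_carrier] \<gamma> \<delta>)
  qed
  then show ?thesis by blast
qed

end

section \<open>Determinants modulo powers of t\<close>

lemma coeff_eq_zero_if_monom_dvd:
  "Polynomial.monom 1 k dvd (q :: 'k::field poly) \<Longrightarrow> d < k \<Longrightarrow> Polynomial.coeff q d = 0"
  by (auto elim!: dvdE simp: coeff_monom_mult)

text \<open>Cross terms contain t^(2d), and 2d \<ge> d + 1.\<close>

lemma coeff_prod_near_one:
  fixes q :: "'r \<Rightarrow> 'k::field poly"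
  assumes "finite A" "d \<ge> 1"
    and "\<And>r. r \<in> A \<Longrightarrow> Polynomial.monom 1 (d + 1) dvd q r - (1 + Polynomial.monom (\<nu> r) d)"
  shows "Polynomial.monom 1 (d + 1) dvd (\<Prod>r\<in>A. q r) - (1 + Polynomial.monom (\<Sum>r\<in>A. \<nu> r) d)"
  using assms(1,3)
proof (induction A rule: finite_induct)
  case (insert a A)
  let ?T = "Polynomial.monom (1::'k) (d + 1)"
  let ?p = "\<Prod>r\<in>A. q r" and ?s = "\<Sum>r\<in>A. \<nu> r"
  have 1: "?T dvd q a - (1 + Polynomial.monom (\<nu> a) d)" and 2: "?T dvd ?p - (1 + Polynomial.monom ?s d)"
    using insert by auto
  have 3: "?T dvd Polynomial.monom (\<nu> a) d * Polynomial.monom ?s d"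
    using assms(2) by (simp add: mult_monom monom_1_dvd_iff')
  have "q a * ?p - (1 + Polynomial.monom (\<nu> a + ?s) d) =
      (q a - (1 + Polynomial.monom (\<nu> a) d)) * ?p + (1 + Polynomial.monom (\<nu> a) d) * (?p - (1 + Polynomial.monom ?s d))
      + Polynomial.monom (\<nu> a) d * Polynomial.monom ?s d"
    by (simp add: algebra_simps flip: add_monom)
  also have "?T dvd \<dots>" by (rule dvd_add[OF dvd_add[OF dvd_mult2[OF 1] dvd_mult[OF 2]] 3])
  finally show ?case using insert by simp
qed simp

text \<open>To first order a determinant near the identity is 1 plus the trace of the deviation: a
  permutation other than the identity moves both some r and its image, so its product contains two
  entries off the diagonal and is divisible by t^(2d).\<close>

lemma coeff_det_near_identity:
  fixes M :: "'k::field poly mat"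
  assumes M: "M \<in> carrier_mat N N" and d: "d \<ge> 1"
    and off: "\<And>r s. r < N \<Longrightarrow> s < N \<Longrightarrow> r \<noteq> s \<Longrightarrow> Polynomial.monom 1 d dvd M $$ (r, s)"
    and diag: "\<And>r. r < N \<Longrightarrow> Polynomial.monom 1 (d + 1) dvd M $$ (r, r) - (1 + Polynomial.monom (\<nu> r) d)"
  shows "Polynomial.coeff (det M) d = (\<Sum>r<N. \<nu> r)"
proof -
  have zero: "Polynomial.coeff (signof p * (\<Prod>r = 0..<N. M $$ (r, p r))) d = 0"
    if p: "p permutes {0..<N}" "p \<noteq> id" for p
  proof -
    obtain r where r: "p r \<noteq> r" using p(2) by (auto simp: fun_eq_iff)
    then have rN: "r < N" using permutes_not_in[OF p(1), of r] by auto
    have prN: "p r < N" using permutes_in_image[OF p(1), of r] rN by simp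
    have r': "p (p r) \<noteq> p r" using r permutes_inj[OF p(1)] by (meson injD)
    have pprN: "p (p r) < N" using permutes_in_image[OF p(1), of "p r"] prN by simp
    have "(\<Prod>r = 0..<N. M $$ (r, p r)) = M $$ (r, p r) * (M $$ (p r, p (p r)) * (\<Prod>r \<in> {0..<N} - {r} - {p r}. M $$ (r, p r)))"
      using rN prN r by (simp add: prod.remove[of "{0..<N}" r] prod.remove[of "{0..<N} - {r}" "p r"])
    moreover have "Polynomial.monom 1 d * (Polynomial.monom 1 d * 1) dvd
        M $$ (r, p r) * (M $$ (p r, p (p r)) * (\<Prod>r \<in> {0..<N} - {r} - {p r}. M $$ (r, p r)))"
      by (intro mult_dvd_mono off) (use r r' rN prN pprN in auto)
    ultimately have "Polynomial.monom 1 (d + d) dvd signof p * (\<Prod>r = 0..<N. M $$ (r, p r))"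
      by (simp add: mult_monom dvd_mult)
    then show ?thesis by (rule coeff_eq_zero_if_monom_dvd) (use d in simp)
  qed
  have "Polynomial.coeff (det M) d =
      (\<Sum>p\<in>{p. p permutes {0..<N}}. Polynomial.coeff (signof p * (\<Prod>r = 0..<N. M $$ (r, p r))) d)"
    by (simp add: det_def'[OF M] coeff_sum)
  also have "\<dots> = (\<Sum>p\<in>{id}. Polynomial.coeff (signof p * (\<Prod>r = 0..<N. M $$ (r, p r))) d)"
    by (rule sum.mono_neutral_right)
      (use zero permutes_id in \<open>auto simp: finite_permutations\<close>)
  also have "\<dots> = Polynomial.coeff (\<Prod>r = 0..<N. M $$ (r, r)) d" by simp
  also have "\<dots> = Polynomial.coeff (1 + Polynomial.monom (\<Sum>r = 0..<N. \<nu> r) d) d"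
  proof -
    have "Polynomial.monom 1 (d + 1) dvd (\<Prod>r = 0..<N. M $$ (r, r)) - (1 + Polynomial.monom (\<Sum>r = 0..<N. \<nu> r) d)"
      by (rule coeff_prod_near_one) (use d diag in auto)
    from coeff_eq_zero_if_monom_dvd[OF this, of d] show ?thesis by simp
  qed
  also have "\<dots> = (\<Sum>r<N. \<nu> r)" using d by (simp add: atLeast0LessThan)
  finally show ?thesis .
qed

text \<open>Matrix parts have order at least a in t and plane parts at least a - 1; the extra factor
  t avoids a truncated difference at \<open>a = 0\<close>. The shift puts the constant tangents
  \<open>basis_vec\<close> into degree 1, together with matrices divisible by t, and it is the
  reason why derivatives lose one degree.\<close>

definition aff_filtration :: "nat \<Rightarrow> ('k::field poly mat2 \<times> 'k poly vec2) set"
  where "aff_filtration a = {((m1, m2, m3, m4), (z1, z2)).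
    (\<forall>m\<in>{m1, m2, m3, m4}. Polynomial.monom 1 a dvd m) \<and>
    (\<forall>z\<in>{z1, z2}. Polynomial.monom 1 a dvd Polynomial.monom 1 1 * z)}"

lemma submodule_aff_filtration: "submodule (aff_filtration a) scalars aff"
  unfolding aff.submodule_iff
  by (auto simp: aff_filtration_def zero_prod_def dvd_smult distrib_left)

lemma aff_filtration_bracket:
  assumes "v \<in> aff_filtration a" "w \<in> aff_filtration b"
  shows "aff_mult v w \<in> aff_filtration (a + b)"
proof -
  have mul: "Polynomial.monom 1 (a + b) = Polynomial.monom (1::'a) a * Polynomial.monom 1 b"
    by (simp add: mult_monom)
  have *: "Polynomial.monom 1 (a + b) dvd x * y" "Polynomial.monom 1 (a + b) dvd y * x"
    if "Polynomial.monom 1 a dvd x" "Polynomial.monom 1 b dvd y" for x y :: "'a poly"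
    using mult_dvd_mono[OF that] by (simp_all add: mul mult.commute)
  have **: "Polynomial.monom 1 (a + b) dvd Polynomial.monom 1 (Suc 0) * (x * y)"
    if "Polynomial.monom 1 a dvd x" "Polynomial.monom 1 b dvd Polynomial.monom 1 (Suc 0) * y" for x y :: "'a poly"
    using *(1)[OF that] by (simp add: ac_simps)
  have ***: "Polynomial.monom 1 (a + b) dvd Polynomial.monom 1 (Suc 0) * (x * y)"
    if "Polynomial.monom 1 b dvd x" "Polynomial.monom 1 a dvd Polynomial.monom 1 (Suc 0) * y" for x y :: "'a poly"
    using *(2)[OF that(2,1)] by (simp add: ac_simps)
  obtain a1 a2 a3 a4 p1 p2 b1 b2 b3 b4 q1 q2 where vw: "v = ((a1, a2, a3, a4), (p1, p2))" "w = ((b1, b2, b3, b4), (q1, q2))"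
    by (metis prod.collapse)
  show ?thesis using assms unfolding vw
    by (auto simp: aff_filtration_def ring_distribs * ** *** intro!: dvd_add dvd_diff)
qed

lemma aff_filtration_antimono: "a \<le> b \<Longrightarrow> aff_filtration b \<subseteq> aff_filtration a"
proof -
  assume "a \<le> b"
  then have "Polynomial.monom (1::'a) a dvd Polynomial.monom 1 b" by (simp add: monom_1_dvd_iff')
  then show ?thesis by (auto simp: aff_filtration_def intro: dvd_trans)
qed

lemma eval_aff_filtration:
  assumes "\<And>i. b i \<in> aff_filtration 1"
  shows "eval_magma aff b w \<in> aff_filtration (magma_degree w)"
  by (induction w) (simp_all add: assms[simplified] aff_filtration_bracket)

lemma ext_aff_filtration:
  assumes "\<And>i. b i \<in> aff_filtration 1" and "f \<in> carrier (free_nonassoc n)"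
    and "\<And>w. f w \<noteq> 0 \<Longrightarrow> m \<le> magma_degree w"
  shows "free_ext aff b f \<in> aff_filtration m"
proof -
  interpret h: algebra_hom "free_nonassoc n" aff "free_ext aff b" by (rule aff_ext_hom)
  have "f \<in> {f \<in> carrier (free_nonassoc n). free_ext aff b f \<in> aff_filtration m}"
  proof (rule submodule_monomials[OF h.submodule_preimage[OF submodule_aff_filtration] assms(2)])
    fix w assume "f w \<noteq> 0"
    then have w: "set_magma w \<subseteq> {1..n}" "m \<le> magma_degree w"
      using assms(2,3) by (auto simp: in_carrier_free_nonassoc)
    then show "magma_monomial w \<in> {f \<in> carrier (free_nonassoc n). free_ext aff b f \<in> aff_filtration m}"
      using eval_aff_filtration[where w = w, OF assms(1)] aff_filtration_antimono[OF w(2)] magma_monomial_carrier[OF w(1)]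
      by (auto simp: aff_ext_monomial[OF w(1)])
  qed
  then show ?thesis by simp
qed

lemma magma_degree_pos: "1 \<le> magma_degree w"
  by (induction w) auto

text \<open>At a point of filtration degree 1 every word has degree at least 1, so the series that
  receives the relations may be started at \<open>aff_filtration 1\<close>.\<close>

lemma ext_relations_filtration:
  assumes b: "\<And>i. b i \<in> aff_filtration 1" and s: "s \<in> polynilpotent_relations cs n"
  shows "free_ext aff b s \<in> aff_filtration (prod_list (map Suc cs))"
proof -
  have "free_ext aff b s \<in> polynilpotent_series aff (aff_filtration 1) cs"
    by (rule hom_polynilpotent_relations[OF lie_algebra_aff aff_ext_hom submodule_aff_filtration _ s])
      (use ext_aff_filtration[OF b _ magma_degree_pos] in auto)
  also have "polynilpotent_series aff (aff_filtration 1) cs \<subseteq> aff_filtration (prod_list (map Suc cs))"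
    by (rule aff.polynilpotent_series_filtration[OF submodule_aff_filtration _ submodule_aff_filtration])
      (simp_all add: aff_filtration_bracket)
  finally show ?thesis .
qed

section \<open>Polynilpotent words\<close>

text \<open>Words whose bracket structure alone puts them into the m-th power of an ideal containing
  the words in \<open>Q\<close>. The rule \<open>ideal\<close> holds because powers of ideals are
  ideals; it permits one further letter that turns the matrix into another direction.\<close>

inductive power_word :: "('x magma \<Rightarrow> bool) \<Rightarrow> nat \<Rightarrow> 'x magma \<Rightarrow> bool" for Q
  where
    base: "Q w \<Longrightarrow> power_word Q 1 w"
  | bracket: "power_word Q m w \<Longrightarrow> Q v \<Longrightarrow> power_word Q (Suc m) (Br w v)"
  | ideal: "power_word Q m w \<Longrightarrow> power_word Q m (Br w v)"

definition poly_word :: "nat list \<Rightarrow> 'x magma \<Rightarrow> bool"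
  where "poly_word cs = foldl (\<lambda>Q c. power_word Q (Suc c)) (\<lambda>_. True) cs"

lemma poly_word_simps [simp]:
  "poly_word [] w" "poly_word (cs @ [c]) = power_word (poly_word cs) (Suc c)"
  by (simp_all add: poly_word_def)

lemma poly_word_Br: "poly_word cs w \<Longrightarrow> poly_word cs (Br w v)"
  by (cases cs rule: rev_cases) (auto intro: power_word.ideal)

lemma (in lie) power_word_sound:
  assumes b: "\<And>i. i \<in> {1..n::nat} \<Longrightarrow> b i \<in> carrier A" and H: "ideal_of A H"
    and Q: "\<And>w. Q w \<Longrightarrow> set_magma w \<subseteq> {1..n} \<Longrightarrow> eval_magma A b w \<in> H"
  shows "power_word Q m w \<Longrightarrow> set_magma w \<subseteq> {1..n} \<Longrightarrow> m \<ge> 1 \<and> eval_magma A b w \<in> lie_power A H m"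
proof (induction rule: power_word.induct)
  case (base w)
  then show ?case using Q by simp
next
  case (bracket m w v)
  then have "eval_magma A b w \<otimes> eval_magma A b v \<in> lie_power A H (Suc m)"
    by (intro lie_power_bracket[OF idealD(1)[OF H]] Q) simp_all
  then show ?case by (simp del: lie_power.simps)
next
  case (ideal m w v)
  then have "eval_magma A b v \<in> carrier A"
    by (intro eval_magma_closed[OF nonassoc_algebra_axioms, of n b] b) simp_all
  with ideal show ?case using idealD(2)[OF lie_power_ideal[OF H]] by simp
qed

lemma (in lie) poly_word_sound:
  assumes b: "\<And>i. i \<in> {1..n::nat} \<Longrightarrow> b i \<in> carrier A"
  shows "poly_word cs w \<Longrightarrow> set_magma w \<subseteq> {1..n} \<Longrightarrow> eval_magma A b w \<in> polynilpotent_ideal A cs"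
proof (induction cs arbitrary: w rule: rev_induct)
  case Nil
  then show ?case
    using eval_magma_closed[OF nonassoc_algebra_axioms, of n b w] b by (simp add: polynilpotent_ideal_series)
next
  case (snoc c cs)
  have "Suc c \<ge> 1 \<and> eval_magma A b w \<in> lie_power A (polynilpotent_ideal A cs) (Suc c)"
  proof (rule power_word_sound[where Q = "poly_word cs" and n = n])
    show "power_word (poly_word cs) (Suc c) w" "set_magma w \<subseteq> {1..n}" using snoc.prems by simp_all
  qed (rule b polynilpotent_ideal_ideal snoc.IH; assumption)+
  then show ?case by (simp add: polynilpotent_ideal_series del: lie_power.simps)
qed

section \<open>Values of words at Pauli matrices\<close>

primrec mat2_eval :: "(nat \<Rightarrow> 'r::comm_ring_1 mat2) \<Rightarrow> nat magma \<Rightarrow> 'r mat2"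
  where
    "mat2_eval P (Gen i) = P i"
  | "mat2_eval P (Br u v) = mat2_bracket (mat2_eval P u) (mat2_eval P v)"

lemma fst_eval_magma: "fst (eval_magma aff (point P Z) w) = mat2_eval P w"
  by (induction w) (simp_all add: fst_aff_mult)

lemma snd_eval_magma_zero: "(\<And>i. i \<in> set_magma w \<Longrightarrow> snd (b i) = 0) \<Longrightarrow> snd (eval_magma aff b w) = 0"
proof (induction w)
  case (Br u v)
  have [simp]: "mat2_act m 0 = 0" for m :: "'a poly mat2"
    by (cases m) (auto simp: zero_prod_def)
  show ?case using Br by (simp add: snd_aff_mult)
qed simp

text \<open>Multiples of Pauli matrices, the antisymmetric one freed from the imaginary unit so that
  any field will do. Every index other than 1 and 2 denotes this third direction.\<close>

fun pauli :: "nat \<Rightarrow> 'r::comm_ring_1 \<Rightarrow> 'r mat2"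
  where "pauli i a = (if i = 1 then (a, 0, 0, - a) else if i = 2 then (0, a, a, 0) else (0, a, - a, 0))"

declare pauli.simps [simp del]

definition pauli_point :: "nat \<Rightarrow> 'k::field poly mat2"
  where "pauli_point i = (if i \<in> {1, 2} then pauli i (Polynomial.monom 1 1) else (0, 0, 0, 0))"

text \<open>The value has a single direction and does not vanish. Brackets respect the parity in
  which the directions 1 and 2 are odd and 3 is even, so the degree decides whether the direction is
  3. The type argument names the field, which otherwise occurs only under the quantifier.\<close>

definition pauli_word :: "'k::field_char_0 itself \<Rightarrow> nat magma \<Rightarrow> nat \<Rightarrow> bool"
  where "pauli_word _ w i \<longleftrightarrow> set_magma w \<subseteq> {1, 2} \<and> i \<in> {1, 2, 3} \<and> (i = 3 \<longleftrightarrow> even (magma_degree w)) \<and>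
    (\<exists>c::'k. c \<noteq> 0 \<and> mat2_eval pauli_point w = pauli i (Polynomial.monom c (magma_degree w)))"

lemma pauli_wordD:
  assumes "pauli_word TYPE('k::field_char_0) w i"
  shows "set_magma w \<subseteq> {1, 2}" "i \<in> {1, 2, 3}" "i = 3 \<longleftrightarrow> even (magma_degree w)"
    "\<exists>c::'k. c \<noteq> 0 \<and> mat2_eval pauli_point w = pauli i (Polynomial.monom c (magma_degree w))"
  using assms unfolding pauli_word_def by blast+

lemma pauli_word_Gen: "j \<in> {1, 2} \<Longrightarrow> pauli_word TYPE('k::field_char_0) (Gen j) j"
  by (auto simp: pauli_word_def pauli_point_def intro!: exI[of _ "1::'k"])

text \<open>As 1 + 2 + 3 = 6, the index \<open>6 - i - j\<close> is the remaining one.\<close>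

lemma pauli_bracket:
  fixes a b :: "'r::comm_ring_1"
  assumes "i \<in> {1, 2, 3}" "j \<in> {1, 2, 3}" "i \<noteq> j"
  shows "\<exists>\<epsilon>\<in>{2, -2}. mat2_bracket (pauli i a) (pauli j b) = pauli (6 - i - j) (\<epsilon> * (a * b))"
  using assms by (auto simp: pauli.simps algebra_simps)

text \<open>Each bracket of two directions contributes a factor 2 or -2, which is nonzero in
  characteristic zero.\<close>

lemma pauli_word_Br:
  assumes u: "pauli_word TYPE('k::field_char_0) u i" and v: "pauli_word TYPE('k) v j" and ij: "i \<noteq> j"
  shows "pauli_word TYPE('k) (Br u v) (6 - i - j)"
proof -
  obtain c :: 'k where c: "c \<noteq> 0" "mat2_eval pauli_point u = pauli i (Polynomial.monom c (magma_degree u))"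
    using pauli_wordD(4)[OF u] by blast
  obtain d :: 'k where d: "d \<noteq> 0" "mat2_eval pauli_point v = pauli j (Polynomial.monom d (magma_degree v))"
    using pauli_wordD(4)[OF v] by blast
  note i = pauli_wordD(2)[OF u] and j = pauli_wordD(2)[OF v]
  obtain \<epsilon> :: "'k poly" where \<epsilon>: "\<epsilon> \<in> {2, -2}" "mat2_eval pauli_point (Br u v) =
      pauli (6 - i - j) (\<epsilon> * (Polynomial.monom c (magma_degree u) * Polynomial.monom d (magma_degree v)))"
    using pauli_bracket[OF i j ij] unfolding mat2_eval.simps c(2) d(2) by blast
  define e :: 'k where "e = (if \<epsilon> = 2 then 2 else -2)"
  have two: "(2::'k poly) = Polynomial.monom 2 0" "(-2::'k poly) = Polynomial.monom (-2) 0"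
    by (simp_all add: numeral_poly monom_0)
  have "\<epsilon> = Polynomial.monom e 0" using \<epsilon>(1) two by (auto simp: e_def)
  then have "mat2_eval pauli_point (Br u v) = pauli (6 - i - j) (Polynomial.monom (e * (c * d)) (magma_degree (Br u v)))"
    unfolding \<epsilon>(2) by (simp add: mult_monom)
  then have "\<exists>c::'k. c \<noteq> 0 \<and> mat2_eval pauli_point (Br u v) = pauli (6 - i - j) (Polynomial.monom c (magma_degree (Br u v)))"
    using c d by (intro exI[of _ "e * (c * d)"]) (simp add: e_def)
  moreover have "6 - i - j \<in> {1, 2, 3} \<and> (6 - i - j = 3 \<longleftrightarrow> even (magma_degree (Br u v)))"
    using pauli_wordD(2,3)[OF u] pauli_wordD(2,3)[OF v] ij by auto
  moreover have "set_magma (Br u v) \<subseteq> {1, 2}" using pauli_wordD(1)[OF u] pauli_wordD(1)[OF v] by simp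
  ultimately show ?thesis unfolding pauli_word_def by blast
qed

text \<open>Bracketing with \<open>u\<close> alternates between the two directions other than that
  of \<open>u\<close>, so no iterate vanishes.\<close>

lemma iterated_bracket_word:
  assumes u: "pauli_word TYPE('k::field_char_0) u i" and v: "pauli_word TYPE('k) v j" and ij: "i \<noteq> j"
    and Q: "Q u" "Q v"
  shows "\<exists>w k. power_word Q (Suc m) w \<and> pauli_word TYPE('k) w k \<and> k \<noteq> i \<and>
    magma_degree w = magma_degree v + m * magma_degree u"
proof (induction m)
  case 0
  show ?case using v ij Q power_word.base[of Q v] by (intro exI[of _ v] exI[of _ j]) simp
next
  case (Suc m)
  then obtain w k where w: "power_word Q (Suc m) w" "pauli_word TYPE('k) w k" "k \<noteq> i"
    "magma_degree w = magma_degree v + m * magma_degree u" by blast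
  have "6 - k - i \<noteq> i" using w(3) pauli_wordD(2)[OF w(2)] pauli_wordD(2)[OF u] by auto
  with w show ?case
    using power_word.bracket[OF w(1) Q(1)] pauli_word_Br[OF w(2) u w(3)]
    by (intro exI[of _ "Br w u"] exI[of _ "6 - k - i"]) simp
qed

text \<open>At each stage a letter of another direction is bracketed to u, and the result c times
  with u again; degree g becomes (c + 1) g + 1. The bound anticipates the application: one degree
  for a letter that leads out of direction 3, one for the factor y, and two for the margin in d + 2
  \<le> D. Only the list \<open>[1]\<close>, with the word of x_1 and x_2 of degree 2, is too short
  for it.\<close>

lemma poly_word_exists:
  assumes "cs \<noteq> []" "\<forall>c\<in>set cs. c \<ge> 1"
  shows "\<exists>u i. poly_word cs u \<and> pauli_word TYPE('k::field_char_0) u i \<and>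
    (cs = [1] \<and> magma_degree u = 2 \<or>
     3 \<le> prod_list (map Suc cs) \<and> magma_degree u + (if i = 3 then 1 else 0) + 3 \<le> 2 * prod_list (map Suc cs))"
  using assms
proof (induction cs rule: rev_induct)
  case (snoc c cs)
  show ?case
  proof (cases "cs = []")
    case True
    have "\<exists>w k. power_word (\<lambda>_. True) (Suc c) w \<and> pauli_word TYPE('k) w k \<and> k \<noteq> 1 \<and>
        magma_degree w = magma_degree (Gen (2::nat)) + c * magma_degree (Gen (1::nat))"
      by (rule iterated_bracket_word[OF pauli_word_Gen pauli_word_Gen]) simp_all
    then obtain w k where w: "power_word (\<lambda>_. True) (Suc c) w" "pauli_word TYPE('k) w k"
      "magma_degree w = Suc c" by auto
    have "poly_word (cs @ [c]) w" using w(1) True by (simp add: poly_word_def)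
    moreover have "c = 1 \<or> c \<ge> 2" using snoc.prems by auto
    moreover have "k = 3 \<longleftrightarrow> odd c" using pauli_wordD(3)[OF w(2)] w(3) by simp
    \<comment> \<open>For \<open>c = 2\<close> the degree 3 is odd; this excludes direction 3 and
      saves the additional letter.\<close>
    then have "c \<ge> 2 \<Longrightarrow> k = 3 \<Longrightarrow> c \<ge> 3" by (cases "c = 2") auto
    ultimately show ?thesis using w True by (intro exI[of _ w] exI[of _ k]) auto
  next
    case False
    let ?D = "prod_list (map Suc cs)"
    obtain u i where u: "poly_word cs u" "pauli_word TYPE('k) u i"
      and deg: "cs = [1] \<and> magma_degree u = 2 \<or> 3 \<le> ?D \<and> magma_degree u + (if i = 3 then 1 else 0) + 3 \<le> 2 * ?D"
      using snoc.IH[OF False] snoc.prems by auto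
    define j :: nat where "j = (if i = 1 then 2 else 1)"
    have j: "j \<in> {1, 2}" "i \<noteq> j" by (auto simp: j_def)
    note i = pauli_wordD(2)[OF u(2)]
    have v: "poly_word cs (Br u (Gen j))" "pauli_word TYPE('k) (Br u (Gen j)) (6 - i - j)"
      using poly_word_Br[OF u(1)] pauli_word_Br[OF u(2) pauli_word_Gen[OF j(1)] j(2)] .
    have "i \<noteq> 6 - i - j" using i j by auto
    from iterated_bracket_word[OF u(2) v(2) this, of "poly_word cs" c] u(1) v(1)
    obtain w k where w: "poly_word (cs @ [c]) w" "pauli_word TYPE('k) w k"
      and dw: "magma_degree w = magma_degree u + 1 + c * magma_degree u" by auto
    have "3 \<le> prod_list (map Suc (cs @ [c])) \<and>
        magma_degree w + (if k = 3 then 1 else 0) + 3 \<le> 2 * prod_list (map Suc (cs @ [c]))"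
    proof (cases "cs = [1] \<and> magma_degree u = 2")
      case True
      \<comment> \<open>The exceptional word yields degree 2 c + 3, which is odd, so the bound holds
        from the next stage on.\<close>
      then have "odd (magma_degree w)" by (simp add: dw)
      then have "k \<noteq> 3" using pauli_wordD(3)[OF w(2)] by simp
      then show ?thesis using True snoc.prems by (simp add: dw)
    next
      case False
      with deg have 3: "3 \<le> ?D" and le: "magma_degree u + 3 \<le> 2 * ?D" by auto
      \<comment> \<open>The slack 3 becomes at least 6 and pays for the new letter, a possible
        direction 3 and the slack to be kept: 1 + 1 + 3.\<close>
      have "(magma_degree u + 3) * (c + 1) \<le> 2 * ?D * (c + 1)" by (rule mult_right_mono[OF le]) simp
      moreover have "c \<ge> 1" using snoc.prems by simp
      ultimately have "magma_degree w + 1 + 3 \<le> 2 * (?D * (c + 1))" by (simp add: dw algebra_simps)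
      moreover have "3 \<le> ?D * (c + 1)" using 3 by (simp add: trans_le_add1)
      ultimately show ?thesis by simp
    qed
    then show ?thesis using w by blast
  qed
qed simp

section \<open>The trace as an obstruction to approximate tameness\<close>

lemma monom_dvd_cancel:
  "Polynomial.monom 1 (Suc k) dvd Polynomial.monom 1 1 * (z :: 'k::field poly) \<longleftrightarrow> Polynomial.monom 1 k dvd z"
proof -
  have "Polynomial.monom (1::'k) (Suc k) = Polynomial.monom 1 1 * Polynomial.monom 1 k" by (simp add: mult_monom)
  then show ?thesis by (simp del: mult_monom)
qed

lemma aff_filtration_vcomp:
  "v \<in> aff_filtration (Suc k) \<Longrightarrow> Polynomial.monom 1 k dvd vcomp (snd v) e"
  by (auto simp: aff_filtration_def vcomp_def monom_dvd_cancel[simplified])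

lemma aff_filtration_diff:
  assumes "v \<in> aff_filtration a" "w \<in> aff_filtration a"
  shows "v - w \<in> aff_filtration a" "v + w \<in> aff_filtration a"
  using aff.submoduleD(6,3)[OF submodule_aff_filtration assms] by (simp_all add: a_minus_def aff_uminus)

context relatively_free begin

lemma eval_in_hull:
  assumes "set_magma w \<subseteq> S" "S \<subseteq> {1..n}"
  shows "eval_magma A x w \<in> subalgebra_of A hull (x ` S)"
proof -
  have "x ` S \<subseteq> carrier A" using assms(2) gen_closed by blast
  from subalgebra_hull[OF this] have "subalgebra_of A (subalgebra_of A hull (x ` S))" .
  then show ?thesis using assms(1)
    by (induction w) (auto simp: subalgebra_of_def intro: hull_inc)
qed

lemma eval_foldr_Br: "eval_magma A x (foldr Br ws w) = ads (map (eval_magma A x) ws) (eval_magma A x w)"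
  by (induction ws) simp_all

text \<open>Terms of large degree and relations of the variety are equally invisible below the order
  given by the classes.\<close>

lemma difference_in_filtration:
  assumes p: "p \<in> carrier F" and q: "q = p \<oplus>\<^bsub>F\<^esub> (r \<oplus>\<^bsub>F\<^esub> s)"
    and r: "r \<in> degree_above n m" and s: "s \<in> polynilpotent_relations cs n"
    and m: "prod_list (map Suc cs) \<le> m" and b: "\<And>i. b i \<in> aff_filtration 1"
  shows "free_ext aff b q - free_ext aff b p \<in> aff_filtration (prod_list (map Suc cs))"
proof -
  have C: "r \<in> carrier F" "s \<in> carrier F"
    using r s by (simp_all add: degree_above_def polynilpotent_relations_def)
  have "free_ext aff b q - free_ext aff b p = free_ext aff b r + free_ext aff b s"
    unfolding q using p C free_nonassoc.M.a_closed[OF C] by (simp add: aff_ext_simps del: free_nonassoc_sel)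
  moreover have "free_ext aff b r + free_ext aff b s \<in> aff_filtration (prod_list (map Suc cs))"
  proof (rule aff_filtration_diff(2)[OF _ ext_relations_filtration[OF b s]])
    show "free_ext aff b r \<in> aff_filtration (prod_list (map Suc cs))"
    by (rule ext_aff_filtration[OF b C(1)]) (use r m in \<open>auto simp: degree_above_def intro: order_trans less_imp_le\<close>)
  qed
  ultimately show ?thesis by (simp only:)
qed

text \<open>Below t^(d+1) the Jacobian matrix of the tuple \<open>p\<close> that comes from tame
  automorphisms agrees with that of the explicit lift \<open>q\<close>, because passing to plane
  parts costs one power of t and d + 2 \<le> D. So its determinant has the coefficient 2 \<kappa> at
  t^d, the trace of the product of the matrices of \<open>ws\<close>, although it is
  constant.\<close>

lemma wild_ads_automorphism:
  fixes P :: "nat \<Rightarrow> 'k poly mat2" and \<kappa> :: 'k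
  assumes cs: "cs = cs' @ [c]" and s: "s \<in> {1..n}"
    and ws: "\<And>w. w \<in> set ws \<Longrightarrow> set_magma w \<subseteq> {1..n} - {s}"
    and u: "u \<in> set ws" "poly_word cs' u"
    and P: "\<And>i z. (P i, basis_vec z i) \<in> aff_filtration 1"
    and d: "d = sum_list (map magma_degree ws)" "d + 2 \<le> prod_list (map Suc cs)"
    and \<kappa>: "2 * \<kappa> \<noteq> 0"
      "\<And>z. foldr (\<lambda>w. mat2_act (mat2_eval P w)) ws z = (Polynomial.monom \<kappa> d * fst z, Polynomial.monom \<kappa> d * snd z)"
  shows "\<exists>\<phi>. absolutely_wild A x n \<phi>"
proof -
  let ?J = "polynilpotent_ideal A cs'"
  have ws': "set_magma w \<subseteq> {1..n}" if "w \<in> set ws" for w using ws[OF that] by auto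
  have J: "ideal_of A ?J" by (rule polynilpotent_ideal_ideal)
  have nil: "lie_power A ?J (Suc c) = {\<zero>}"
    using polynilpotent by (simp add: cs polynilpotent_ideal_series del: lie_power.simps)
  have uJ: "eval_magma A x u \<in> ?J"
    by (rule poly_word_sound[OF gen_closed u(2) ws'[OF u(1)]])
  obtain \<phi> where \<phi>: "\<phi> \<in> carrier (alg_Aut A)" "\<phi> (x s) = x s \<oplus> ads (map (eval_magma A x) ws) (x s)"
    "\<And>i. i \<in> {1..n} - {s} \<Longrightarrow> \<phi> (x i) = x i"
  proof (rule ads_automorphism[OF J nil s])
    show "set (map (eval_magma A x) ws) \<subseteq> subalgebra_of A hull (x ` ({1..n} - {s}))"
      using eval_in_hull[OF ws] by auto
    show "eval_magma A x u \<in> set (map (eval_magma A x) ws)" using u by simp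
  qed (use uJ in auto)
  define W where "W = foldr Br ws (Gen s)"
  have W: "set_magma W \<subseteq> {1..n}"
    unfolding W_def using ws' s by (induction ws) auto
  have degW: "magma_degree W = d + 1"
    unfolding W_def d(1) by (induction ws) auto
  have gs: "nonassoc_gen s \<in> carrier F" and mW: "magma_monomial W \<in> carrier F"
    using nonassoc_gen_carrier[OF s] magma_monomial_carrier[OF W] by auto
  define q where "q j = (if j = s then nonassoc_gen s \<oplus>\<^bsub>F\<^esub> magma_monomial W else nonassoc_gen j)" for j
  have q: "lifts q \<phi>"
    unfolding lifts_def
  proof (intro ballI conjI)
    fix j assume j: "j \<in> {1..n}"
    show "q j \<in> carrier F"
      using free_nonassoc.M.a_closed[OF gs mW] nonassoc_gen_carrier[OF j] unfolding q_def by metis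
    show "proj (q j) = \<phi> (x j)"
    proof (cases "j = s")
      case True
      have "proj (q s) = x s \<oplus> eval_magma A x W"
        using proj.hom_add[OF gs mW] proj_gen[OF s] eval_magma_proj[OF W] by (simp add: q_def)
      then show ?thesis using True \<phi>(2) by (simp add: W_def eval_foldr_Br)
    next
      case False
      then show ?thesis using \<phi>(3)[of j] proj_gen[OF j] j by (simp add: q_def)
    qed
  qed
  have "\<not> approximately_tame A x n \<phi>"
  proof
    assume tame: "approximately_tame A x n \<phi>"
    let ?D = "prod_list (map Suc cs)"
    have D: "1 \<le> ?D" using d(2) by simp
    have base: "\<exists>\<gamma>. \<forall>P :: nat \<Rightarrow> 'k poly mat2. det (jacobian n P nonassoc_gen) = [:\<gamma>:]"
      by (rule exI[of _ 1]) (simp add: jacobian_gen one_pCons)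
    obtain p where const: "\<exists>\<gamma>. \<forall>P. det (jacobian n P p) = [:\<gamma>:]"
      and p: "\<And>j. j \<in> {1..n} \<Longrightarrow> p j \<in> carrier F"
      and diff: "\<And>j. j \<in> {1..n} \<Longrightarrow> \<exists>r\<in>degree_above n ?D. \<exists>s\<in>polynilpotent_relations cs n. q j = p j \<oplus>\<^bsub>F\<^esub> (r \<oplus>\<^bsub>F\<^esub> s)"
      by (rule approximately_tame_lifts[where \<Phi> = "\<lambda>p. \<exists>\<gamma>. \<forall>P. det (jacobian n P p) = [:\<gamma>:]", OF tame q D base])
        (rule constant_jacobian_step that; assumption)+
    have near: "Polynomial.monom 1 (d + 1) dvd partial P (q j) e z - partial P (p j) e z" if j: "j \<in> {1..n}" for j e z
    proof -
      obtain r s where rs: "r \<in> degree_above n ?D" "s \<in> polynilpotent_relations cs n" "q j = p j \<oplus>\<^bsub>F\<^esub> (r \<oplus>\<^bsub>F\<^esub> s)"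
        using diff[OF j] by blast
      have "free_ext aff (point P (basis_vec z)) (q j) - free_ext aff (point P (basis_vec z)) (p j) \<in> aff_filtration ?D"
        by (rule difference_in_filtration[where b = "point P (basis_vec z)", OF p[OF j] rs(3,1,2) order_refl P])
      then have "free_ext aff (point P (basis_vec z)) (q j) - free_ext aff (point P (basis_vec z)) (p j) \<in> aff_filtration (Suc (d + 1))"
        using aff_filtration_antimono[of "Suc (d + 1)" ?D] d(2) by auto
      from aff_filtration_vcomp[OF this, of e] show ?thesis by (simp add: partial_def)
    qed
    have qW: "partial P (q (r div 2 + 1)) (r mod 2) z = (if r = z then 1 else 0) +
        (if r div 2 + 1 = s then partial P (magma_monomial W) (r mod 2) z else 0)" for r z
    proof (cases "r div 2 + 1 = s")
      case True
      then show ?thesis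
        using partial_add[OF gs mW, of P "r mod 2" z] partial_gen[of P r z] by (simp add: q_def)
    next
      case False
      then show ?thesis using partial_gen[of P r z] by (simp add: q_def)
    qed
    have Wd: "Polynomial.monom 1 d dvd partial P (magma_monomial W) e z" for e z
      using eval_aff_filtration[of "point P (basis_vec z)" W, OF P] degW
      by (simp add: partial_def aff_ext_monomial[OF W] aff_filtration_vcomp)
    have Wdiag: "partial P (magma_monomial W) (r mod 2) r = Polynomial.monom \<kappa> d" if r: "r div 2 + 1 = s" for r
    proof -
      let ?b = "point P (basis_vec r)"
      \<comment> \<open>Along a coordinate of x_s the words in \<open>ws\<close> have no plane part,
        so bracketing with them reduces to the action of their matrices.\<close>
      have zero: "snd (eval_magma aff ?b w) = 0" if "w \<in> set ws" for w
        using ws[OF that] r by (intro snd_eval_magma_zero) (auto simp: basis_vec_def zero_prod_def)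
      have act0: "mat2_act m 0 = 0" for m :: "'k poly mat2"
        by (cases m) (auto simp: zero_prod_def)
      have "snd (eval_magma aff ?b (foldr Br vs (Gen s))) = foldr (\<lambda>w. mat2_act (mat2_eval P w)) vs (basis_vec r s)"
        if "set vs \<subseteq> set ws" for vs
        using that by (induction vs) (simp_all add: snd_aff_mult zero act0 fst_eval_magma)
      from this[of ws] have "snd (eval_magma aff ?b W) = (Polynomial.monom \<kappa> d * fst (basis_vec r s), Polynomial.monom \<kappa> d * snd (basis_vec r s))"
        by (simp add: W_def \<kappa>(2))
      then show ?thesis
        using r by (auto simp: partial_def aff_ext_monomial[OF W] vcomp_def basis_vec_def)
    qed
    define \<nu> where "\<nu> r = (if r div 2 + 1 = s then \<kappa> else 0)" for r
    have d1: "d \<ge> 1" using u(1) magma_degree_pos[of u] member_le_sum_list[of "magma_degree u" "map magma_degree ws"]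
      unfolding d(1) by simp
    \<comment> \<open>Only the Jacobian matrix of \<open>q\<close> is known explicitly; that of
      \<open>p\<close> is treated as a perturbation of it.\<close>
    have jq: "jacobian n P p $$ (r, z) = partial P (q (r div 2 + 1)) (r mod 2) z - (partial P (q (r div 2 + 1)) (r mod 2) z - partial P (p (r div 2 + 1)) (r mod 2) z)"
      if "r < 2 * n" "z < 2 * n" for r z
      using that by (simp add: jacobian_def)
    have "Polynomial.coeff (det (jacobian n P p)) d = (\<Sum>r<2*n. \<nu> r)"
    proof (rule coeff_det_near_identity[OF jacobian_carrier d1])
      fix r z assume rz: "r < 2 * n" "z < 2 * n" "r \<noteq> z"
      have "Polynomial.monom (1::'k) d dvd Polynomial.monom 1 (d + 1)" by (simp add: monom_1_dvd_iff')
      then have "Polynomial.monom 1 d dvd partial P (q (r div 2 + 1)) (r mod 2) z - partial P (p (r div 2 + 1)) (r mod 2) z"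
        using near[OF row_index[OF rz(1)]] by (rule dvd_trans)
      moreover have "Polynomial.monom 1 d dvd partial P (q (r div 2 + 1)) (r mod 2) z"
        unfolding qW using rz(3) Wd by simp
      ultimately show "Polynomial.monom 1 d dvd jacobian n P p $$ (r, z)"
        unfolding jq[OF rz(1,2)] by (rule dvd_diff[rotated])
    next
      fix r assume r: "r < 2 * n"
      have "partial P (q (r div 2 + 1)) (r mod 2) r = 1 + Polynomial.monom (\<nu> r) d"
        unfolding qW by (simp add: \<nu>_def Wdiag)
      then have "jacobian n P p $$ (r, r) - (1 + Polynomial.monom (\<nu> r) d) =
          - (partial P (q (r div 2 + 1)) (r mod 2) r - partial P (p (r div 2 + 1)) (r mod 2) r)"
        unfolding jq[OF r r] by simp
      then show "Polynomial.monom 1 (d + 1) dvd jacobian n P p $$ (r, r) - (1 + Polynomial.monom (\<nu> r) d)"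
        using near[OF row_index[OF r], of "r mod 2" r] by (simp only: dvd_minus_iff)
    qed
    \<comment> \<open>x_s owns two consecutive rows; each contributes \<kappa>, which explains the
      factor 2.\<close>
    also have "(\<Sum>r<2*n. \<nu> r) = (\<Sum>r\<in>{2 * (s - 1), 2 * (s - 1) + 1}. \<kappa>)"
    proof (rule sum.mono_neutral_cong_right)
      show "{2 * (s - 1), 2 * (s - 1) + 1} \<subseteq> {..<2 * n}" using s by auto
      show "\<forall>r\<in>{..<2 * n} - {2 * (s - 1), 2 * (s - 1) + 1}. \<nu> r = 0"
        by (auto simp: \<nu>_def)
      fix r assume "r \<in> {2 * (s - 1), 2 * (s - 1) + 1}"
      then show "\<nu> r = \<kappa>" using s by (auto simp: \<nu>_def)
    qed simp
    finally have "Polynomial.coeff (det (jacobian n P p)) d = 2 * \<kappa>" by simp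
    moreover obtain \<gamma> where "det (jacobian n P p) = [:\<gamma>:]" using const by blast
    ultimately show False using \<kappa>(1) d1 by (simp add: coeff_pCons split: nat.splits)
  qed
  then show ?thesis using \<phi>(1) by (auto simp: absolutely_wild_def)
qed

end

section \<open>The case of two generators\<close>

lemma aff_module_simps:
  "aff_smult a (v + w) = aff_smult a v + aff_smult a w" "aff_smult a (aff_smult b v) = aff_smult (a * b) v"
  "aff_smult 1 v = v" "aff_smult 0 v = 0" "aff_smult a 0 = 0"
  "aff_mult (aff_smult a v) (aff_smult b v) = 0"
  using aff.smult_add[of v w a] aff.smult_smult[of v a b] aff.one_smult[of v] aff.zero_smult[of v] aff.smult_zero[of a]
    aff.mult_smult_left[of v "aff_smult b v" a] aff.mult_smult_right[of v v b] aff.bracket_self[of v]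
  by (simp_all add: aff.smult_zero[simplified])

lemma aff_add_smult: "aff_smult (a + b) v = aff_smult a v + aff_smult b v"
  using aff.add_smult[of v a b] by simp

text \<open>A Lie algebra generated by one element is at most a line. In the free nonassociative
  algebra powers of a generator survive, so the statement concerns values in the affine algebra,
  where multiples of one element have bracket zero.\<close>

lemma ext_single_generator:
  fixes f :: "nat magma \<Rightarrow> 'k::field"
  assumes f: "f \<in> subalgebra_of (free_nonassoc n) hull {nonassoc_gen j}" and j: "j \<in> {1..n}"
  shows "\<exists>a. \<forall>b. free_ext aff b f = aff_smult a (b j)"
proof -
  let ?T = "{f :: nat magma \<Rightarrow> 'k. f \<in> carrier (free_nonassoc n) \<and> (\<exists>a. \<forall>b. free_ext aff b f = aff_smult a (b j))}"
  have "subalgebra_of (free_nonassoc n) ?T"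
  proof (rule free_nonassoc.subalgebraI)
    show "?T \<subseteq> carrier (free_nonassoc n)" by blast
    show "\<zero>\<^bsub>free_nonassoc n\<^esub> \<in> ?T"
      using free_nonassoc.M.zero_closed[of n]
      by (auto simp: aff_ext_zero aff_module_simps simp del: free_nonassoc_sel intro!: exI[of _ 0])
    fix f :: "nat magma \<Rightarrow> 'k" assume "f \<in> ?T"
    then obtain a where f: "f \<in> carrier (free_nonassoc n)" "\<And>b. free_ext aff b f = aff_smult a (b j)" by blast
    show "k \<odot>\<^bsub>free_nonassoc n\<^esub> f \<in> ?T" for k
      using free_nonassoc.smult_in[OF f(1)] f
      by (auto simp: aff_ext_smult aff_module_simps simp del: free_nonassoc_sel intro!: exI[of _ "k * a"])
    fix g :: "nat magma \<Rightarrow> 'k" assume "g \<in> ?T"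
    then obtain a' where g: "g \<in> carrier (free_nonassoc n)" "\<And>b. free_ext aff b g = aff_smult a' (b j)" by blast
    show "f \<oplus>\<^bsub>free_nonassoc n\<^esub> g \<in> ?T"
      using free_nonassoc.M.a_closed[OF f(1) g(1)] f g
      by (auto simp: aff_ext_simps aff_add_smult simp del: free_nonassoc_sel intro!: exI[of _ "a + a'"])
    show "f \<otimes>\<^bsub>free_nonassoc n\<^esub> g \<in> ?T"
      using free_nonassoc.mult_closed[OF f(1) g(1)] f g
      by (auto simp: aff_ext_simps aff_module_simps simp del: free_nonassoc_sel intro!: exI[of _ 0])
  qed
  moreover have "nonassoc_gen j \<in> ?T"
    using nonassoc_gen_carrier[OF j] j by (auto simp: aff_module_simps intro!: exI[of _ 1])
  ultimately have "subalgebra_of (free_nonassoc n) hull {nonassoc_gen j} \<subseteq> ?T"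
    by (intro hull_minimal) simp_all
  with f show ?thesis by blast
qed

text \<open>Linearity is demanded of the values only: a lift may contain terms such as the square of
  a generator, which vanish in every Lie algebra.\<close>

definition linear_tuple :: "(nat \<Rightarrow> nat magma \<Rightarrow> 'k::field) \<Rightarrow> bool"
  where "linear_tuple p \<longleftrightarrow> (\<forall>j\<in>{1..2}. \<exists>k l. \<forall>b. free_ext aff b (p j) = aff_smult k (b 1) + aff_smult l (b 2))"

lemma linear_tuple_gen: "linear_tuple nonassoc_gen"
  unfolding linear_tuple_def
proof
  fix j :: nat assume "j \<in> {1..2}"
  then have "j = 1 \<or> j = 2" by auto
  then show "\<exists>k l. \<forall>b. free_ext aff b (nonassoc_gen j) = aff_smult k (b 1) + aff_smult l (b 2)"
    by (elim disjE) (rule exI[of _ 1], rule exI[of _ 0], simp add: aff_module_simps,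
      rule exI[of _ 0], rule exI[of _ 1], simp add: aff_module_simps)
qed

lemma (in relatively_free) linear_tuple_step:
  assumes n: "n = 2" and p: "linear_tuple p" "\<And>j. j \<in> {1..n} \<Longrightarrow> p j \<in> carrier F" and i: "i \<in> {1..n}"
    and f: "f \<in> carrier F" "f \<in> subalgebra_of F hull (nonassoc_gen ` ({1..n} - {i}))"
  shows "linear_tuple (elementary_tuple p i \<alpha> f)"
  unfolding linear_tuple_def
proof
  fix l :: nat assume l: "l \<in> {1..2}"
  define j where "j = 3 - i"
  have "i = 1 \<or> i = 2" using i n by auto
  then have j: "j \<in> {1..n}" and sing: "{1..n} - {i} = {j}" using n by (auto simp: j_def)
  show "\<exists>k l'. \<forall>b. free_ext aff b (elementary_tuple p i \<alpha> f l) = aff_smult k (b 1) + aff_smult l' (b 2)"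
  proof (cases "l = i")
    case False
    then show ?thesis using p(1) l by (simp add: elementary_tuple_def linear_tuple_def)
  next
    case True
    obtain a where a: "\<And>b. free_ext aff b f = aff_smult a (b j)"
      using ext_single_generator[of f n j] f(2) j unfolding sing by auto
    obtain k1 l1 where 1: "\<And>b. free_ext aff b (p i) = aff_smult k1 (b 1) + aff_smult l1 (b 2)"
      using p(1) i n unfolding linear_tuple_def by metis
    obtain k2 l2 where 2: "\<And>b. free_ext aff b (p j) = aff_smult k2 (b 1) + aff_smult l2 (b 2)"
      using p(1) j n unfolding linear_tuple_def by metis
    interpret ph: algebra_hom F F "free_ext F p" by (rule free_nonassoc.free_ext_algebra_hom) (rule p)
    have "free_ext aff b (elementary_tuple p i \<alpha> f i) = aff_smult (\<alpha> * k1 + a * k2) (b 1) + aff_smult (\<alpha> * l1 + a * l2) (b 2)" for b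
    proof -
      have "free_ext aff b (elementary_tuple p i \<alpha> f i) = aff_smult \<alpha> (free_ext aff b (p i)) + free_ext aff b (free_ext F p f)"
        using aff_ext_simps(1)[OF free_nonassoc.smult_in[OF p(2)[OF i]] ph.hom_closed[OF f(1)], of b \<alpha>]
          aff_ext_smult[OF p(2)[OF i], of b \<alpha>]
        by (simp add: elementary_tuple_def del: free_nonassoc_sel)
      also have "free_ext aff b (free_ext F p f) = aff_smult a (free_ext aff b (p j))"
        using aff_ext_comp[where n = n and p = p, OF _ f(1)] p(2) by (simp add: a)
      finally show ?thesis by (simp add: 1 2 aff_module_simps aff_add_smult ac_simps)
    qed
    with True show ?thesis by blast
  qed
qed

lemma aff_filtration_fst:
  "v \<in> aff_filtration a \<Longrightarrow> fst v = (m1, m2, m3, m4) \<Longrightarrow>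
    Polynomial.monom 1 a dvd m1 \<and> Polynomial.monom 1 a dvd m2"
  by (cases v) (auto simp: aff_filtration_def)

text \<open>At the Pauli point a linear tuple has matrix parts of degree 1 in t, whereas the summand
  \<open>[u, x_j]\<close> appears in degree \<open>magma_degree u + 1\<close>. Only matrix parts are
  compared, so no power of t is lost, and relations start at D, which is larger than this
  degree.\<close>

lemma wild_rank_two:
  fixes A :: "('k::field_char_0, 'a) module"
  assumes A: "relatively_free A x 2 cs proj" and cs: "cs = cs' @ [c]"
    and u: "poly_word cs' u" "pauli_word TYPE('k) u i" and deg: "magma_degree u + 2 \<le> prod_list (map Suc cs)"
  shows "\<exists>\<phi>. absolutely_wild A x 2 \<phi>"
proof -
  interpret relatively_free A x 2 cs proj by fact
  let ?J = "polynilpotent_ideal A cs'"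
  have J: "ideal_of A ?J" by (rule polynilpotent_ideal_ideal)
  have nil: "lie_power A ?J (Suc c) = {\<zero>\<^bsub>A\<^esub>}"
    using polynilpotent by (simp add: cs polynilpotent_ideal_series del: lie_power.simps)
  have two: "{1, 2} = {1..2::nat}" by auto
  have uS: "set_magma u \<subseteq> {1..2}" using pauli_wordD(1)[OF u(2)] unfolding two .
  have uJ: "eval_magma A x u \<in> ?J" by (rule poly_word_sound[OF gen_closed u(1) uS])
  obtain \<phi> where \<phi>: "\<phi> \<in> carrier (alg_Aut A)"
    "\<And>j. j \<in> {1..2} \<Longrightarrow> \<phi> (x j) = x j \<oplus>\<^bsub>A\<^esub> eval_magma A x u \<otimes>\<^bsub>A\<^esub> x j"
    by (rule inner_like_automorphism[OF J nil uJ]) (rule that)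
  define q where "q j = nonassoc_gen j \<oplus>\<^bsub>F\<^esub> magma_monomial (Br u (Gen j))" for j
  have W: "set_magma (Br u (Gen j)) \<subseteq> {1..2}" if "j \<in> {1..2}" for j using uS that by simp
  have q: "lifts q \<phi>"
    unfolding lifts_def
  proof (intro ballI conjI)
    fix j :: nat assume j: "j \<in> {1..2}"
    note C = nonassoc_gen_carrier[OF j] magma_monomial_carrier[OF W[OF j]]
    show "q j \<in> carrier F" unfolding q_def by (rule free_nonassoc.M.a_closed[OF C])
    show "proj (q j) = \<phi> (x j)"
      unfolding q_def using proj.hom_add[OF C] proj_gen[OF j] eval_magma_proj[OF W[OF j]] \<phi>(2)[OF j] by simp
  qed
  have "\<not> approximately_tame A x 2 \<phi>"
  proof
    assume tame: "approximately_tame A x 2 \<phi>"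
    let ?D = "prod_list (map Suc cs)"
    have D: "1 \<le> ?D" using deg by simp
    obtain p where lin: "linear_tuple p"
      and p: "\<And>j. j \<in> {1..2} \<Longrightarrow> p j \<in> carrier F"
      and diff: "\<And>j. j \<in> {1..2} \<Longrightarrow> \<exists>r\<in>degree_above 2 ?D. \<exists>s\<in>polynilpotent_relations cs 2. q j = p j \<oplus>\<^bsub>F\<^esub> (r \<oplus>\<^bsub>F\<^esub> s)"
      by (rule approximately_tame_lifts[where \<Phi> = linear_tuple, OF tame q D linear_tuple_gen])
        (rule linear_tuple_step[OF refl] that; assumption)+
    \<comment> \<open>A generator whose direction differs from that of \<open>u\<close>, so that
      their bracket does not vanish.\<close>
    define j :: nat where "j = (if i = 1 then 2 else 1)"
    have j: "j \<in> {1, 2}" "i \<noteq> j" by (auto simp: j_def)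
    have j2: "j \<in> {1..2}" using j by auto
    define k where "k = 6 - i - j"
    have "pauli_word TYPE('k) (Br u (Gen j)) k" unfolding k_def by (rule pauli_word_Br[OF u(2) pauli_word_Gen[OF j(1)] j(2)])
    from pauli_wordD(4)[OF this] obtain e :: 'k where e: "e \<noteq> 0" "mat2_eval pauli_point (Br u (Gen j)) = pauli k (Polynomial.monom e (magma_degree u + 1))"
      unfolding magma_degree.simps by blast
    define b :: "nat \<Rightarrow> 'k poly mat2 \<times> 'k poly vec2" where "b = point pauli_point (\<lambda>_. 0)"
    have b: "b l \<in> aff_filtration 1" for l
      by (auto simp: b_def pauli_point_def pauli.simps aff_filtration_def zero_prod_def)
    obtain r s where rs: "r \<in> degree_above 2 ?D" "s \<in> polynilpotent_relations cs 2" "q j = p j \<oplus>\<^bsub>F\<^esub> (r \<oplus>\<^bsub>F\<^esub> s)"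
      using diff[OF j2] by blast
    have mem: "free_ext aff b (q j) - free_ext aff b (p j) \<in> aff_filtration ?D"
      by (rule difference_in_filtration[where b = b, OF p[OF j2] rs(3,1,2) order_refl b])
    obtain k1 k2 where "free_ext aff b (p j) = aff_smult k1 (b 1) + aff_smult k2 (b 2)"
      using lin j2 unfolding linear_tuple_def by blast
    moreover have "free_ext aff b (q j) = b j + eval_magma aff b (Br u (Gen j))"
      unfolding q_def using aff_ext_simps(1)[OF nonassoc_gen_carrier[OF j2] magma_monomial_carrier[OF W[OF j2]], of b]
        aff_ext_monomial[OF W[OF j2], of b] j2 by (simp del: free_nonassoc_sel)
    ultimately have "fst (free_ext aff b (q j) - free_ext aff b (p j)) =
        pauli_point j + pauli k (Polynomial.monom e (magma_degree u + 1)) -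
        (fst (aff_smult k1 (b 1)) + fst (aff_smult k2 (b 2)))"
      using e(2) fst_eval_magma[of "pauli_point :: nat \<Rightarrow> 'k poly mat2" "\<lambda>_. 0" "Br u (Gen j)"]
      by (simp add: b_def del: eval_magma.simps mat2_eval.simps)
    moreover obtain m1 m2 m3 m4 where m: "fst (free_ext aff b (q j) - free_ext aff b (p j)) = (m1, m2, m3, m4)"
      by (metis prod.collapse)
    ultimately have eq: "(m1, m2, m3, m4) = pauli_point j + pauli k (Polynomial.monom e (magma_degree u + 1)) -
        (fst (aff_smult k1 (b 1)) + fst (aff_smult k2 (b 2)))" by simp
    have "Polynomial.monom 1 ?D dvd m1" "Polynomial.monom 1 ?D dvd m2"
      using aff_filtration_fst[OF mem m] by simp_all
    then have zero: "Polynomial.coeff m1 (magma_degree u + 1) = 0" "Polynomial.coeff m2 (magma_degree u + 1) = 0"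
      using coeff_eq_zero_if_monom_dvd deg by (metis Suc_1 Suc_eq_plus1 Suc_le_lessD add_Suc_right)+
    have "magma_degree u \<noteq> 0" using magma_degree_pos[of u] by simp
    \<comment> \<open>The upper row of the matrix is enough: direction 1 shows on the diagonal,
      directions 2 and 3 beside it. The linear terms sit in degree 1, and \<open>u\<close> has
      positive degree, so they do not interfere.\<close>
    then have "Polynomial.coeff (if k = 1 then m1 else m2) (magma_degree u + 1) = e"
      using eq j(1) by (auto simp: b_def pauli_point_def pauli.simps zero_prod_def split: if_splits)
    with zero e(1) show False by (simp split: if_splits)
  qed
  then show ?thesis using \<phi>(1) by (auto simp: absolutely_wild_def)
qed

section \<open>Choice of the automorphism according to rank and classes\<close>

theorem theorem6:
  fixes cs :: "nat list" and n :: nat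
  assumes "cs \<noteq> []" and "\<forall>c\<in>set cs. c \<ge> 1"
    and "(polynilpotent_variety cs :: ('k::field_char_0, 'a) module set) \<noteq> abelian_variety"
    and "(polynilpotent_variety cs :: ('k, 'a) module set)
      \<noteq> variety_product abelian_variety abelian_variety"
    and "n \<ge> 2"
  shows "\<exists>\<phi>. absolutely_wild
    (free_polynilpotent cs n :: ('k, (nat magma \<Rightarrow> 'k) set set) module)
    (free_polynilpotent_gen cs n) n \<phi>"
proof -
  let ?A = "free_polynilpotent cs n :: ('k, (nat magma \<Rightarrow> 'k) set set) module"
  let ?t = "Polynomial.monom 1 1 :: 'k poly"
  note rf = relatively_free_free_polynilpotent[of cs n, where ?'k = 'k]
  interpret relatively_free ?A "free_polynilpotent_gen cs n" n cs
      "\<lambda>f. polynilpotent_ideal (free_lie n) cs +>\<^bsub>free_lie n\<^esub> (lie_ideal n +>\<^bsub>free_nonassoc n\<^esub> f)"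
    by (rule rf)
  \<comment> \<open>For the lists \<open>[1]\<close> and \<open>[1, 1]\<close> the recursion unfolds
    to the two excluded varieties.\<close>
  have cs1: "cs \<noteq> [1]" and cs11: "cs \<noteq> [1, 1]"
    using assms(3,4) by (auto simp: abelian_variety_def)
  obtain cs' c where cs: "cs = cs' @ [c]" using assms(1) by (metis rev_exhaust)
  have c: "c \<ge> 1" and cs'_pos: "\<forall>c\<in>set cs'. c \<ge> 1" using assms(2) by (auto simp: cs)
  show ?thesis
  proof (cases "cs' = []")
    case True
    then have c2: "c \<ge> 2" using c cs1 by (simp add: cs)
    \<comment> \<open>The only word here is a generator and not a commutator, so it may be sent to a
      scalar matrix. The trace 2 t already appears for d = 1, and c \<ge> 2 gives d + 2 \<le> c +
      1.\<close>
    define P :: "nat \<Rightarrow> 'k poly mat2" where "P i = (if i = 1 then (?t, 0, 0, ?t) else (0, 0, 0, 0))" for i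
    show ?thesis
    proof (rule wild_ads_automorphism[where ws = "[Gen 1]" and u = "Gen 1" and s = 2 and \<kappa> = 1 and d = 1 and P = P, OF cs])
      show "(P i, basis_vec z i) \<in> aff_filtration 1" for i z
        by (auto simp: P_def aff_filtration_def basis_vec_def)
      show "1 + 2 \<le> prod_list (map Suc cs)" using c2 True by (simp add: cs)
      show "foldr (\<lambda>w. mat2_act (mat2_eval P w)) [Gen 1] z = (Polynomial.monom 1 1 * fst z, Polynomial.monom 1 1 * snd z)" for z
        by (cases z) (simp add: P_def)
    qed (use assms(5) True in auto)
  next
    case False
    let ?D' = "prod_list (map Suc cs')"
    have D: "prod_list (map Suc cs) = ?D' * (c + 1)" by (simp add: cs)
    obtain u i where u: "poly_word cs' u" "pauli_word TYPE('k) u i"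
      and deg: "cs' = [1] \<and> magma_degree u = 2 \<or>
        3 \<le> ?D' \<and> magma_degree u + (if i = 3 then 1 else 0) + 3 \<le> 2 * ?D'"
      using poly_word_exists[OF False cs'_pos] by blast
    have le: "2 * ?D' \<le> prod_list (map Suc cs)" unfolding D using c by (simp add: mult.commute)
    show ?thesis
    proof (cases "n = 2")
      case True
      have "magma_degree u + 2 \<le> 2 * ?D'" using deg by auto
      with le have "magma_degree u + 2 \<le> prod_list (map Suc cs)" by (rule order_trans[rotated])
      with wild_rank_two[OF rf[unfolded True] cs u] show ?thesis unfolding True by blast
    next
      case False
      then have n: "3 \<le> n" using assms(5) by simp
      \<comment> \<open>A word in direction 1 or 2 is wanted, so that the generator of the same
        direction makes the product scalar. Direction 3 is left by one more bracket with
        x_1.\<close>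
      have "\<exists>v y. poly_word cs' v \<and> pauli_word TYPE('k) v y \<and> y \<noteq> 3 \<and> magma_degree v + 3 \<le> prod_list (map Suc cs)"
      proof (cases "i = 3")
        case True
        have "magma_degree u + 4 \<le> prod_list (map Suc cs)"
        proof (cases "cs' = [1] \<and> magma_degree u = 2")
          case True
          \<comment> \<open>The word of degree 2 grows to degree 3, and 3 + 3 \<le> 2 (c + 1)
            amounts to c \<ge> 2; this is where the metabelian variety has to be excluded.\<close>
          then have "c \<ge> 2" using c cs11 by (auto simp: cs)
          then show ?thesis unfolding D using True by simp
        next
          case False
          then show ?thesis using deg le True by auto
        qed
        moreover have "pauli_word TYPE('k) (Br u (Gen 1)) 2"
          using pauli_word_Br[OF u(2) pauli_word_Gen[of 1]] True by simp
        ultimately show ?thesis using poly_word_Br[OF u(1)]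
          by (intro exI[of _ "Br u (Gen 1)"] exI[of _ 2]) simp
      next
        case False
        have "odd (magma_degree u)" using pauli_wordD(3)[OF u(2)] False by simp
        then have "magma_degree u + 3 \<le> 2 * ?D'" using deg by auto
        then show ?thesis using u False le by (intro exI[of _ u] exI[of _ i]) simp
      qed
      then obtain v y where v: "poly_word cs' v" "pauli_word TYPE('k) v y" "y \<noteq> 3"
        and dv: "magma_degree v + 3 \<le> prod_list (map Suc cs)" by blast
      have y: "y = 1 \<or> y = 2" using pauli_wordD(2)[OF v(2)] v(3) by auto
      obtain e :: 'k where e: "e \<noteq> 0" "mat2_eval pauli_point v = pauli y (Polynomial.monom e (magma_degree v))"
        using pauli_wordD(4)[OF v(2)] by blast
      show ?thesis
      proof (rule wild_ads_automorphism[where ws = "[Gen y, v]" and u = v and s = 3 and \<kappa> = e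
            and d = "1 + magma_degree v" and P = pauli_point, OF cs])
        show "(pauli_point i, basis_vec z i) \<in> aff_filtration 1" for i z
          by (auto simp: pauli_point_def pauli.simps aff_filtration_def basis_vec_def)
        show "1 + magma_degree v + 2 \<le> prod_list (map Suc cs)" using dv by simp
        show "2 * e \<noteq> 0" using e by simp
        show "set_magma w \<subseteq> {1..n} - {3}" if "w \<in> set [Gen y, v]" for w
          using that pauli_wordD(1)[OF v(2)] y n by auto
        show "foldr (\<lambda>w. mat2_act (mat2_eval pauli_point w)) [Gen y, v] z =
            (Polynomial.monom e (1 + magma_degree v) * fst z, Polynomial.monom e (1 + magma_degree v) * snd z)" for z
        proof -
          \<comment> \<open>The squares of the matrices in directions 1 and 2 are the identity, so
            the product of the values of the letter and of \<open>v\<close> is scalar, with the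
            product of their factors.\<close>
          have "?t * Polynomial.monom e (magma_degree v) = Polynomial.monom e (1 + magma_degree v)"
            by (simp add: mult_monom)
          then show ?thesis using y
            by (cases z) (auto simp: e(2) pauli_point_def pauli.simps simp flip: mult.assoc)
        qed
      qed (use n v in auto)
    qed
  qed
qed

end
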